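(* There exist absolute constants $s_0,c_0,c_1,c_2,C>0$ such that the following holds in the multinomial model described in the context. Suppose $s\geq s_0$, $\frac{s^2d}{n\theta^*_{\min}}\leq c_0$, and $\delta_{01}^*(2s)\leq\sqrt{nd}/6$. Then on an event of probability at least $1-\exp(-c_1ds^2)$, it holds $$\mathrm{TV}(\pi_v,\gamma^* )\leq C\left(\frac{sd}{\sqrt{n\theta^*_{\min}}}+\frac{\delta_{01}^*(2s)}{\sqrt n}+e^{d(M_0^*-c_2s^2)}\right).$$
   Context: Model. $\Theta=\{\theta=(\theta_1,\dots,\theta_d)\in\mathbb R^d:\theta_j>0\ \forall j=1,\dots,d,\ \theta_1+\dots+\theta_d<1\}$; for $\theta\in\mathbb R^d$ set $\theta_0=1-\sum_{j=1}^d\theta_j$, so that for $\theta\in\Theta$, $(\theta_0,\dots,\theta_d)$ is a strictly positive probability mass function on $d+1$ states. For a ground truth $\theta^*\in\Theta$, one observes counts $N=(N_0,\dots,N_d)\sim\mathrm{Multinomial}(n,(\theta_0^*,\dots,\theta_d^* ))$; $\bar N_j=N_j/n$, and $\theta^*_{\min}=\min_{j=0,\dots,d}\theta_j^*$. Normalized negative log likelihood: $\ell(\theta)=-\sum_{j=0}^d\bar N_j\log\theta_j$, $\theta\in\Theta$, regarded as a function of the free parameters $\theta_1,\dots,\theta_d$. The MLE is $\hat\theta=\arg\min_{\theta\in\Theta}\ell(\theta)$ when it exists and is unique. The Fisher information matrix is $F^*=\mathrm{diag}\big((1/\theta_j^* )_{j=1}^d\big)+\frac1{\theta_0^*}\mathbf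 1\mathbf 1^\top\in\mathbb R^{d\times d}$, with $\mathbf 1$ the all-ones vector. The prior is a probability density $\pi_0$ strictly positive on $\Theta$; the posterior is $\pi_v(\theta)\propto e^{-n\ell(\theta)}\pi_0(\theta)$, $\theta\in\Theta$; and $\gamma^*=\mathcal N(\hat\theta,(nF^* )^{-1})$ (the assertion that a bound on $\mathrm{TV}(\pi_v,\gamma^* )$ holds on an event includes that $\hat\theta$ exists and is unique on that event). $|u|_{F^*}=|(F^* )^{1/2}u|$; for a gradient vector $S$, $\|S\|_{F^*}=|(F^* )^{-1/2}S|$. $\mathcal U^*(s)=\{\theta\in\mathbb R^d:|\theta-\theta^*|_{F^*}\le s\sqrt{d/n}\}$; $\delta_{01}^*(s)=\sup_{\theta\in\mathcal U^*(s)}\|\nabla\log\pi_0(\theta)\|_{F^*}$, with $\delta_{01}^*(s)=\infty$ if $\pi_0$ is not $C^1$ or not strictly positive on $\mathcal U^*(s)$; $M_0^*=d^{-1}\log\sup_{\theta\in\Theta}\pi_0(\theta)/\pi_0(\theta^* )$. $\mathrm{TV}(P,Q)=\sup_B|P(B)-Q(B)|$. *)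

theory Defs
  imports
    "HOL-Probability.Probability"
    "Jordan_Normal_Form.Determinant"
    "Jordan_Normal_Form.Gauss_Jordan_Elimination"
begin

text \<open>
  The constants of the main statement are chosen before the dimension \<open>d\<close>, so the dimension
  cannot be a type. A point of \<open>d\<close>-dimensional Euclidean space is a function on \<open>{1..d}\<close>
  that is \<open>undefined\<close> elsewhere; on the set of these functions the product topology is the
  Euclidean one and the product of \<open>d\<close> copies of \<open>lborel\<close> is Lebesgue measure.
\<close>

abbreviation Rd :: "nat \<Rightarrow> (nat \<Rightarrow> real) set" where
  "Rd d \<equiv> {1..d} \<rightarrow>\<^sub>E UNIV"

abbreviation lborel_d :: "nat \<Rightarrow> (nat \<Rightarrow> real) measure" where
  "lborel_d d \<equiv> PiM {1..d} (\<lambda>_. lborel)"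

section \<open>Linear algebra\<close>

text \<open>Matrices and column vectors are those of \<^theory>\<open>Jordan_Normal_Form.Matrix\<close>, whose
  indices start at 0.\<close>

definition coord_vec :: "nat \<Rightarrow> (nat \<Rightarrow> real) \<Rightarrow> real Matrix.vec" where
  "coord_vec d u = Matrix.vec d (\<lambda>i. u (Suc i))"

definition vnorm :: "real Matrix.vec \<Rightarrow> real" where
  "vnorm v = sqrt (scalar_prod v v)"

definition minv :: "real Matrix.mat \<Rightarrow> real Matrix.mat" where
  "minv A = the (mat_inverse A)"

definition is_psd_sqrt :: "real Matrix.mat \<Rightarrow> real Matrix.mat \<Rightarrow> bool" where
  "is_psd_sqrt A R \<longleftrightarrow>
     R \<in> carrier_mat (dim_row A) (dim_row A) \<and> transpose_mat R = R \<and>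
     (\<forall>v \<in> carrier_vec (dim_row A). 0 \<le> scalar_prod v (R *\<^sub>v v)) \<and> R * R = A"

text \<open>A symmetric positive semidefinite matrix has exactly one such root.\<close>
definition msqrt :: "real Matrix.mat \<Rightarrow> real Matrix.mat" where
  "msqrt A = (SOME R. is_psd_sqrt A R)"

definition wnorm :: "real Matrix.mat \<Rightarrow> nat \<Rightarrow> (nat \<Rightarrow> real) \<Rightarrow> real" where
  "wnorm F d u = vnorm (msqrt F *\<^sub>v coord_vec d u)"

definition wnorm_dual :: "real Matrix.mat \<Rightarrow> nat \<Rightarrow> (nat \<Rightarrow> real) \<Rightarrow> real" where
  "wnorm_dual F d S = vnorm (minv (msqrt F) *\<^sub>v coord_vec d S)"

definition gaussian :: "nat \<Rightarrow> (nat \<Rightarrow> real) \<Rightarrow> real Matrix.mat \<Rightarrow> (nat \<Rightarrow> real) measure" where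
  "gaussian d \<mu> \<Sigma> = density (lborel_d d) (\<lambda>x.
     let v = coord_vec d (\<lambda>j. x j - \<mu> j) in
     ennreal (exp (- scalar_prod v (minv \<Sigma> *\<^sub>v v) / 2) / sqrt ((2 * pi) ^ d * Determinant.det \<Sigma>)))"

section \<open>Differentiability\<close>

definition grad :: "nat \<Rightarrow> ((nat \<Rightarrow> real) \<Rightarrow> real) \<Rightarrow> (nat \<Rightarrow> real) \<Rightarrow> (nat \<Rightarrow> real)" where
  "grad d f x = (\<lambda>j \<in> {1..d}. deriv (\<lambda>t. f (x(j := t))) (x j))"

text \<open>The second conjunct is Frechet differentiability at \<open>x\<close>; the function is
  differentiated as a function on the whole space, also at boundary points of \<open>U\<close>.\<close>
definition C1_on :: "nat \<Rightarrow> ((nat \<Rightarrow> real) \<Rightarrow> real) \<Rightarrow> (nat \<Rightarrow> real) set \<Rightarrow> bool" where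
  "C1_on d f U \<longleftrightarrow>
     (\<forall>j \<in> {1..d}. continuous_on U (\<lambda>x. grad d f x j)) \<and>
     (\<forall>x \<in> U. ((\<lambda>y. (f y - f x - (\<Sum>j = 1..d. grad d f x j * (y j - x j)))
                  / L2_set (\<lambda>j. y j - x j) {1..d}) \<longlongrightarrow> 0) (at x within Rd d))"

section \<open>The multinomial model\<close>

definition full :: "nat \<Rightarrow> (nat \<Rightarrow> real) \<Rightarrow> nat \<Rightarrow> real" where
  "full d \<theta> j = (if j = 0 then 1 - (\<Sum>i = 1..d. \<theta> i) else \<theta> j)"

definition Theta :: "nat \<Rightarrow> (nat \<Rightarrow> real) set" where
  "Theta d = {\<theta> \<in> Rd d. (\<forall>j \<in> {1..d}. 0 < \<theta> j) \<and> (\<Sum>j = 1..d. \<theta> j) < 1}"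

definition theta_min :: "nat \<Rightarrow> (nat \<Rightarrow> real) \<Rightarrow> real" where
  "theta_min d \<theta> = Min (full d \<theta> ` {0..d})"

definition categorical_pmf :: "nat \<Rightarrow> (nat \<Rightarrow> real) \<Rightarrow> nat pmf" where
  "categorical_pmf d \<theta> = embed_pmf (\<lambda>j. if j \<le> d then full d \<theta> j else 0)"

lemma full_pos:
  assumes "\<theta> \<in> Theta d" "j \<le> d"
  shows "0 < full d \<theta> j"
  using assms by (auto simp: full_def Theta_def)

lemma sum_full: "(\<Sum>j = 0..d. full d \<theta> j) = 1"
proof -
  have "(\<Sum>j = 0..d. full d \<theta> j) = full d \<theta> 0 + (\<Sum>j = 1..d. full d \<theta> j)"
    by (simp add: sum.atLeast_Suc_atMost)
  also have "(\<Sum>j = 1..d. full d \<theta> j) = (\<Sum>j = 1..d. \<theta> j)"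
    by (intro sum.cong) (auto simp: full_def)
  finally show ?thesis by (simp add: full_def)
qed

lemma pmf_categorical:
  assumes "\<theta> \<in> Theta d"
  shows "pmf (categorical_pmf d \<theta>) j = (if j \<le> d then full d \<theta> j else 0)"
  unfolding categorical_pmf_def
proof (rule pmf_embed_pmf)
  let ?f = "\<lambda>j. if j \<le> d then full d \<theta> j else 0"
  show nonneg: "0 \<le> ?f j" for j using full_pos[OF assms, of j] by auto
  have "(\<integral>\<^sup>+ j. ennreal (?f j) \<partial>count_space UNIV) = (\<Sum>j \<in> {0..d}. ennreal (?f j))"
    by (intro nn_integral_count_space') auto
  also have "\<dots> = ennreal (\<Sum>j \<in> {0..d}. ?f j)"
    by (intro sum_ennreal nonneg)
  also have "(\<Sum>j \<in> {0..d}. ?f j) = (\<Sum>j \<in> {0..d}. full d \<theta> j)"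
    by (intro sum.cong) auto
  finally show "(\<integral>\<^sup>+ j. ennreal (?f j) \<partial>count_space UNIV) = 1"
    by (simp add: sum_full)
qed

text \<open>The law of the counts \<open>N\<close>, where \<open>N j\<close> is the number of occurrences of state \<open>j\<close>
  in \<open>n\<close> independent draws.\<close>
definition multinomial_pmf :: "nat \<Rightarrow> nat \<Rightarrow> (nat \<Rightarrow> real) \<Rightarrow> (nat \<Rightarrow> nat) pmf" where
  "multinomial_pmf n d \<theta> = map_pmf count_list (replicate_pmf n (categorical_pmf d \<theta>))"

definition nll :: "nat \<Rightarrow> nat \<Rightarrow> (nat \<Rightarrow> nat) \<Rightarrow> (nat \<Rightarrow> real) \<Rightarrow> real" where
  "nll n d N \<theta> = - (\<Sum>j = 0..d. (real (N j) / real n) * ln (full d \<theta> j))"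

definition is_MLE :: "nat \<Rightarrow> nat \<Rightarrow> (nat \<Rightarrow> nat) \<Rightarrow> (nat \<Rightarrow> real) \<Rightarrow> bool" where
  "is_MLE n d N t \<longleftrightarrow> t \<in> Theta d \<and> (\<forall>\<theta> \<in> Theta d. nll n d N t \<le> nll n d N \<theta>)"

definition MLE :: "nat \<Rightarrow> nat \<Rightarrow> (nat \<Rightarrow> nat) \<Rightarrow> (nat \<Rightarrow> real)" where
  "MLE n d N = (THE t. is_MLE n d N t)"

definition fisher :: "nat \<Rightarrow> (nat \<Rightarrow> real) \<Rightarrow> real Matrix.mat" where
  "fisher d \<theta> = Matrix.mat d d (\<lambda>(i, k).
     (if i = k then 1 / full d \<theta> (Suc i) else 0) + 1 / full d \<theta> 0)"

definition prior_density :: "nat \<Rightarrow> ((nat \<Rightarrow> real) \<Rightarrow> real) \<Rightarrow> bool" where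
  "prior_density d \<pi>\<^sub>0 \<longleftrightarrow>
     \<pi>\<^sub>0 \<in> borel_measurable (lborel_d d) \<and> (\<forall>\<theta> \<in> Rd d. 0 \<le> \<pi>\<^sub>0 \<theta>) \<and>
     (\<integral>\<^sup>+ \<theta>. ennreal (\<pi>\<^sub>0 \<theta>) \<partial>lborel_d d) = 1 \<and> (\<forall>\<theta> \<in> Theta d. 0 < \<pi>\<^sub>0 \<theta>)"

definition posterior ::
  "nat \<Rightarrow> nat \<Rightarrow> (nat \<Rightarrow> nat) \<Rightarrow> ((nat \<Rightarrow> real) \<Rightarrow> real) \<Rightarrow> (nat \<Rightarrow> real) measure" where
  "posterior n d N \<pi>\<^sub>0 =
     (let w = (\<lambda>\<theta>. ennreal (exp (- real n * nll n d N \<theta>) * \<pi>\<^sub>0 \<theta>) * indicator (Theta d) \<theta>)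
      in density (lborel_d d) (\<lambda>\<theta>. w \<theta> / (\<integral>\<^sup>+ \<theta>'. w \<theta>' \<partial>lborel_d d)))"

definition TV :: "'a measure \<Rightarrow> 'a measure \<Rightarrow> real" where
  "TV P Q = (SUP B \<in> sets P. \<bar>measure P B - measure Q B\<bar>)"

definition Ustar :: "nat \<Rightarrow> nat \<Rightarrow> (nat \<Rightarrow> real) \<Rightarrow> real \<Rightarrow> (nat \<Rightarrow> real) set" where
  "Ustar n d \<theta>s s =
     {\<theta> \<in> Rd d. wnorm (fisher d \<theta>s) d (\<lambda>j. \<theta> j - \<theta>s j) \<le> s * sqrt (real d / real n)}"

definition delta01 ::
  "nat \<Rightarrow> nat \<Rightarrow> (nat \<Rightarrow> real) \<Rightarrow> ((nat \<Rightarrow> real) \<Rightarrow> real) \<Rightarrow> real \<Rightarrow> ereal" where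
  "delta01 n d \<theta>s \<pi>\<^sub>0 s =
     (if C1_on d \<pi>\<^sub>0 (Ustar n d \<theta>s s) \<and> (\<forall>\<theta> \<in> Ustar n d \<theta>s s. 0 < \<pi>\<^sub>0 \<theta>)
      then SUP \<theta> \<in> Ustar n d \<theta>s s.
             ereal (wnorm_dual (fisher d \<theta>s) d (grad d (\<lambda>x. ln (\<pi>\<^sub>0 x)) \<theta>))
      else \<infinity>)"

text \<open>The prior need not be bounded, so the supremum in \<open>M0\<close> may be infinite.\<close>

definition ln_ereal :: "ereal \<Rightarrow> ereal" where
  "ln_ereal x = (if x = \<infinity> then \<infinity> else if x \<le> 0 then -\<infinity> else ereal (ln (real_of_ereal x)))"

definition exp_ereal :: "ereal \<Rightarrow> ereal" where
  "exp_ereal x = (if x = \<infinity> then \<infinity> else if x = -\<infinity> then 0 else ereal (exp (real_of_ereal x)))"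

definition M0 :: "nat \<Rightarrow> (nat \<Rightarrow> real) \<Rightarrow> ((nat \<Rightarrow> real) \<Rightarrow> real) \<Rightarrow> ereal" where
  "M0 d \<theta>s \<pi>\<^sub>0 = ln_ereal (SUP \<theta> \<in> Theta d. ereal (\<pi>\<^sub>0 \<theta> / \<pi>\<^sub>0 \<theta>s)) / ereal (real d)"

end

theory Submission
  imports Defs "HOL-Real_Asymp.Real_Asymp" "Jordan_Normal_Form.Char_Poly"
begin

text \<open>For a flat prior the posterior is the Dirichlet distribution with parameters \<open>N j + 1\<close>. Its
  Kullback-Leibler divergence from the Gaussian is elementary: Stirling's formula controls the
  normalizing constants, and the remaining terms are central moments of order at most three of the
  Dirichlet distribution.

  On the ball \<open>U\<close> of radius \<open>2 s \<surd>(d / n)\<close> the logarithm of the prior is Lipschitz and the logarithm of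
  the Dirichlet density is uniformly concave, so the Prekopa-Leindler inequality bounds the
  chi-square divergence between the restrictions to \<open>U\<close> of the general and the flat posterior.
  Outside \<open>U\<close> the likelihood is exponentially small: by convexity of the relative entropy along rays
  from the maximum likelihood estimate it is at least of order \<open>d s\<^sup>2 / n\<close> there, and replacing the
  likelihood by its square root costs only a factor \<open>exp (O(d))\<close>.

  The event is that the relative entropy of the empirical frequencies from \<open>\<theta>s\<close> is at most of order
  \<open>d s\<^sup>2 / n\<close>. Its probability comes from an exponential moment, which splits by the chain rule into
  binomial ones.\<close>

text \<open>The constants may not depend on \<open>d\<close>. A factor \<open>exp (O(d))\<close> is
  therefore affordable only in tails, where \<open>exp (- c d s^2)\<close> with \<open>s\<close>
  large absorbs it; in the bulk nothing of the kind may be lost. This rules out a pointwise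
  expansion on \<open>U\<close>: there the third order term of the log-likelihood can be of order
  \<open>s^3 d^(3/2) / sqrt (n theta_min)\<close>, more than is claimed. Integrated against the
  Dirichlet law it leaves only a small third moment, and the divergence becomes quadratically small,
  of order \<open>s^2 d^2 / (n theta_min)\<close>. The Gaussian has its covariance at the truth and
  its mean at the estimate. This mismatch is of first order in the relative error of the
  frequencies, but the first order terms of the quadratic form and of the log determinant cancel in
  expectation. The prior has only a Lipschitz logarithm, so no expansion of it is available. Applied
  to \<open>p g^2\<close>, \<open>p\<close> and \<open>p g\<close>, with \<open>g\<close> the prior
  and \<open>p\<close> the Dirichlet density, Prekopa-Leindler gives directly the second moment of
  the density ratio.\<close>

hide_const (open) Polynomial.order Order.top
no_notation inner (infix "\<bullet>" 70)

section \<open>The one-dimensional and iterated Prekopa-Leindler inequality\<close>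

lemma emeasure_lborel_preimage_double:
  fixes A :: "real set"
  assumes [measurable]: "A \<in> sets borel"
  shows "2 * emeasure lborel {z. 2 * z - b \<in> A} = emeasure lborel A"
proof -
  have "emeasure lborel A = (\<integral>\<^sup>+x. indicator A x \<partial>lborel)"
    by simp
  also have "\<dots> = 2 * (\<integral>\<^sup>+z. indicator A (- b + 2 * z) \<partial>lborel)"
    by (subst nn_integral_real_affine[where c = 2 and t = "- b"]) auto
  also have "(\<integral>\<^sup>+z. indicator A (- b + 2 * z) \<partial>lborel) = (\<integral>\<^sup>+z. indicator {z. 2 * z - b \<in> A} z \<partial>lborel)"
    by (intro nn_integral_cong) (auto simp: indicator_def add.commute)
  also have "\<dots> = emeasure lborel {z. 2 * z - b \<in> A}"
    by (rule nn_integral_indicator) measurable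
  finally show ?thesis by simp
qed

text \<open>The translated halves \<open>(A + b) / 2\<close> and \<open>(a + B) / 2\<close> both lie
  in \<open>C\<close>. With \<open>a\<close> close to \<open>Sup A\<close> and \<open>b\<close>
  close to \<open>Inf B\<close> they overlap in a short interval only, so their measures almost add
  up. \<open>C\<close> is a separate Borel set because the half-sum of two Borel sets need not be
  Borel.\<close>

lemma midpoint_set_emeasure_bounded:
  fixes A B C :: "real set"
  assumes [measurable]: "A \<in> sets borel" "B \<in> sets borel" "C \<in> sets borel"
    and "A \<noteq> {}" "B \<noteq> {}" "bdd_above A" "bdd_below B"
    and C: "\<And>x y. x \<in> A \<Longrightarrow> y \<in> B \<Longrightarrow> (x + y) / 2 \<in> C"
  shows "emeasure lborel A + emeasure lborel B \<le> 2 * emeasure lborel C"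
proof (rule ennreal_le_epsilon)
  fix e :: real assume "e > 0"
  have "Sup A - e / 4 < Sup A" using \<open>e > 0\<close> by simp
  then obtain a where a: "a \<in> A" "Sup A - e / 4 < a"
    using less_cSup_iff[OF assms(4,6)] by blast
  have "Inf B < Inf B + e / 4" using \<open>e > 0\<close> by simp
  then obtain b where b: "b \<in> B" "b < Inf B + e / 4"
    using cInf_less_iff[OF assms(5,7)] by blast
  define T1 T2 where "T1 = {z. 2 * z - b \<in> A}" and "T2 = {z. 2 * z - a \<in> B}"
  have [measurable]: "T1 \<in> sets lborel" "T2 \<in> sets lborel"
    unfolding T1_def T2_def by measurable
  have sub: "T1 \<union> T2 \<subseteq> C"
  proof
    fix z assume "z \<in> T1 \<union> T2"
    then show "z \<in> C"
      using C[of "2*z-b" b] C[of a "2*z-a"] a b by (auto simp: T1_def T2_def)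
  qed
  have int: "T1 \<inter> T2 \<subseteq> {(a + Inf B) / 2 .. (Sup A + b) / 2}"
    using cSup_upper[OF _ assms(6)] cInf_lower[OF _ assms(7)]
    by (fastforce simp: T1_def T2_def)
  have "emeasure lborel (T1 \<inter> T2) \<le> emeasure lborel {(a + Inf B) / 2 .. (Sup A + b) / 2}"
    by (intro emeasure_mono int) auto
  also have "\<dots> \<le> ennreal (e / 4)"
    using a b cInf_lower[OF b(1) assms(7)] cSup_upper[OF a(1) assms(6)]
    by (subst emeasure_lborel_Icc) (auto intro!: ennreal_leI simp: field_simps)
  finally have int_le: "emeasure lborel (T1 \<inter> T2) \<le> ennreal (e / 4)" .
  have "emeasure lborel T1 + emeasure lborel T2
      = emeasure lborel (T1 \<union> T2) + emeasure lborel (T1 \<inter> T2)"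
    by (rule emeasure_Un_Int) measurable
  also have "\<dots> \<le> emeasure lborel C + ennreal (e / 4)"
    by (intro add_mono emeasure_mono sub int_le) auto
  finally have "2 * (emeasure lborel T1 + emeasure lborel T2) \<le> 2 * (emeasure lborel C + ennreal (e / 4))"
    by (intro mult_left_mono) auto
  moreover have "2 * emeasure lborel T1 = emeasure lborel A" "2 * emeasure lborel T2 = emeasure lborel B"
    unfolding T1_def T2_def by (rule emeasure_lborel_preimage_double; simp)+
  moreover have "2 * ennreal (e / 4) \<le> ennreal e"
    using \<open>e > 0\<close> by (simp add: ennreal_numeral[symmetric] ennreal_mult[symmetric] ennreal_leI del: ennreal_numeral)
  ultimately show "emeasure lborel A + emeasure lborel B \<le> 2 * emeasure lborel C + ennreal e"
    by (simp add: distrib_left) (meson add_left_mono order_trans)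
qed

lemma midpoint_set_emeasure:
  fixes A B C :: "real set"
  assumes [measurable]: "A \<in> sets borel" "B \<in> sets borel" "C \<in> sets borel"
    and ne: "A \<noteq> {}" "B \<noteq> {}"
    and C: "\<And>x y. x \<in> A \<Longrightarrow> y \<in> B \<Longrightarrow> (x + y) / 2 \<in> C"
  shows "emeasure lborel A + emeasure lborel B \<le> 2 * emeasure lborel C"
proof -
  obtain a b where ab: "a \<in> A" "b \<in> B" using ne by blast
  \<comment> \<open>The truncation starts at \<open>k0\<close>, where \<open>a\<close> and
    \<open>b\<close> already survive, so that no truncated set is empty.\<close>
  define k0 :: nat where "k0 = nat \<lceil>max a (- b)\<rceil>"
  define A' B' where "A' = (\<lambda>k::nat. A \<inter> {..real (k + k0)})" and "B' = (\<lambda>k::nat. B \<inter> {- real (k + k0)..})"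
  have [measurable]: "A' k \<in> sets borel" "B' k \<in> sets borel" for k unfolding A'_def B'_def by auto
  have "a \<le> real k0" "- real k0 \<le> b" unfolding k0_def by linarith+
  then have ne': "A' k \<noteq> {}" "B' k \<noteq> {}" for k using ab by (force simp: A'_def B'_def)+
  have inc: "incseq A'" "incseq B'" by (auto simp: incseq_def A'_def B'_def)
  have U: "(\<Union>k. A' k) = A" "(\<Union>k. B' k) = B"
  proof -
    have "\<exists>k::nat. x \<le> real (k + k0) \<and> - real (k + k0) \<le> x" for x
    proof -
      obtain k :: nat where "\<bar>x\<bar> \<le> real k" using real_arch_simple by blast
      then show ?thesis by (intro exI[of _ k]) auto
    qed
    then show "(\<Union>k. A' k) = A" "(\<Union>k. B' k) = B" unfolding A'_def B'_def by blast+
  qed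
  have lim: "(\<lambda>k. emeasure lborel (A' k) + emeasure lborel (B' k))
      \<longlonglongrightarrow> emeasure lborel A + emeasure lborel B"
    using Lim_emeasure_incseq[of A' lborel] Lim_emeasure_incseq[of B' lborel] inc U
    by (intro tendsto_add) (auto simp: image_subset_iff)
  show ?thesis
  proof (rule LIMSEQ_le_const2[OF lim])
    have "emeasure lborel (A' k) + emeasure lborel (B' k) \<le> 2 * emeasure lborel C" for k
      by (rule midpoint_set_emeasure_bounded) (use ne' C in \<open>auto simp: A'_def B'_def intro!: bdd_aboveI bdd_belowI\<close>)
    then show "\<exists>N. \<forall>n\<ge>N. emeasure lborel (A' n) + emeasure lborel (B' n) \<le> 2 * emeasure lborel C"
      by blast
  qed
qed

lemma nn_integral_layer_cake:
  assumes [measurable]: "f \<in> borel_measurable (lborel :: real measure)"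
  shows "(\<integral>\<^sup>+x. f x \<partial>lborel) = (\<integral>\<^sup>+t. indicator {0<..} t * emeasure lborel {x. ennreal t < f x} \<partial>lborel)"
proof -
  have *: "f x = (\<integral>\<^sup>+t. indicator {0<..} t * indicator {t. ennreal t < f x} t \<partial>lborel)" for x
  proof -
    have "(\<integral>\<^sup>+t. indicator {0<..} t * indicator {t. ennreal t < f x} t \<partial>lborel)
        = (\<integral>\<^sup>+t. indicator {t. 0 < t \<and> ennreal t < f x} t \<partial>lborel)"
      by (intro nn_integral_cong) (auto simp: indicator_def)
    also have "\<dots> = emeasure lborel {t::real. 0 < t \<and> ennreal t < f x}"
      by (rule nn_integral_indicator) measurable
    also have "\<dots> = f x"
    proof (cases "f x")
      case (real c)
      then have "{t::real. 0 < t \<and> ennreal t < f x} = {0<..<c}"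
        by (auto simp: ennreal_less_iff)
      then show ?thesis using real by simp
    next
      case top
      then have "{t::real. 0 < t \<and> ennreal t < f x} = {0<..}" by auto
      moreover have "emeasure lborel {0::real<..} = \<infinity>"
      proof (rule ccontr)
        assume "emeasure lborel {0::real<..} \<noteq> \<infinity>"
        then obtain c where c: "emeasure lborel {0::real<..} = ennreal c" "c \<ge> 0"
          by (cases "emeasure lborel {0::real<..}") auto
        have "emeasure lborel {0::real<..c+1} \<le> emeasure lborel {0::real<..}"
          by (intro emeasure_mono) auto
        with c show False by (auto simp: ennreal_le_iff)
      qed
      ultimately show ?thesis using top by (simp add: infinity_ennreal_def)
    qed
    finally show ?thesis by simp
  qed
  have "(\<integral>\<^sup>+x. f x \<partial>lborel) = (\<integral>\<^sup>+x. (\<integral>\<^sup>+t. indicator {0<..} t * indicator {t. ennreal t < f x} t \<partial>lborel) \<partial>lborel)"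
    using * by simp
  also have "\<dots> = (\<integral>\<^sup>+t. (\<integral>\<^sup>+x. indicator {0<..} t * indicator {t. ennreal t < f x} t \<partial>lborel) \<partial>lborel)"
    by (rule lborel_pair.Fubini') (simp add: indicator_def case_prod_beta, measurable)
  also have "\<dots> = (\<integral>\<^sup>+t. indicator {0<..} t * emeasure lborel {x. ennreal t < f x} \<partial>lborel)"
  proof (rule nn_integral_cong)
    fix t :: real
    have "(\<integral>\<^sup>+x. indicator {0<..} t * indicator {t. ennreal t < f x} t \<partial>lborel)
       = (\<integral>\<^sup>+x. indicator {0<..} t * indicator {x. ennreal t < f x} x \<partial>lborel)"
      by (intro nn_integral_cong) (auto simp: indicator_def)
    also have "\<dots> = indicator {0<..} t * emeasure lborel {x. ennreal t < f x}"
      by (rule nn_integral_cmult_indicator) measurable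
    finally show "(\<integral>\<^sup>+x. indicator {0<..} t * indicator {t. ennreal t < f x} t \<partial>lborel) = \<dots>" .
  qed
  finally show ?thesis .
qed

text \<open>With equal suprema the level sets of \<open>f\<close> and \<open>g\<close> at height
  \<open>t\<close> are nonempty for the same \<open>t\<close>, namely \<open>t < 1\<close>, and
  midpoints between them lie in the level set of \<open>h\<close>. Integrating the inequality for
  sets over \<open>t\<close> gives an additive form, stronger than the product form.\<close>

lemma prekopa_leindler_normalized:
  fixes f g h :: "real \<Rightarrow> ennreal"
  assumes [measurable]: "f \<in> borel_measurable borel" "g \<in> borel_measurable borel" "h \<in> borel_measurable borel"
    and f: "(SUP x. f x) = 1" and g: "(SUP x. g x) = 1"
    and fgh: "\<And>x y. f x * g y \<le> (h ((x + y) / 2))\<^sup>2"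
  shows "(\<integral>\<^sup>+x. f x \<partial>lborel) + (\<integral>\<^sup>+x. g x \<partial>lborel) \<le> 2 * (\<integral>\<^sup>+x. h x \<partial>lborel)"
proof -
  have "emeasure lborel {x. ennreal t < f x} + emeasure lborel {x. ennreal t < g x}
      \<le> 2 * emeasure lborel {x. ennreal t < h x}" if "t > 0" for t
  proof (cases "t < 1")
    case True
    then have "ennreal t < 1" using that by (metis ennreal_1 ennreal_lessI less_numeral_extra(1))
    then have "\<exists>x. ennreal t < f x" "\<exists>x. ennreal t < g x"
      using f g by (metis less_SUP_iff)+
    moreover have "ennreal t < h ((x + y) / 2)" if "ennreal t < f x" "ennreal t < g y" for x y
    proof (rule ccontr)
      assume "\<not> ennreal t < h ((x + y) / 2)"
      then have "(h ((x + y) / 2))\<^sup>2 \<le> (ennreal t)\<^sup>2" by (intro power_mono) auto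
      also have "(ennreal t)\<^sup>2 < f x * ennreal t"
        unfolding power2_eq_square using that \<open>t > 0\<close>
        by (intro ennreal_mult_strict_right_mono) auto
      also have "f x * ennreal t \<le> f x * g y"
        using that by (intro mult_left_mono) auto
      finally show False using fgh[of x y] by simp
    qed
    ultimately show ?thesis
      by (intro midpoint_set_emeasure) auto
  next
    case False
    then have "1 \<le> ennreal t" by (metis ennreal_1 ennreal_leI not_less)
    moreover have "f x \<le> 1" "g x \<le> 1" for x using f g by (metis SUP_upper UNIV_I)+
    ultimately have "\<not> ennreal t < f x" "\<not> ennreal t < g x" for x
      by (meson leD order_trans)+
    then have "{x. ennreal t < f x} = {}" "{x. ennreal t < g x} = {}" by auto
    then show ?thesis by simp
  qed
  then have "(\<integral>\<^sup>+t. indicator {0<..} t * emeasure lborel {x. ennreal t < f x} + indicator {0<..} t * emeasure lborel {x. ennreal t < g x} \<partial>lborel)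
    \<le> (\<integral>\<^sup>+t. 2 * (indicator {0<..} t * emeasure lborel {x. ennreal t < h x}) \<partial>lborel)"
    by (intro nn_integral_mono) (auto simp: indicator_def)
  then show ?thesis
    by (subst (1 2 3) nn_integral_layer_cake) (simp_all add: nn_integral_add nn_integral_cmult)
qed

lemma ennreal_four_mult_le_add_power2: "4 * (a * b) \<le> (a + b)\<^sup>2" for a b :: ennreal
proof (cases "a = top \<or> b = top")
  case True
  then show ?thesis by (auto simp: power2_eq_square ennreal_top_mult)
next
  case False
  then obtain x y where "a = ennreal x" "b = ennreal y" "x \<ge> 0" "y \<ge> 0"
    by (cases a; cases b) auto
  moreover have "4 * (x * y) \<le> (x + y)\<^sup>2"
    using sum_squares_bound[of x y] by (simp add: power2_eq_square algebra_simps)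
  ultimately show ?thesis
    by (simp add: ennreal_plus[symmetric] ennreal_mult[symmetric] ennreal_power ennreal_numeral[symmetric] ennreal_leI
      del: ennreal_plus ennreal_numeral)
qed

text \<open>After scaling both suprema to 1 the inequality of arithmetic and geometric means turns
  the sum into a product. Dividing \<open>h\<close> by the geometric mean \<open>c\<close> of the
  suprema preserves the hypothesis.\<close>

lemma prekopa_leindler_bounded:
  fixes f g h :: "real \<Rightarrow> ennreal"
  assumes [measurable]: "f \<in> borel_measurable borel" "g \<in> borel_measurable borel" "h \<in> borel_measurable borel"
    and f: "(SUP x. f x) \<noteq> top" and g: "(SUP x. g x) \<noteq> top"
    and fgh: "\<And>x y. f x * g y \<le> (h ((x + y) / 2))\<^sup>2"
  shows "(\<integral>\<^sup>+x. f x \<partial>lborel) * (\<integral>\<^sup>+x. g x \<partial>lborel) \<le> (\<integral>\<^sup>+x. h x \<partial>lborel)\<^sup>2"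
proof (cases "(SUP x. f x) = 0 \<or> (SUP x. g x) = 0")
  case True
  then have "(\<forall>x. f x = 0) \<or> (\<forall>x. g x = 0)"
    by (metis SUP_upper UNIV_I le_zero_eq)
  then show ?thesis by auto
next
  case False
  obtain a where a: "(SUP x. f x) = ennreal a" "a > 0"
    using f False by (cases "SUP x. f x") (auto simp: zero_less_iff_neq_zero less_le)
  obtain b where b: "(SUP x. g x) = ennreal b" "b > 0"
    using g False by (cases "SUP x. g x") (auto simp: zero_less_iff_neq_zero less_le)
  define c where "c = sqrt (a * b)"
  have c: "c > 0" "c\<^sup>2 = a * b" using a b by (auto simp: c_def)
  define f' g' h' where "f' x = ennreal (1 / a) * f x" and "g' x = ennreal (1 / b) * g x"
    and "h' x = ennreal (1 / c) * h x" for x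
  have [measurable]: "f' \<in> borel_measurable borel" "g' \<in> borel_measurable borel" "h' \<in> borel_measurable borel"
    unfolding f'_def g'_def h'_def by measurable
  have "(\<integral>\<^sup>+x. f' x \<partial>lborel) + (\<integral>\<^sup>+x. g' x \<partial>lborel) \<le> 2 * (\<integral>\<^sup>+x. h' x \<partial>lborel)"
  proof (rule prekopa_leindler_normalized)
    show "(SUP x. f' x) = 1" "(SUP x. g' x) = 1"
      using a b by (simp_all add: f'_def g'_def SUP_mult_left_ennreal[symmetric] ennreal_mult[symmetric])
    show "f' x * g' y \<le> (h' ((x + y) / 2))\<^sup>2" for x y
    proof -
      have "f' x * g' y = ennreal (1 / (a * b)) * (f x * g y)"
        using a b by (simp add: f'_def g'_def ennreal_mult' mult_ac divide_simps flip: ennreal_mult)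
      also have "\<dots> \<le> ennreal (1 / (a * b)) * (h ((x + y) / 2))\<^sup>2"
        by (intro mult_left_mono fgh) auto
      also have "ennreal (1 / (a * b)) = (ennreal (1 / c))\<^sup>2"
        using c a b by (simp add: ennreal_power power_divide)
      finally show ?thesis by (simp add: h'_def power_mult_distrib)
    qed
  qed measurable
  define F G H where "F = (\<integral>\<^sup>+x. f x \<partial>lborel)" and "G = (\<integral>\<^sup>+x. g x \<partial>lborel)" and "H = (\<integral>\<^sup>+x. h x \<partial>lborel)"
  have le: "ennreal (1 / a) * F + ennreal (1 / b) * G \<le> 2 * (ennreal (1 / c) * H)"
    using \<open>_ \<le> 2 * (\<integral>\<^sup>+x. h' x \<partial>lborel)\<close>
    by (simp add: f'_def g'_def h'_def nn_integral_cmult F_def G_def H_def)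
  have "4 * ((ennreal (1 / a) * F) * (ennreal (1 / b) * G)) \<le> (2 * (ennreal (1 / c) * H))\<^sup>2"
    using ennreal_four_mult_le_add_power2 power_mono[OF le, of 2] by (meson order_trans zero_le)
  also have "\<dots> = 4 * ((ennreal (1 / c))\<^sup>2 * H\<^sup>2)"
    by (simp add: power_mult_distrib)
  finally have "(ennreal (1 / a) * F) * (ennreal (1 / b) * G) \<le> (ennreal (1 / c))\<^sup>2 * H\<^sup>2"
    by (subst (asm) ennreal_mult_le_mult_iff) auto
  also have "(ennreal (1 / c))\<^sup>2 = ennreal (1 / a) * ennreal (1 / b)"
    using c a b by (simp add: ennreal_power power_divide ennreal_mult[symmetric])
  finally have "(ennreal (1 / a) * ennreal (1 / b)) * (F * G) \<le> (ennreal (1 / a) * ennreal (1 / b)) * H\<^sup>2"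
    by (simp add: mult_ac)
  then have "F * G \<le> H\<^sup>2"
    using a b by (subst (asm) ennreal_mult_le_mult_iff) (auto simp flip: ennreal_mult)
  then show ?thesis by (simp add: F_def G_def H_def)
qed

text \<open>An unbounded function cannot be scaled to supremum 1, so \<open>f\<close> and
  \<open>g\<close> are cut off at integers and monotone convergence removes the cutoffs. These are
  independent of each other because a product of suprema is a double supremum.\<close>

lemma prekopa_leindler_real:
  fixes f g h :: "real \<Rightarrow> ennreal"
  assumes [measurable]: "f \<in> borel_measurable borel" "g \<in> borel_measurable borel" "h \<in> borel_measurable borel"
    and fgh: "\<And>x y. f x * g y \<le> (h ((x + y) / 2))\<^sup>2"
  shows "(\<integral>\<^sup>+x. f x \<partial>lborel) * (\<integral>\<^sup>+x. g x \<partial>lborel) \<le> (\<integral>\<^sup>+x. h x \<partial>lborel)\<^sup>2"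
proof -
  define tr where "tr f k x = min (f x) (of_nat k)" for f :: "real \<Rightarrow> ennreal" and k :: nat and x
  have tr_meas [measurable]: "tr f k \<in> borel_measurable borel" if [measurable]: "f \<in> borel_measurable borel" for f k
    unfolding tr_def by measurable
  have lim: "(\<lambda>k. \<integral>\<^sup>+x. tr f k x \<partial>lborel) \<longlonglongrightarrow> (\<integral>\<^sup>+x. f x \<partial>lborel)"
    if [measurable]: "f \<in> borel_measurable borel" for f
  proof (rule nn_integral_LIMSEQ)
    show "incseq (\<lambda>k x. tr f k x)" by (auto simp: incseq_def le_fun_def tr_def min.coboundedI2 intro: of_nat_mono)
    show "(\<lambda>k. tr f k x) \<longlonglongrightarrow> f x" for x
    proof (cases "f x = top")
      case True
      then show ?thesis by (simp add: tr_def min_absorb2 of_nat_tendsto_top_ennreal)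
    next
      case False
      then obtain n :: nat where n: "f x < of_nat n" using ennreal_Ex_less_of_nat less_top by metis
      have "eventually (\<lambda>k. tr f k x = f x) sequentially"
        using eventually_ge_at_top[of n]
      proof eventually_elim
        case (elim k)
        then have "f x \<le> of_nat k" using n by (meson less_imp_le of_nat_mono order_trans)
        then show ?case by (simp add: tr_def min_absorb1)
      qed
      then show ?thesis by (rule tendsto_eventually)
    qed
  qed measurable
  have "(\<integral>\<^sup>+x. tr f k x \<partial>lborel) * (\<integral>\<^sup>+x. tr g k' x \<partial>lborel) \<le> (\<integral>\<^sup>+x. h x \<partial>lborel)\<^sup>2" for k k'
  proof (rule prekopa_leindler_bounded)
    have "(SUP x. tr f k x) \<le> of_nat k" for f k by (intro SUP_least) (simp add: tr_def)
    then show "(SUP x. tr f k x) \<noteq> top" "(SUP x. tr g k' x) \<noteq> top"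
      by (metis ennreal_of_nat_neq_top top.extremum_unique)+
    show "tr f k x * tr g k' y \<le> (h ((x + y) / 2))\<^sup>2" for x y
      by (rule order_trans[OF mult_mono fgh]) (auto simp: tr_def)
  qed measurable
  then have "(\<Squnion>k. \<integral>\<^sup>+x. tr f k x \<partial>lborel) * (\<Squnion>k. \<integral>\<^sup>+x. tr g k x \<partial>lborel) \<le> (\<integral>\<^sup>+x. h x \<partial>lborel)\<^sup>2"
    by (simp add: SUP_mult_left_ennreal SUP_mult_right_ennreal SUP_least)
  moreover have "incseq (\<lambda>k. \<integral>\<^sup>+x. tr f k x \<partial>lborel)" for f
    by (auto simp: incseq_def tr_def intro!: nn_integral_mono min.mono of_nat_mono)
  ultimately show ?thesis
    using LIMSEQ_unique[OF lim[OF assms(1)] LIMSEQ_SUP] LIMSEQ_unique[OF lim[OF assms(2)] LIMSEQ_SUP]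
    by metis
qed

text \<open>Tensorization by Fubini: for fixed values \<open>s\<close>, \<open>t\<close> of one
  coordinate the induction hypothesis applies to the sections, and its conclusion is the hypothesis
  of the one-dimensional inequality for the partial integrals. Squaring the right-hand side avoids
  square roots of extended reals.\<close>

theorem prekopa_leindler_PiM:
  fixes f g h :: "('i \<Rightarrow> real) \<Rightarrow> ennreal"
  assumes "finite I"
    and "f \<in> borel_measurable (PiM I (\<lambda>_. lborel))" "g \<in> borel_measurable (PiM I (\<lambda>_. lborel))"
      "h \<in> borel_measurable (PiM I (\<lambda>_. lborel))"
    and "\<And>x y. x \<in> I \<rightarrow>\<^sub>E UNIV \<Longrightarrow> y \<in> I \<rightarrow>\<^sub>E UNIV \<Longrightarrow> f x * g y \<le> (h (\<lambda>i\<in>I. (x i + y i) / 2))\<^sup>2"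
  shows "(\<integral>\<^sup>+x. f x \<partial>PiM I (\<lambda>_. lborel)) * (\<integral>\<^sup>+x. g x \<partial>PiM I (\<lambda>_. lborel))
    \<le> (\<integral>\<^sup>+x. h x \<partial>PiM I (\<lambda>_. lborel))\<^sup>2"
  using assms
proof (induction I arbitrary: f g h rule: finite_induct)
  case empty
  then show ?case
    using empty(4)[of "\<lambda>_. undefined" "\<lambda>_. undefined"]
    by (simp add: PiM_empty nn_integral_count_space_finite restrict_def)
next
  case (insert i I)
  interpret product_sigma_finite "\<lambda>_. lborel :: real measure" ..
  note [measurable] = insert.prems(1,2,3)
  have meas [measurable]: "(\<lambda>y. \<integral>\<^sup>+x. f (x(i := y)) \<partial>PiM I (\<lambda>_. lborel)) \<in> borel_measurable borel"
    if [measurable]: "f \<in> borel_measurable (PiM (insert i I) (\<lambda>_. lborel))" for f :: "('i \<Rightarrow> real) \<Rightarrow> ennreal"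
  proof -
    interpret I: sigma_finite_measure "PiM I (\<lambda>_. lborel :: real measure)" by (rule sigma_finite[OF insert.hyps(1)])
    have "(\<lambda>(y, x). f (x(i := y))) \<in> borel_measurable (lborel \<Otimes>\<^sub>M PiM I (\<lambda>_. lborel))"
      by measurable
    from I.borel_measurable_nn_integral[OF this] show ?thesis by simp
  qed
  show ?case
    unfolding product_nn_integral_insert_rev[OF insert.hyps insert.prems(1)]
      product_nn_integral_insert_rev[OF insert.hyps insert.prems(2)]
      product_nn_integral_insert_rev[OF insert.hyps insert.prems(3)]
  proof (rule prekopa_leindler_real)
    fix s t :: real
    show "(\<integral>\<^sup>+x. f (x(i := s)) \<partial>PiM I (\<lambda>_. lborel)) * (\<integral>\<^sup>+x. g (x(i := t)) \<partial>PiM I (\<lambda>_. lborel))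
       \<le> (\<integral>\<^sup>+x. h (x(i := (s + t) / 2)) \<partial>PiM I (\<lambda>_. lborel))\<^sup>2"
    proof (rule insert.IH)
      fix x y :: "'i \<Rightarrow> real" assume "x \<in> I \<rightarrow>\<^sub>E UNIV" "y \<in> I \<rightarrow>\<^sub>E UNIV"
      then have "x(i := s) \<in> insert i I \<rightarrow>\<^sub>E UNIV" "y(i := t) \<in> insert i I \<rightarrow>\<^sub>E UNIV"
        by (auto simp: PiE_def extensional_def)
      from insert.prems(4)[OF this]
      have "f (x(i := s)) * g (y(i := t)) \<le> (h (\<lambda>j\<in>insert i I. ((x(i := s)) j + (y(i := t)) j) / 2))\<^sup>2" .
      also have "(\<lambda>j\<in>insert i I. ((x(i := s)) j + (y(i := t)) j) / 2) = (\<lambda>j\<in>I. (x j + y j) / 2)(i := (s + t) / 2)"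
        using insert.hyps(2) by (auto simp: fun_eq_iff)
      finally show "f (x(i := s)) * g (y(i := t)) \<le> (h ((\<lambda>j\<in>I. (x j + y j) / 2)(i := (s + t) / 2)))\<^sup>2" .
    qed measurable
  qed (use meas in measurable)
qed

section \<open>Stirling bounds\<close>

text \<open>The logarithm of \<open>n! e^n / n^(n + 1/2)\<close>; Stirling's formula says that it
  tends to \<open>ln (2 * pi) / 2\<close>.\<close>

definition stirling_error :: "nat \<Rightarrow> real" where
  "stirling_error n = ln (fact n) - (real n + 1 / 2) * ln (real n) + real n"

text \<open>Midpoint and trapezoidal rule for the integral of \<open>1 / x\<close> over
  \<open>[n, n + 1]\<close>: by convexity the integral lies between the two. The second bound
  telescopes and makes \<open>stirling_error n - 1 / (4 n)\<close> increasing.\<close>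

lemma stirling_error_Suc_bounds:
  assumes "n \<ge> 1"
  shows "stirling_error (Suc n) \<le> stirling_error n"
    and "stirling_error n - stirling_error (Suc n) \<le> 1 / (4 * real n) - 1 / (4 * real (Suc n))"
proof -
  define x where "x = real n"
  have x: "x \<ge> 1" using assms by (simp add: x_def)
  have eq: "stirling_error n - stirling_error (Suc n) = (x + 1 / 2) * (ln (x + 1) - ln x) - 1"
    unfolding stirling_error_def fact_Suc x_def
    by (subst ln_mult) (use assms in \<open>auto simp: field_simps\<close>)
  have "ln (x + 1) - ln x \<ge> 2 * 1 / (2 * x + 1)"
    using ln_inverse_approx_ge[of x "x + 1"] x by simp
  then have "(x + 1 / 2) * (ln (x + 1) - ln x) \<ge> (x + 1 / 2) * (2 * 1 / (2 * x + 1))"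
    using x by (intro mult_left_mono) auto
  also have "(x + 1 / 2) * (2 * 1 / (2 * x + 1)) = 1" using x by (simp add: field_simps)
  finally show "stirling_error (Suc n) \<le> stirling_error n" using eq by simp
  have "ln (x + 1) - ln x \<le> 1 * (inverse x + inverse (x + 1)) / 2"
    using ln_inverse_approx_le[of x 1] x by simp
  then have "(x + 1 / 2) * (ln (x + 1) - ln x) - 1 \<le> (x + 1 / 2) * (1 * (inverse x + inverse (x + 1)) / 2) - 1"
    using x by (intro diff_right_mono mult_left_mono) auto
  also have "\<dots> = 1 / (4 * x) - 1 / (4 * (x + 1))"
    using x by (simp add: divide_simps) (simp add: algebra_simps)
  finally show "stirling_error n - stirling_error (Suc n) \<le> 1 / (4 * real n) - 1 / (4 * real (Suc n))"
    using eq by (simp add: x_def add_ac)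
qed

lemma wallis_prod_eq:
  "(\<Prod>k=1..n. (4*real k^2) / (4*real k^2 - 1)) = (2 ^ (2 * n) * (fact n)\<^sup>2)\<^sup>2 / ((fact (2 * n))\<^sup>2 * (2 * real n + 1))"
proof (induction n)
  case (Suc n)
  define x P B :: real where "x = real n" and "P = (2 ^ (2 * n) * (fact n)\<^sup>2)\<^sup>2" and "B = fact (2 * n)"
  have pos: "x \<ge> 0" "B > 0" by (auto simp: x_def B_def)
  have sq: "4 * (real (Suc n))\<^sup>2 - 1 = (2 * x + 1) * (2 * x + 3)"
    by (simp add: power2_eq_square algebra_simps x_def)
  have fact_eq: "fact (2 * Suc n) = 2 * (x + 1) * (2 * x + 1) * B"
    by (simp add: algebra_simps x_def B_def)
  have num: "(2 ^ (2 * Suc n) * (fact (Suc n))\<^sup>2)\<^sup>2 = P * (16 * (x + 1) ^ 4)"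
    by (simp add: P_def x_def power_mult_distrib flip: power_mult) (simp add: algebra_simps)
  have "(\<Prod>k=1..Suc n. (4*real k^2) / (4*real k^2 - 1)) = P / (B\<^sup>2 * (2 * x + 1)) * (4 * (x + 1)\<^sup>2 / ((2 * x + 1) * (2 * x + 3)))"
    using Suc.IH sq by (simp add: P_def B_def x_def add_ac)
  also have "\<dots> = P * (16 * (x + 1) ^ 4) / ((2 * (x + 1) * (2 * x + 1) * B)\<^sup>2 * (2 * x + 3))"
    using pos by (simp add: divide_simps power_mult_distrib) (auto simp: power2_eq_square power4_eq_xxxx algebra_simps)
  finally show ?case
    unfolding num fact_eq by (simp add: x_def algebra_simps)
qed simp

text \<open>Monotonicity gives some limit \<open>L\<close>. The logarithm of the Wallis product is
  \<open>4 * stirling_error n - 2 * stirling_error (2 * n)\<close> plus a term tending to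
  \<open>- 2 * ln 2\<close>, so its limit \<open>ln (pi / 2)\<close> equals
  \<open>2 * L - 2 * ln 2\<close>, which fixes \<open>L\<close>.\<close>

lemma stirling_error_tendsto: "(\<lambda>n. stirling_error (Suc n)) \<longlonglongrightarrow> ln (2 * pi) / 2"
proof -
  define S where "S n = stirling_error (Suc n)" for n
  have dec: "decseq S" unfolding S_def by (intro decseq_SucI stirling_error_Suc_bounds) auto
  have inc: "incseq (\<lambda>n. S n - 1 / (4 * real (Suc n)))"
    unfolding S_def using stirling_error_Suc_bounds(2)[of "Suc n" for n]
    by (intro incseq_SucI) (smt (verit) One_nat_def Suc_le_mono zero_le)
  have "S 0 - 1 / 4 \<le> S n" for n
    using incseqD[OF inc, of 0 n] by simp (smt (verit) divide_nonneg_nonneg of_nat_0_le_iff)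
  then obtain L where L: "S \<longlonglongrightarrow> L" using decseq_convergent[OF dec] by blast
  have L1: "stirling_error \<longlonglongrightarrow> L" using L unfolding S_def by (rule LIMSEQ_imp_Suc)
  have L2: "(\<lambda>n. stirling_error (2 * n)) \<longlonglongrightarrow> L"
    using LIMSEQ_subseq_LIMSEQ[OF L1, of "\<lambda>n. 2 * n"] by (simp add: strict_mono_def o_def)
  have eq: "ln (\<Prod>k=1..n. (4*real k^2) / (4*real k^2 - 1))
     = 4 * stirling_error n - 2 * stirling_error (2 * n) + ln (real n / (2 * real n + 1)) - ln 2" if "n \<ge> 1" for n
  proof -
    have n: "real n > 0" using that by simp
    have "ln ((2 ^ (2 * n) * (fact n)\<^sup>2)\<^sup>2 / ((fact (2 * n))\<^sup>2 * (2 * real n + 1)))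
      = 4 * real n * ln 2 + 4 * ln (fact n) - 2 * ln (fact (2 * n)) - ln (2 * real n + 1)"
    proof -
      have "ln ((2 ^ (2 * n) * (fact n)\<^sup>2)\<^sup>2 :: real) = 4 * real n * ln 2 + 4 * ln (fact n)"
        by (simp add: ln_mult ln_realpow)
      moreover have "ln ((fact (2 * n))\<^sup>2 * (2 * real n + 1)) = 2 * ln (fact (2 * n)) + ln (2 * real n + 1)"
        by (subst ln_mult_pos) (auto simp: ln_realpow)
      ultimately show ?thesis
        by (subst ln_divide_pos) (auto intro!: mult_pos_pos)
    qed
    moreover have "ln (real n / (2 * real n + 1)) = ln (real n) - ln (2 * real n + 1)"
      using n by (subst ln_div) auto
    moreover have "ln (real (2 * n)) = ln 2 + ln (real n)" using n by (simp add: ln_mult)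
    ultimately show ?thesis
      unfolding wallis_prod_eq stirling_error_def by (simp add: algebra_simps)
  qed
  have "(\<lambda>n. ln (real n / (2 * real n + 1))) \<longlonglongrightarrow> ln (1 / 2)" by (rule tendsto_ln) (real_asymp, simp)
  then have "(\<lambda>n. 4 * stirling_error n - 2 * stirling_error (2 * n) + ln (real n / (2 * real n + 1)) - ln 2)
      \<longlonglongrightarrow> 4 * L - 2 * L + ln (1 / 2) - ln 2"
    by (intro tendsto_diff tendsto_add tendsto_mult tendsto_const L1 L2)
  moreover have "(\<lambda>n. ln (\<Prod>k=1..n. (4*real k^2) / (4*real k^2 - 1))) \<longlonglongrightarrow> ln (pi / 2)"
    by (intro tendsto_ln wallis) auto
  then have "(\<lambda>n. 4 * stirling_error n - 2 * stirling_error (2 * n) + ln (real n / (2 * real n + 1)) - ln 2)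
      \<longlonglongrightarrow> ln (pi / 2)"
    by (rule Lim_transform_eventually) (rule eventually_mono[OF eventually_ge_at_top[of 1] eq])
  ultimately have "4 * L - 2 * L + ln (1 / 2) - ln 2 = ln (pi / 2)" by (rule LIMSEQ_unique)
  then have Leq: "L = ln (2 * pi) / 2" by (simp add: ln_div ln_mult)
  have S: "S \<longlonglongrightarrow> ln (2 * pi) / 2" using L unfolding Leq .
  show ?thesis using S[unfolded S_def] .
qed

lemma stirling_error_bounds:
  assumes "n \<ge> 1"
  shows "ln (2 * pi) / 2 \<le> stirling_error n" and "stirling_error n \<le> ln (2 * pi) / 2 + 1 / (4 * real n)"
proof -
  obtain m where m: "n = Suc m" using assms by (cases n) auto
  have dec: "decseq (\<lambda>n. stirling_error (Suc n))" by (intro decseq_SucI stirling_error_Suc_bounds) auto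
  have inc: "incseq (\<lambda>n. stirling_error (Suc n) - 1 / (4 * real (Suc n)))"
    using stirling_error_Suc_bounds(2)[of "Suc n" for n]
    by (intro incseq_SucI) (smt (verit) One_nat_def Suc_le_mono zero_le)
  show "ln (2 * pi) / 2 \<le> stirling_error n"
    using decseq_ge[OF dec stirling_error_tendsto, of m] m by simp
  have "(\<lambda>n. 1 / (4 * real (Suc n))) \<longlonglongrightarrow> 0" by real_asymp
  then have "(\<lambda>n. stirling_error (Suc n) - 1 / (4 * real (Suc n))) \<longlonglongrightarrow> ln (2 * pi) / 2 - 0"
    by (intro tendsto_diff stirling_error_tendsto)
  from incseq_le[OF inc this, of m] show "stirling_error n \<le> ln (2 * pi) / 2 + 1 / (4 * real n)"
    using m by simp
qed

lemma ln_fact_lower: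
  assumes "n \<ge> 1"
  shows "real n * ln (real n) - real n + ln (2 * pi * real n) / 2 \<le> ln (fact n)"
  using stirling_error_bounds(1)[OF assms] assms by (simp add: stirling_error_def ln_mult field_simps)

lemma ln_fact_upper:
  assumes "n \<ge> 1"
  shows "ln (fact n) \<le> real n * ln (real n) - real n + ln (2 * pi * real n) / 2 + 1 / (4 * real n)"
  using stirling_error_bounds(2)[OF assms] assms by (simp add: stirling_error_def ln_mult field_simps)

section \<open>Concentration of the multinomial likelihood ratio\<close>

text \<open>The discrete form of the integral of \<open>1 / sqrt S\<close> with respect to
  \<open>S\<close>: each summand is at most twice the increment of the square root.\<close>

lemma sum_div_sqrt_partial_sums_le:
  fixes P :: "nat \<Rightarrow> real"
  assumes "\<And>i. P i > 0"
  shows "(\<Sum>m\<le>k. P m / sqrt (\<Sum>i\<le>m. P i)) \<le> 2 * sqrt (\<Sum>i\<le>k. P i)"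
proof (induction k)
  case 0
  have "P 0 / sqrt (P 0) = sqrt (P 0)" using assms[of 0] by (simp add: real_div_sqrt)
  then show ?case using assms[of 0] by simp
next
  case (Suc k)
  define A B where "A = sqrt (\<Sum>i\<le>k. P i)" and "B = sqrt (\<Sum>i\<le>Suc k. P i)"
  have nn: "(\<Sum>i\<le>k. P i) \<ge> 0" "(\<Sum>i\<le>Suc k. P i) > 0"
    using assms by (auto intro!: sum_nonneg simp: less_imp_le simp del: sum.atMost_Suc) (rule sum_pos; simp)
  have AB: "0 \<le> A" "A \<le> B" "0 < B" using nn assms[of "Suc k"] by (auto simp: A_def B_def)
  have "P (Suc k) = B\<^sup>2 - A\<^sup>2" using nn by (simp add: A_def B_def)
  also have "\<dots> = (B - A) * (B + A)" by (simp add: power2_eq_square algebra_simps)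
  also have "\<dots> \<le> (B - A) * (2 * B)" using AB by (intro mult_left_mono) auto
  finally have "P (Suc k) / B \<le> 2 * (B - A)" using AB by (simp add: field_simps)
  then show ?case using Suc.IH by (simp add: A_def B_def)
qed

text \<open>Chernoff: tilting the success probability from \<open>p\<close> down to \<open>m / n\<close>.\<close>
lemma binomial_lower_tail:
  fixes p q :: real
  assumes pq: "0 < p" "0 < q" "p + q = 1" and n: "n \<ge> 1" and m: "real m \<le> real n * p"
  shows "(\<Sum>i\<le>m. real (n choose i) * p ^ i * q ^ (n - i)) * (real m ^ m * real (n - m) ^ (n - m))
     \<le> p ^ m * q ^ (n - m) * real n ^ n"
proof (cases "m = 0")
  case True
  then show ?thesis by simp
next
  case False
  have "real n * p < real n" using pq n by simp
  with m have mn: "m < n" by linarith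
  define a b where "a = real m / real n" and "b = real (n - m) / real n"
  have ab: "a > 0" "b > 0" "a + b = 1" "a \<le> p" "q \<le> b"
  proof -
    show "a > 0" "b > 0" using False mn by (auto simp: a_def b_def)
    show s: "a + b = 1" using mn n by (simp add: a_def b_def flip: add_divide_distrib)
    show "a \<le> p" using m n by (simp add: a_def field_simps)
    with s pq show "q \<le> b" by simp
  qed
  \<comment> \<open>The ratio \<open>(p / a)^i * (q / b)^(n - i)\<close> increases with
    \<open>i\<close>, because \<open>a \<le> p\<close> and \<open>q \<le> b\<close>; for
    \<open>i \<le> m\<close> it is bounded by its value at \<open>m\<close>.\<close>
  have term_le: "p ^ i * q ^ (n - i) * (a ^ m * b ^ (n - m)) \<le> a ^ i * b ^ (n - i) * (p ^ m * q ^ (n - m))"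
    if "i \<le> m" for i
  proof -
    have "q ^ (m - i) * a ^ (m - i) \<le> b ^ (m - i) * p ^ (m - i)"
      using ab pq by (intro mult_mono power_mono) auto
    then have "(p ^ i * q ^ (n - m) * a ^ i * b ^ (n - m)) * (q ^ (m - i) * a ^ (m - i))
      \<le> (p ^ i * q ^ (n - m) * a ^ i * b ^ (n - m)) * (b ^ (m - i) * p ^ (m - i))"
      using ab pq by (intro mult_left_mono) auto
    moreover have "n - i = (n - m) + (m - i)" "m = i + (m - i)" using that mn by auto
    then have "q ^ (n - i) = q ^ (n - m) * q ^ (m - i)" "b ^ (n - i) = b ^ (n - m) * b ^ (m - i)"
      "a ^ m = a ^ i * a ^ (m - i)" "p ^ m = p ^ i * p ^ (m - i)"
      by (metis power_add)+
    ultimately show ?thesis by (simp add: mult_ac)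
  qed
  have "(\<Sum>i\<le>m. real (n choose i) * p ^ i * q ^ (n - i)) * (a ^ m * b ^ (n - m))
      = (\<Sum>i\<le>m. real (n choose i) * (p ^ i * q ^ (n - i) * (a ^ m * b ^ (n - m))))"
    unfolding sum_distrib_right by (intro sum.cong refl) (simp add: mult_ac)
  also have "\<dots> \<le> (\<Sum>i\<le>m. real (n choose i) * (a ^ i * b ^ (n - i) * (p ^ m * q ^ (n - m))))"
    by (intro sum_mono mult_left_mono term_le) auto
  also have "\<dots> \<le> (\<Sum>i\<le>n. real (n choose i) * (a ^ i * b ^ (n - i) * (p ^ m * q ^ (n - m))))"
    using mn ab pq by (intro sum_mono2) auto
  also have "\<dots> = (\<Sum>i\<le>n. real (n choose i) * a ^ i * b ^ (n - i)) * (p ^ m * q ^ (n - m))"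
    unfolding sum_distrib_right by (intro sum.cong refl) (simp add: mult_ac)
  also have "(\<Sum>i\<le>n. real (n choose i) * a ^ i * b ^ (n - i)) = 1"
    using binomial_ring[of a b n] ab by simp
  finally have le: "(\<Sum>i\<le>m. real (n choose i) * p ^ i * q ^ (n - i)) * (a ^ m * b ^ (n - m)) \<le> p ^ m * q ^ (n - m)"
    by simp
  have "a ^ m * b ^ (n - m) * real n ^ n = (a * real n) ^ m * (b * real n) ^ (n - m)"
    using mn by (simp add: power_mult_distrib flip: power_add)
  also have "a * real n = real m" using n by (simp add: a_def)
  also have "b * real n = real (n - m)" using n by (simp add: b_def)
  finally have e: "real m ^ m * real (n - m) ^ (n - m) = a ^ m * b ^ (n - m) * real n ^ n" by simp
  show ?thesis
    unfolding e using mult_right_mono[OF le, of "real n ^ n"] by (simp add: mult_ac)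
qed

text \<open>Up to the factor \<open>sqrt (n^n)\<close> the sum is the expectation of the square root
  of the likelihood ratio over the lower half. Chernoff bounds that root at \<open>m\<close> by the
  inverse square root of the probability of at most \<open>m\<close> successes, and the sum of
  \<open>P m\<close> over the root of its partial sums is bounded whatever the distribution. Hence
  no factor depending on \<open>n\<close> or \<open>p\<close> appears.\<close>

lemma binomial_sqrt_likelihood_half:
  fixes p q :: real
  assumes pq: "0 < p" "0 < q" "p + q = 1" and n: "n \<ge> 1"
  shows "(\<Sum>m | m \<le> n \<and> real m \<le> real n * p.
      real (n choose m) * sqrt (p ^ m * q ^ (n - m) * real m ^ m * real (n - m) ^ (n - m))) \<le> 2 * sqrt (real n ^ n)"
proof -
  define k where "k = nat \<lfloor>real n * p\<rfloor>"
  have kn: "k \<le> n" "real k \<le> real n * p"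
  proof -
    have "0 \<le> real n * p" "real n * p \<le> real n" using pq by (auto intro: mult_left_le)
    then show "k \<le> n" "real k \<le> real n * p" unfolding k_def by linarith+
  qed
  have set_eq: "{m. m \<le> n \<and> real m \<le> real n * p} = {..k}"
  proof -
    have "m \<le> k" if "real m \<le> real n * p" for m using that unfolding k_def by linarith
    moreover have "real m \<le> real n * p" if "m \<le> k" for m using that kn by linarith
    ultimately show ?thesis using kn by auto
  qed
  \<comment> \<open>The value 1 beyond \<open>n\<close> makes \<open>P\<close> positive everywhere,
    as the summation lemma asks; the sums below stop at \<open>k \<le> n\<close>.\<close>
  define P where "P m = (if m \<le> n then real (n choose m) * p ^ m * q ^ (n - m) else 1)" for m
  have P: "P m > 0" for m using pq by (auto simp: P_def zero_less_binomial)
  have "(\<Sum>m\<le>k. real (n choose m) * sqrt (p ^ m * q ^ (n - m) * real m ^ m * real (n - m) ^ (n - m)))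
    \<le> (\<Sum>m\<le>k. sqrt (real n ^ n) * (P m / sqrt (\<Sum>i\<le>m. P i)))"
  proof (rule sum_mono)
    fix m assume "m \<in> {..k}"
    then have m: "m \<le> n" "real m \<le> real n * p" using kn by auto
    define R G where "R = real m ^ m * real (n - m) ^ (n - m)" and "G = (\<Sum>i\<le>m. P i)"
    define L where "L = p ^ m * q ^ (n - m)"
    have G: "G > 0" unfolding G_def using P by (intro sum_pos) auto
    have L: "L > 0" using pq by (simp add: L_def)
    have "G = (\<Sum>i\<le>m. real (n choose i) * p ^ i * q ^ (n - i))"
      unfolding G_def P_def using m by (intro sum.cong) auto
    then have "G * R \<le> L * real n ^ n"
      using binomial_lower_tail[OF pq n m(2)] by (simp add: R_def L_def)
    then have "R \<le> L * real n ^ n / G" using G by (simp add: field_simps)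
    then have "sqrt (L * R) \<le> sqrt (L * (L * real n ^ n / G))"
      using L by (intro real_sqrt_le_mono mult_left_mono) auto
    also have "\<dots> = L * (sqrt (real n ^ n) / sqrt G)"
      using L by (simp add: real_sqrt_mult real_sqrt_divide)
    finally have "real (n choose m) * sqrt (L * R) \<le> real (n choose m) * (L * (sqrt (real n ^ n) / sqrt G))"
      by (intro mult_left_mono) auto
    also have "\<dots> = sqrt (real n ^ n) * (P m / sqrt G)" using m by (simp add: P_def L_def)
    finally show "real (n choose m) * sqrt (p ^ m * q ^ (n - m) * real m ^ m * real (n - m) ^ (n - m))
      \<le> sqrt (real n ^ n) * (P m / sqrt (\<Sum>i\<le>m. P i))"
      by (simp add: L_def R_def G_def mult_ac)
  qed
  also have "\<dots> = sqrt (real n ^ n) * (\<Sum>m\<le>k. P m / sqrt (\<Sum>i\<le>m. P i))"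
    by (simp add: sum_distrib_left)
  also have "\<dots> \<le> sqrt (real n ^ n) * (2 * sqrt (\<Sum>i\<le>k. P i))"
    by (intro mult_left_mono sum_div_sqrt_partial_sums_le P) auto
  also have "(\<Sum>i\<le>k. P i) \<le> 1"
  proof -
    have "(\<Sum>i\<le>k. P i) \<le> (\<Sum>i\<le>n. P i)" using kn P by (intro sum_mono2) (auto simp: less_imp_le)
    also have "\<dots> = (\<Sum>i\<le>n. real (n choose i) * p ^ i * q ^ (n - i))" by (simp add: P_def)
    also have "\<dots> = 1" using binomial_ring[of p q n] pq by simp
    finally show ?thesis .
  qed
  then have "sqrt (real n ^ n) * (2 * sqrt (\<Sum>i\<le>k. P i)) \<le> sqrt (real n ^ n) * (2 * 1)"
    by (intro mult_left_mono) auto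
  finally show ?thesis by (simp add: set_eq)
qed

text \<open>Replacing \<open>m\<close> by \<open>n - m\<close> and exchanging \<open>p\<close> and
  \<open>q\<close> carries the upper half to the lower one. The statement is homogeneous in
  \<open>p\<close> and \<open>q\<close> because the chain rule applies it with \<open>q\<close> the
  mass of several states and \<open>p + q\<close> different from 1.\<close>

lemma binomial_sqrt_likelihood:
  fixes p q :: real
  assumes pq: "0 < p" "0 < q"
  shows "(\<Sum>m\<le>n. real (n choose m) * sqrt (p ^ m * q ^ (n - m) * real m ^ m * real (n - m) ^ (n - m)))
    \<le> 4 * sqrt (real n ^ n * (p + q) ^ n)"
proof (cases "n = 0")
  case False
  then have n: "n \<ge> 1" by simp
  define P Q where "P = p / (p + q)" and "Q = q / (p + q)"
  have PQ: "0 < P" "0 < Q" "P + Q = 1" using pq by (auto simp: P_def Q_def simp flip: add_divide_distrib)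
  define t where "t P Q m = real (n choose m) * sqrt (P ^ m * Q ^ (n - m) * real m ^ m * real (n - m) ^ (n - m))"
    for P Q :: real and m
  have t_nonneg: "t P Q m \<ge> 0" if "P \<ge> 0" "Q \<ge> 0" for P Q m using that by (auto simp: t_def)
  have swap: "t P Q m = t Q P (n - m)" if "m \<le> n" for m
    using that binomial_symmetric[OF that] by (simp add: t_def mult_ac)
  have "(\<Sum>m\<le>n. t P Q m) \<le> (\<Sum>m | m \<le> n \<and> real m \<le> real n * P. t P Q m) + (\<Sum>m | m \<le> n \<and> real n * P \<le> real m. t P Q m)"
  proof -
    have "(\<Sum>m\<le>n. t P Q m) \<le> sum (t P Q) ({m. m \<le> n \<and> real m \<le> real n * P} \<union> {m. m \<le> n \<and> real n * P \<le> real m})"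
      using PQ t_nonneg[of P Q] by (intro sum_mono2) auto
    also have "\<dots> \<le> (\<Sum>m | m \<le> n \<and> real m \<le> real n * P. t P Q m) + (\<Sum>m | m \<le> n \<and> real n * P \<le> real m. t P Q m)"
      using PQ t_nonneg[of P Q] by (subst sum_Un) (auto intro!: sum_nonneg)
    finally show ?thesis .
  qed
  also have "(\<Sum>m | m \<le> n \<and> real n * P \<le> real m. t P Q m) = (\<Sum>m | m \<le> n \<and> real m \<le> real n * Q. t Q P m)"
  proof (rule sum.reindex_bij_witness[of _ "\<lambda>m. n - m" "\<lambda>m. n - m"])
    have QP: "real n * Q = real n - real n * P" using PQ(3) by (metis add_diff_cancel_left' mult.right_neutral right_diff_distrib)
    show "n - a \<in> {m. m \<le> n \<and> real m \<le> real n * Q}" if "a \<in> {m. m \<le> n \<and> real n * P \<le> real m}" for a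
      using that by (simp add: QP of_nat_diff)
    show "n - b \<in> {m. m \<le> n \<and> real n * P \<le> real m}" if "b \<in> {m. m \<le> n \<and> real m \<le> real n * Q}" for b
      using that by (simp add: QP of_nat_diff)
  qed (auto simp: swap)
  also have "(\<Sum>m | m \<le> n \<and> real m \<le> real n * P. t P Q m) + (\<Sum>m | m \<le> n \<and> real m \<le> real n * Q. t Q P m)
     \<le> 2 * sqrt (real n ^ n) + 2 * sqrt (real n ^ n)"
    unfolding t_def using PQ by (intro add_mono binomial_sqrt_likelihood_half n) auto
  finally have le: "(\<Sum>m\<le>n. t P Q m) \<le> 4 * sqrt (real n ^ n)" by simp
  have "t p q m = sqrt ((p + q) ^ n) * t P Q m" if "m \<le> n" for m
  proof -
    have "p ^ m * q ^ (n - m) = (p + q) ^ n * (P ^ m * Q ^ (n - m))"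
      using pq that by (simp add: P_def Q_def power_divide flip: power_add)
    then show ?thesis by (simp add: t_def real_sqrt_mult mult_ac)
  qed
  then have "(\<Sum>m\<le>n. t p q m) = sqrt ((p + q) ^ n) * (\<Sum>m\<le>n. t P Q m)"
    by (simp add: sum_distrib_left)
  also have "\<dots> \<le> sqrt ((p + q) ^ n) * (4 * sqrt (real n ^ n))"
    using pq by (intro mult_left_mono le) auto
  finally show ?thesis by (simp add: t_def real_sqrt_mult mult_ac)
qed auto

section \<open>Count vectors and the chain rule\<close>

definition comps :: "nat \<Rightarrow> nat \<Rightarrow> (nat \<Rightarrow> nat) set" where
  "comps d n = {N. (\<forall>j>d. N j = 0) \<and> (\<Sum>j\<le>d. N j) = n}"

lemma comps_0: "comps 0 n = {\<lambda>j. if j = 0 then n else 0}"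
  by (auto simp: comps_def fun_eq_iff)

lemma comps_Suc:
  "bij_betw (\<lambda>(m, N). N(Suc d := m)) (SIGMA m:{..n}. comps d (n - m)) (comps (Suc d) n)"
  unfolding bij_betw_def
proof
  show "inj_on (\<lambda>(m, N). N(Suc d := m)) (SIGMA m:{..n}. comps d (n - m))"
  proof (rule inj_onI, clarify)
    fix m N m' N' assume a: "N \<in> comps d (n - m)" "N' \<in> comps d (n - m')" "N(Suc d := m) = N'(Suc d := m')"
    have "m = m'" using a(3) by (metis fun_upd_same)
    moreover have "N j = N' j" for j
      using a(1,2) fun_cong[OF a(3), of j] by (cases "j = Suc d") (auto simp: comps_def)
    ultimately show "m = m' \<and> N = N'" by auto
  qed
  have "(\<Sum>j\<le>d. (N(Suc d := m)) j) = (\<Sum>j\<le>d. N j)" for N :: "nat \<Rightarrow> nat" and m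
    by (intro sum.cong) auto
  note [simp] = this
  show "(\<lambda>(m, N). N(Suc d := m)) ` (SIGMA m:{..n}. comps d (n - m)) = comps (Suc d) n"
  proof safe
    fix m N assume "m \<le> n" "N \<in> comps d (n - m)"
    then show "N(Suc d := m) \<in> comps (Suc d) n" by (auto simp: comps_def)
  next
    fix N assume N: "N \<in> comps (Suc d) n"
    then have "(N (Suc d), N(Suc d := 0)) \<in> (SIGMA m:{..n}. comps d (n - m))"
      by (auto simp: comps_def less_Suc_eq not_less_eq)
    moreover have "N = (\<lambda>(m, N). N(Suc d := m)) (N (Suc d), N(Suc d := 0))" by simp
    ultimately show "N \<in> (\<lambda>(m, N). N(Suc d := m)) ` (SIGMA m:{..n}. comps d (n - m))" by blast
  qed
qed

lemma finite_comps: "finite (comps d n)"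
proof (induction d arbitrary: n)
  case (Suc d)
  then show ?case by (intro bij_betw_finite[THEN iffD1, OF comps_Suc]) auto
qed (simp add: comps_0)

lemma sum_comps_Suc:
  "(\<Sum>N\<in>comps (Suc d) n. f N) = (\<Sum>m\<le>n. \<Sum>N\<in>comps d (n - m). f (N(Suc d := m)))"
proof -
  have "(\<Sum>m\<le>n. \<Sum>N\<in>comps d (n - m). f (N(Suc d := m)))
      = (\<Sum>(m, N)\<in>(SIGMA m:{..n}. comps d (n - m)). f (N(Suc d := m)))"
    by (intro sum.Sigma) (auto simp: finite_comps)
  also have "\<dots> = (\<Sum>N\<in>comps (Suc d) n. f N)"
    by (subst sum.reindex_bij_betw[OF comps_Suc, symmetric]) (simp add: case_prod_beta)
  finally show ?thesis by simp
qed

text \<open>Splitting off the last count leaves inner sums of the same kind with one state fewer and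
  total \<open>n - m\<close>; bounding these by induction leaves a binomial sum. Each of the
  \<open>d\<close> splittings costs a factor 4. A zero count is harmless since
  \<open>0 ^ 0 = 1\<close>.\<close>

lemma multinomial_sqrt_likelihood:
  fixes p :: "nat \<Rightarrow> real"
  assumes "\<And>j. j \<le> d \<Longrightarrow> p j > 0"
  shows "(\<Sum>N\<in>comps d n. \<Prod>j\<le>d. sqrt (p j ^ N j * real (N j) ^ N j) / fact (N j))
    \<le> 4 ^ d * sqrt (real n ^ n * (\<Sum>j\<le>d. p j) ^ n) / fact n"
  using assms
proof (induction d arbitrary: n)
  case 0
  then show ?case by (simp add: comps_0 mult_ac)
next
  case (Suc d)
  define q where "q = (\<Sum>j\<le>d. p j)"
  have q: "q > 0" unfolding q_def using Suc.prems by (intro sum_pos) auto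
  have p: "p (Suc d) > 0" using Suc.prems by simp
  define w where "w j m = sqrt (p j ^ m * real m ^ m) / fact m" for j m
  have w: "w (Suc d) m \<ge> 0" for m using p by (simp add: w_def)
  have "(\<Sum>N\<in>comps (Suc d) n. \<Prod>j\<le>Suc d. w j (N j))
      = (\<Sum>m\<le>n. \<Sum>N\<in>comps d (n - m). w (Suc d) m * (\<Prod>j\<le>d. w j (N j)))"
    unfolding sum_comps_Suc by (intro sum.cong refl) (auto intro!: prod.cong)
  also have "\<dots> = (\<Sum>m\<le>n. w (Suc d) m * (\<Sum>N\<in>comps d (n - m). \<Prod>j\<le>d. w j (N j)))"
    by (simp add: sum_distrib_left)
  also have "\<dots> \<le> (\<Sum>m\<le>n. w (Suc d) m * (4 ^ d * sqrt (real (n - m) ^ (n - m) * q ^ (n - m)) / fact (n - m)))"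
    unfolding q_def w_def using Suc.IH Suc.prems w[unfolded w_def]
    by (intro sum_mono mult_left_mono) (auto simp del: of_nat_diff)
  also have "\<dots> = 4 ^ d / fact n * (\<Sum>m\<le>n. real (n choose m) *
      sqrt (p (Suc d) ^ m * q ^ (n - m) * real m ^ m * real (n - m) ^ (n - m)))"
    unfolding sum_distrib_left
  proof (intro sum.cong refl)
    fix m assume "m \<in> {..n}"
    then have e: "real (n choose m) = fact n / (fact m * fact (n - m))" by (simp add: binomial_fact)
    show "w (Suc d) m * (4 ^ d * sqrt (real (n - m) ^ (n - m) * q ^ (n - m)) / fact (n - m))
      = 4 ^ d / fact n * (real (n choose m) * sqrt (p (Suc d) ^ m * q ^ (n - m) * real m ^ m * real (n - m) ^ (n - m)))"
      unfolding e w_def real_sqrt_mult by (simp add: divide_simps)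
  qed
  also have "\<dots> \<le> 4 ^ d / fact n * (4 * sqrt (real n ^ n * (p (Suc d) + q) ^ n))"
    by (intro mult_left_mono binomial_sqrt_likelihood p q) auto
  also have "\<dots> = 4 ^ Suc d * sqrt (real n ^ n * (\<Sum>j\<le>Suc d. p j) ^ n) / fact n"
    by (simp add: q_def add_ac)
  finally show ?case by (simp add: w_def)
qed


section \<open>The multinomial law and the tail of its likelihood ratio\<close>

lemma sqrt_prod: "sqrt (\<Prod>j\<in>A. f j) = (\<Prod>j\<in>A. sqrt (f j))"
  by (induction A rule: infinite_finite_induct) (simp_all add: real_sqrt_mult)

lemma set_pmf_multinomial:
  assumes "\<theta> \<in> Theta d"
  shows "set_pmf (multinomial_pmf n d \<theta>) \<subseteq> comps d n"
proof
  fix N assume "N \<in> set_pmf (multinomial_pmf n d \<theta>)"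
  then obtain xs where xs: "N = count_list xs" "set xs \<subseteq> set_pmf (categorical_pmf d \<theta>)" "length xs = n"
    by (auto simp: multinomial_pmf_def set_replicate_pmf)
  have sub: "set xs \<subseteq> {..d}"
    using xs(2) pmf_categorical[OF assms] by (auto simp: set_pmf_iff split: if_splits)
  then have "(\<Sum>j\<le>d. count_list xs j) = length xs"
    by (intro sum_count_set) auto
  moreover have "count_list xs j = 0" if "j > d" for j
    using sub that by (intro count_notin) auto
  ultimately show "N \<in> comps d n" using xs by (auto simp: comps_def)
qed

lemma multinomial_pmf_Suc:
  "multinomial_pmf (Suc n) d \<theta> =
     bind_pmf (categorical_pmf d \<theta>) (\<lambda>j. map_pmf (\<lambda>N. N(j := Suc (N j))) (multinomial_pmf n d \<theta>))"
proof -
  have "count_list (j # xs) = (count_list xs)(j := Suc (count_list xs j))" for j :: nat and xs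
    by (auto simp: fun_eq_iff)
  then show ?thesis
    by (simp add: multinomial_pmf_def map_bind_pmf map_pmf_comp)
       (simp add: map_pmf_def bind_assoc_pmf bind_return_pmf)
qed

text \<open>Induction on the draws, conditioning on one of them. If it shows state \<open>j\<close>,
  the contribution is the share \<open>N j / (n + 1)\<close> of the claimed value, and the shares
  add up to 1.\<close>

lemma pmf_multinomial:
  assumes "\<theta> \<in> Theta d" "N \<in> comps d n"
  shows "pmf (multinomial_pmf n d \<theta>) N = fact n * (\<Prod>j\<le>d. full d \<theta> j ^ N j / fact (N j))"
  using assms(2)
proof (induction n arbitrary: N)
  case 0
  then have "N j = 0" for j by (cases "j \<le> d") (auto simp: comps_def)
  then have "N = (\<lambda>_. 0)" by auto
  moreover have "count_list ([] :: nat list) = (\<lambda>_. 0)" by (auto simp: fun_eq_iff)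
  ultimately show ?case by (simp only: multinomial_pmf_def replicate_pmf.simps map_return_pmf) simp
next
  case (Suc n)
  define Q where "Q = (\<Prod>j\<le>d. full d \<theta> j ^ N j / fact (N j))"
  have step: "full d \<theta> j * pmf (map_pmf (\<lambda>N. N(j := Suc (N j))) (multinomial_pmf n d \<theta>)) N = real (N j) * (fact n * Q)"
    if j: "j \<le> d" for j
  proof (cases "N j = 0")
    case True
    then have "N \<notin> (\<lambda>N. N(j := Suc (N j))) ` set_pmf (multinomial_pmf n d \<theta>)"
      by (metis (no_types, lifting) fun_upd_same imageE nat.distinct(1))
    then show ?thesis using True by (simp add: pmf_map_outside)
  next
    case False
    define N' where "N' = N(j := N j - 1)"
    have N: "N = N'(j := Suc (N' j))" using False by (auto simp: N'_def)
    have "inj (\<lambda>N :: nat \<Rightarrow> nat. N(j := Suc (N j)))"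
    proof (rule injI, rule ext)
      fix M M' :: "nat \<Rightarrow> nat" and i assume "M(j := Suc (M j)) = M'(j := Suc (M' j))"
      from fun_cong[OF this, of i] show "M i = M' i" by (auto split: if_splits)
    qed
    then have "pmf (map_pmf (\<lambda>N. N(j := Suc (N j))) (multinomial_pmf n d \<theta>)) N = pmf (multinomial_pmf n d \<theta>) N'"
      by (subst N) (rule pmf_map_inj')
    also have "\<dots> = fact n * (\<Prod>j\<le>d. full d \<theta> j ^ N' j / fact (N' j))"
    proof (rule Suc.IH)
      have "(\<Sum>i\<le>d. N i) = Suc (\<Sum>i\<le>d. N' i)"
        using j False by (subst (1 2) sum.remove[of _ j]) (auto simp: N'_def intro!: sum.cong)
      then show "N' \<in> comps d n" using Suc.prems j by (auto simp: comps_def N'_def)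
    qed
    finally have pmf_eq: "pmf (map_pmf (\<lambda>N. N(j := Suc (N j))) (multinomial_pmf n d \<theta>)) N
      = fact n * (\<Prod>j\<le>d. full d \<theta> j ^ N' j / fact (N' j))" .
    have e1: "(\<Prod>i\<in>{..d}-{j}. full d \<theta> i ^ N' i / fact (N' i)) = (\<Prod>i\<in>{..d}-{j}. full d \<theta> i ^ N i / fact (N i))"
      by (intro prod.cong) (auto simp: N'_def)
    have e2: "full d \<theta> j * (full d \<theta> j ^ N' j / fact (N' j)) = real (N j) * (full d \<theta> j ^ N j / fact (N j))"
    proof -
      obtain k where k: "N j = Suc k" using False by (cases "N j") auto
      have "real (Suc k) * (full d \<theta> j ^ Suc k / (real (Suc k) * fact k)) = full d \<theta> j ^ Suc k / fact k"
        by (simp del: of_nat_Suc power_Suc)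
      then show ?thesis using k by (simp add: N'_def del: of_nat_Suc)
    qed
    have "full d \<theta> j * (\<Prod>j\<le>d. full d \<theta> j ^ N' j / fact (N' j)) = real (N j) * Q"
      unfolding Q_def using j
      by (subst (1 2) prod.remove[of _ j]) (simp_all only: mult.assoc[symmetric] e1 e2 finite_atMost atMost_iff)
    then show ?thesis unfolding pmf_eq by (simp add: mult_ac)
  qed
  have "pmf (multinomial_pmf (Suc n) d \<theta>) N
      = (\<Sum>j\<le>d. pmf (map_pmf (\<lambda>N. N(j := Suc (N j))) (multinomial_pmf n d \<theta>)) N * pmf (categorical_pmf d \<theta>) j)"
    unfolding multinomial_pmf_Suc pmf_bind
    by (rule integral_measure_pmf_real) (auto simp: set_pmf_iff pmf_categorical[OF assms(1)] split: if_splits)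
  also have "\<dots> = (\<Sum>j\<le>d. real (N j) * (fact n * Q))"
    using step by (intro sum.cong) (auto simp: pmf_categorical[OF assms(1)] mult_ac)
  also have "\<dots> = real (\<Sum>j\<le>d. N j) * (fact n * Q)" by (simp add: sum_distrib_right)
  also have "(\<Sum>j\<le>d. N j) = Suc n" using Suc.prems by (simp add: comps_def)
  finally show ?case by (simp add: Q_def algebra_simps)
qed

text \<open>Markov's inequality for the square root of the likelihood ratio \<open>R N\<close>,
  whose logarithm is \<open>n\<close> times the relative entropy of the frequencies from
  \<open>\<theta>\<close>. The expectation of \<open>R\<close> itself grows like a power of
  \<open>n\<close>, whereas that of its root is at most \<open>4 ^ d\<close>.\<close>

lemma multinomial_likelihood_ratio_tail:
  assumes \<theta>: "\<theta> \<in> Theta d" and n: "n \<ge> 1"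
  shows "measure_pmf.prob (multinomial_pmf n d \<theta>)
      {N \<in> comps d n. (\<Prod>j\<le>d. (real (N j) / (real n * full d \<theta> j)) ^ N j) \<le> exp t} \<ge> 1 - 4 ^ d * exp (- t / 2)"
proof -
  let ?M = "multinomial_pmf n d \<theta>"
  define R where "R N = (\<Prod>j\<le>d. (real (N j) / (real n * full d \<theta> j)) ^ N j)" for N :: "nat \<Rightarrow> nat"
  have fp: "full d \<theta> j > 0" if "j \<le> d" for j using full_pos[OF \<theta> that] .
  have R: "R N \<ge> 0" for N
    unfolding R_def using fp by (intro prod_nonneg) (auto simp: less_imp_le)
  define B where "B = {N \<in> comps d n. R N > exp t}"
  have fin: "finite B" unfolding B_def using finite_comps[of d n] by auto
  \<comment> \<open>Half of each exponent of \<open>full d \<theta> j\<close> cancels, and the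
    result is again a product over the states, the summand of the multinomial sum above.\<close>
  have sqrt_eq: "pmf ?M N * sqrt (R N)
      = fact n / sqrt (real n ^ n) * (\<Prod>j\<le>d. sqrt (full d \<theta> j ^ N j * real (N j) ^ N j) / fact (N j))"
    if N: "N \<in> comps d n" for N
  proof -
    have "(\<Prod>j\<le>d. sqrt (real n ^ N j)) = sqrt (real n ^ n)"
      using N by (simp add: comps_def flip: sqrt_prod power_sum)
    have "(full d \<theta> j ^ N j / fact (N j)) * sqrt ((real (N j) / (real n * full d \<theta> j)) ^ N j)
      = (sqrt (full d \<theta> j ^ N j * real (N j) ^ N j) / fact (N j)) / sqrt (real n ^ N j)" if "j \<le> d" for j
    proof -
      define a where "a = full d \<theta> j ^ N j"
      have a: "a > 0" using fp[OF that] by (simp add: a_def)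
      have "a * sqrt (real (N j) ^ N j / (real n ^ N j * a)) = sqrt (a * real (N j) ^ N j) / sqrt (real n ^ N j)"
      proof -
        have "a = sqrt a * sqrt a" using a by simp
        then show ?thesis using a by (simp add: real_sqrt_mult real_sqrt_divide divide_simps)
      qed
      then show ?thesis by (simp add: a_def power_divide power_mult_distrib)
    qed
    note term_eq = this
    have "pmf ?M N * sqrt (R N)
      = fact n * (\<Prod>j\<le>d. (full d \<theta> j ^ N j / fact (N j)) * sqrt ((real (N j) / (real n * full d \<theta> j)) ^ N j))"
      unfolding pmf_multinomial[OF \<theta> N] R_def sqrt_prod prod.distrib by simp
    also have "\<dots> = fact n * (\<Prod>j\<le>d. (sqrt (full d \<theta> j ^ N j * real (N j) ^ N j) / fact (N j)) / sqrt (real n ^ N j))"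
      using term_eq by (intro arg_cong[of _ _ "(*) (fact n)"] prod.cong) auto
    finally show ?thesis
      using \<open>(\<Prod>j\<le>d. sqrt (real n ^ N j)) = sqrt (real n ^ n)\<close> by (simp add: prod_dividef prod.distrib)
  qed
  have "exp (t / 2) * measure ?M B = (\<Sum>N\<in>B. exp (t / 2) * pmf ?M N)"
    by (simp add: measure_measure_pmf_finite fin sum_distrib_left)
  also have "\<dots> \<le> (\<Sum>N\<in>B. pmf ?M N * sqrt (R N))"
  proof (rule sum_mono)
    fix N assume "N \<in> B"
    then have "exp t \<le> R N" by (simp add: B_def)
    then have "sqrt (exp t) \<le> sqrt (R N)" by simp
    moreover have "sqrt (exp t) = exp (t / 2)"
      by (intro real_sqrt_unique) (auto simp: power2_eq_square mult_exp_exp)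
    ultimately show "exp (t / 2) * pmf ?M N \<le> pmf ?M N * sqrt (R N)"
      by (simp add: mult.commute[of "exp (t / 2)"] mult_left_mono)
  qed
  also have "\<dots> \<le> (\<Sum>N\<in>comps d n. pmf ?M N * sqrt (R N))"
    using R by (intro sum_mono2) (auto simp: B_def finite_comps)
  also have "\<dots> = fact n / sqrt (real n ^ n) *
      (\<Sum>N\<in>comps d n. \<Prod>j\<le>d. sqrt (full d \<theta> j ^ N j * real (N j) ^ N j) / fact (N j))"
    unfolding sum_distrib_left by (intro sum.cong refl sqrt_eq)
  also have "\<dots> \<le> fact n / sqrt (real n ^ n) * (4 ^ d * sqrt (real n ^ n * (\<Sum>j\<le>d. full d \<theta> j) ^ n) / fact n)"
    by (intro mult_left_mono multinomial_sqrt_likelihood fp) auto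
  also have "(\<Sum>j\<le>d. full d \<theta> j) = 1" using sum_full[of d \<theta>] by (simp add: atLeast0AtMost)
  also have "fact n / sqrt (real n ^ n) * (4 ^ d * sqrt (real n ^ n * 1 ^ n) / fact n) = 4 ^ d"
    using n by simp
  finally have B: "measure ?M B \<le> 4 ^ d * exp (- t / 2)"
    by (simp add: exp_minus field_simps)
  have "1 = measure ?M (comps d n)"
    using set_pmf_multinomial[OF \<theta>] by (simp add: measure_pmf.prob_eq_1 AE_measure_pmf_iff subset_iff)
  also have "comps d n = {N \<in> comps d n. R N \<le> exp t} \<union> B" by (auto simp: B_def)
  also have "measure ?M \<dots> \<le> measure ?M {N \<in> comps d n. R N \<le> exp t} + measure ?M B"
    by (intro measure_Un_le) auto
  finally show ?thesis using B by (simp add: R_def)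
qed

section \<open>Square roots of positive semidefinite matrices\<close>

lemma scalar_prod_self_pos_iff:
  fixes v :: "real Matrix.vec"
  shows "0 < scalar_prod v v \<longleftrightarrow> v \<noteq> 0\<^sub>v (dim_vec v)"
proof -
  have *: "scalar_prod v v = (\<Sum>i<dim_vec v. (v $ i)\<^sup>2)"
    by (simp add: scalar_prod_def power2_eq_square atLeast0LessThan)
  have "(\<Sum>i<dim_vec v. (v $ i)\<^sup>2) = 0 \<longleftrightarrow> (\<forall>i<dim_vec v. v $ i = 0)"
    by (subst sum_nonneg_eq_0_iff) auto
  also have "\<dots> \<longleftrightarrow> v = 0\<^sub>v (dim_vec v)" by (auto simp: vec_eq_iff)
  finally show ?thesis
    using sum_nonneg[of "{..<dim_vec v}" "\<lambda>i. (v $ i)\<^sup>2"] unfolding * by (auto simp: less_le)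
qed

lemma scalar_prod_self_nonneg: "0 \<le> scalar_prod v v" for v :: "real Matrix.vec"
  by (simp add: scalar_prod_def sum_nonneg)

lemma symmetric_scalar_prod:
  fixes A :: "'a :: comm_semiring_0 mat"
  assumes "A \<in> carrier_mat n n" "transpose_mat A = A" "v \<in> carrier_vec n" "w \<in> carrier_vec n"
  shows "scalar_prod v (A *\<^sub>v w) = scalar_prod (A *\<^sub>v v) w"
  using assoc_scalar_prod[of v n A n w] transpose_vec_mult_scalar assms
  by (metis mult_mat_vec_carrier comm_scalar_prod)

text \<open>The real and imaginary parts of a complex eigenvector satisfy \<open>A x = \<alpha> x - \<beta> y\<close> and
  \<open>A y = \<alpha> y + \<beta> x\<close>; symmetry of \<open>A\<close> forces \<open>\<beta> = 0\<close>.\<close>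
lemma symmetric_real_eigenvector:
  fixes A :: "real Matrix.mat"
  assumes A: "A \<in> carrier_mat n n" and sym: "transpose_mat A = A" and n: "n > 0"
  obtains v lam where "v \<in> carrier_vec n" "scalar_prod v v = 1" "A *\<^sub>v v = lam \<cdot>\<^sub>v v"
proof -
  define C where "C = map_mat complex_of_real A"
  have C: "C \<in> carrier_mat n n" using A by (simp add: C_def)
  obtain as where as: "char_poly C = (\<Prod>a\<leftarrow>as. [:- a, 1:])" "length as = n"
    using char_poly_factorized[OF C] by blast
  then obtain a as' where "as = a # as'" using n by (cases as) auto
  then have "poly (char_poly C) a = 0" using as by simp
  then obtain w where w: "w \<in> carrier_vec n" "w \<noteq> 0\<^sub>v n" "C *\<^sub>v w = a \<cdot>\<^sub>v w"
    using eigenvalue_root_char_poly[OF C] C by (auto simp: eigenvalue_def eigenvector_def)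
  define x y where "x = map_vec Re w" and "y = map_vec Im w"
  have xy: "x \<in> carrier_vec n" "y \<in> carrier_vec n" using w by (auto simp: x_def y_def)
  have ev: "(\<Sum>j<n. complex_of_real (A $$ (i, j)) * w $ j) = a * w $ i" if "i < n" for i
    using arg_cong[OF w(3), of "\<lambda>v. v $ i"] that A w(1) C
    by (simp add: scalar_prod_def C_def atLeast0LessThan)
  have Ax: "A *\<^sub>v x = Re a \<cdot>\<^sub>v x - Im a \<cdot>\<^sub>v y"
  proof (rule eq_vecI)
    fix i assume "i < dim_vec (Re a \<cdot>\<^sub>v x - Im a \<cdot>\<^sub>v y)"
    then have i: "i < n" using xy by simp
    have "(\<Sum>j<n. A $$ (i, j) * Re (w $ j)) = Re (\<Sum>j<n. complex_of_real (A $$ (i, j)) * w $ j)"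
      by simp
    then show "(A *\<^sub>v x) $ i = (Re a \<cdot>\<^sub>v x - Im a \<cdot>\<^sub>v y) $ i"
      using i A w(1) xy ev[OF i] by (simp add: scalar_prod_def atLeast0LessThan x_def y_def)
  qed (use A xy in auto)
  have Ay: "A *\<^sub>v y = Re a \<cdot>\<^sub>v y + Im a \<cdot>\<^sub>v x"
  proof (rule eq_vecI)
    fix i assume "i < dim_vec (Re a \<cdot>\<^sub>v y + Im a \<cdot>\<^sub>v x)"
    then have i: "i < n" using xy by simp
    have "(\<Sum>j<n. A $$ (i, j) * Im (w $ j)) = Im (\<Sum>j<n. complex_of_real (A $$ (i, j)) * w $ j)"
      by simp
    then show "(A *\<^sub>v y) $ i = (Re a \<cdot>\<^sub>v y + Im a \<cdot>\<^sub>v x) $ i"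
      using i A w(1) xy ev[OF i] by (simp add: scalar_prod_def atLeast0LessThan x_def y_def)
  qed (use A xy in auto)
  have "scalar_prod x (A *\<^sub>v y) = scalar_prod (A *\<^sub>v x) y"
    using symmetric_scalar_prod[OF A sym] xy by blast
  then have "Im a * (scalar_prod x x + scalar_prod y y) = 0"
    unfolding Ax Ay using xy comm_scalar_prod[of x n y]
    by (simp add: scalar_prod_add_distrib[of _ n] minus_scalar_prod_distrib[of _ n] algebra_simps)
  moreover have nz: "x \<noteq> 0\<^sub>v n \<or> y \<noteq> 0\<^sub>v n"
  proof (rule ccontr)
    assume "\<not> (x \<noteq> 0\<^sub>v n \<or> y \<noteq> 0\<^sub>v n)"
    then have z: "map_vec Re w = 0\<^sub>v n" "map_vec Im w = 0\<^sub>v n" by (auto simp: x_def y_def)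
    have "w = 0\<^sub>v n"
    proof (rule eq_vecI)
      fix i assume "i < dim_vec (0\<^sub>v n :: complex Matrix.vec)"
      then show "w $ i = 0\<^sub>v n $ i"
        using arg_cong[OF z(1), of "\<lambda>v. v $ i"] arg_cong[OF z(2), of "\<lambda>v. v $ i"] w(1)
        by (simp add: complex_eq_iff)
    qed (use w in auto)
    with w show False by simp
  qed
  ultimately have "Im a = 0"
    using scalar_prod_self_pos_iff[of x] scalar_prod_self_pos_iff[of y] xy
      scalar_prod_self_nonneg[of x] scalar_prod_self_nonneg[of y] by auto
  then have "A *\<^sub>v x = Re a \<cdot>\<^sub>v x" "A *\<^sub>v y = Re a \<cdot>\<^sub>v y"
    unfolding Ax Ay using xy by auto
  with nz xy obtain z where z: "z \<in> carrier_vec n" "z \<noteq> 0\<^sub>v n" "A *\<^sub>v z = Re a \<cdot>\<^sub>v z" by blast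
  define c where "c = 1 / sqrt (scalar_prod z z)"
  have zz: "scalar_prod z z > 0" using z scalar_prod_self_pos_iff[of z] by auto
  show thesis
  proof (rule that)
    show "c \<cdot>\<^sub>v z \<in> carrier_vec n" using z by simp
    show "scalar_prod (c \<cdot>\<^sub>v z) (c \<cdot>\<^sub>v z) = 1"
      using z zz by (simp add: c_def)
    show "A *\<^sub>v (c \<cdot>\<^sub>v z) = Re a \<cdot>\<^sub>v (c \<cdot>\<^sub>v z)"
      using z A by (simp add: mult_mat_vec[of _ n n] smult_smult_assoc mult.commute)
  qed
qed

text \<open>The reflection in the hyperplane orthogonal to \<open>v - e_0\<close> exchanges the unit
  vectors \<open>e_0\<close> and \<open>v\<close>. Being symmetric and its own inverse, it is a
  change of basis that needs no Gram-Schmidt process.\<close>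

lemma householder:
  fixes v :: "real Matrix.vec"
  assumes v: "v \<in> carrier_vec n" "scalar_prod v v = 1" and n: "n > 0"
  obtains H where "H \<in> carrier_mat n n" "transpose_mat H = H" "H * H = 1\<^sub>m n" "H *\<^sub>v unit_vec n 0 = v"
proof (cases "v = unit_vec n 0")
  case True
  then show ?thesis using that[of "1\<^sub>m n"] v by auto
next
  case False
  define u where "u i = v $ i - (if i = 0 then 1 else 0)" for i
  define S where "S = (\<Sum>i<n. u i * u i)"
  define c where "c = 2 / S"
  have vv: "(\<Sum>i<n. v $ i * v $ i) = 1" using v by (simp add: scalar_prod_def atLeast0LessThan)
  \<comment> \<open>As \<open>v\<close> has length 1, the squared length of
    \<open>u = v - e_0\<close> is \<open>2 - 2 * v $ 0\<close>.\<close>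
  have S: "S = - 2 * u 0"
  proof -
    have "S = (\<Sum>i<n. v $ i * v $ i + (if i = 0 then 1 - 2 * v $ 0 else 0))"
      unfolding S_def u_def by (intro sum.cong) (auto simp: algebra_simps)
    also have "\<dots> = 1 + (1 - 2 * v $ 0)" using n by (simp add: sum.distrib vv sum.delta)
    finally show ?thesis by (simp add: u_def)
  qed
  have "S \<noteq> 0"
  proof
    assume "S = 0"
    then have "u i = 0" if "i < n" for i
      unfolding S_def using that by (subst (asm) sum_nonneg_eq_0_iff) auto
    then have "v = unit_vec n 0" using v by (intro eq_vecI) (auto simp: u_def split: if_splits)
    with False show False by simp
  qed
  define H where "H = Matrix.mat n n (\<lambda>(i, j). (if i = j then 1 else 0) - c * u i * u j)"
  show ?thesis
  proof (rule that)
    show "H \<in> carrier_mat n n" by (simp add: H_def)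
    show "transpose_mat H = H" by (rule eq_matI) (auto simp: H_def)
    show "H * H = 1\<^sub>m n"
    proof (rule eq_matI)
      fix i j assume "i < dim_row (1\<^sub>m n :: real Matrix.mat)" "j < dim_col (1\<^sub>m n :: real Matrix.mat)"
      then have ij: "i < n" "j < n" by auto
      have "(H * H) $$ (i, j) = (\<Sum>k<n. ((if i = k then 1 else 0) - c * u i * u k) * ((if k = j then 1 else 0) - c * u k * u j))"
        using ij by (simp add: H_def scalar_prod_def atLeast0LessThan)
      also have "\<dots> = (\<Sum>k<n. (if k = i then (if i = j then 1 else 0) - c * u i * u j else 0)
          - (if k = j then c * u i * u j else 0) + c * c * u i * u j * (u k * u k))"
        by (intro sum.cong refl) (auto simp: algebra_simps)
      also have "\<dots> = (if i = j then 1 else 0) - 2 * (c * u i * u j) + c * c * u i * u j * S"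
        using ij by (simp add: sum.distrib sum_subtractf S_def flip: sum_distrib_left)
      also have "c * c * u i * u j * S = 2 * (c * u i * u j)" using \<open>S \<noteq> 0\<close> by (simp add: c_def)
      finally show "(H * H) $$ (i, j) = 1\<^sub>m n $$ (i, j)" using ij by simp
    qed (auto simp: H_def)
    show "H *\<^sub>v unit_vec n 0 = v"
    proof (rule eq_vecI)
      fix i assume "i < dim_vec v"
      then have i: "i < n" using v by simp
      have "c * u 0 = -1" using \<open>S \<noteq> 0\<close> S by (simp add: c_def field_simps)
      then have "c * u i * u 0 = - u i" by (metis mult.commute mult.left_commute mult_minus1)
      then show "(H *\<^sub>v unit_vec n 0) $ i = v $ i"
        using i n by (simp add: H_def) (simp add: u_def)
    qed (use v in \<open>auto simp: H_def\<close>)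
  qed
qed

text \<open>Deflation: a reflection taking \<open>e_0\<close> to a unit eigenvector conjugates
  \<open>A\<close> to a block matrix with the eigenvalue in the corner, and the root is assembled
  from the square root of the eigenvalue and the root of the remaining block. Since
  \<open>msqrt\<close> is a choice, this existence is what gives it its properties.\<close>

lemma is_psd_sqrt_exists:
  fixes A :: "real Matrix.mat"
  assumes "A \<in> carrier_mat n n" "transpose_mat A = A"
    and "\<And>v. v \<in> carrier_vec n \<Longrightarrow> 0 \<le> scalar_prod v (A *\<^sub>v v)"
  shows "\<exists>R. is_psd_sqrt A R"
  using assms
proof (induction n arbitrary: A)
  case 0
  then have "A = 1\<^sub>m 0" by (intro eq_matI) auto
  then show ?case by (intro exI[of _ "1\<^sub>m 0"]) (auto simp: is_psd_sqrt_def scalar_prod_self_nonneg)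
next
  case (Suc m)
  let ?n = "Suc m"
  note A = Suc.prems(1) and sym = Suc.prems(2) and psd = Suc.prems(3)
  obtain v lam where v: "v \<in> carrier_vec ?n" "scalar_prod v v = 1" "A *\<^sub>v v = lam \<cdot>\<^sub>v v"
    using symmetric_real_eigenvector[OF A sym] by blast
  have "lam \<ge> 0" using psd[OF v(1)] v by simp
  obtain H where H: "H \<in> carrier_mat ?n ?n" "transpose_mat H = H" "H * H = 1\<^sub>m ?n" "H *\<^sub>v unit_vec ?n 0 = v"
    using householder[OF v(1,2)] by blast
  define B where "B = H * A * H"
  have B: "B \<in> carrier_mat ?n ?n" using H A by (simp add: B_def)
  have symB: "transpose_mat B = B"
    unfolding B_def using H(1,2) A sym
    by (simp add: transpose_mult[of _ ?n ?n _ ?n] assoc_mult_mat[of _ ?n ?n _ ?n _ ?n])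
  have HBH: "H * B * H = A"
  proof -
    have "H * B * H = (H * H) * A * (H * H)"
      unfolding B_def using H(1) A by (simp add: assoc_mult_mat[of _ ?n ?n _ ?n _ ?n])
    then show ?thesis using H A by simp
  qed
  have psdB: "0 \<le> scalar_prod w (B *\<^sub>v w)" if w: "w \<in> carrier_vec ?n" for w
  proof -
    have "scalar_prod w (B *\<^sub>v w) = scalar_prod w (H *\<^sub>v (A *\<^sub>v (H *\<^sub>v w)))"
      unfolding B_def using H(1) A w by (simp add: assoc_mult_mat_vec[of _ ?n ?n _ ?n])
    also have "\<dots> = scalar_prod (H *\<^sub>v w) (A *\<^sub>v (H *\<^sub>v w))"
      using H A w by (intro symmetric_scalar_prod[of _ ?n]) auto
    finally show ?thesis using psd[of "H *\<^sub>v w"] H w by simp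
  qed
  have "H *\<^sub>v v = unit_vec ?n 0"
  proof -
    have "H *\<^sub>v v = (H * H) *\<^sub>v unit_vec ?n 0"
      using H(1) unfolding H(4)[symmetric] by (simp add: assoc_mult_mat_vec[of _ ?n ?n _ ?n])
    then show ?thesis using H(3) by simp
  qed
  then have Be0: "B *\<^sub>v unit_vec ?n 0 = lam \<cdot>\<^sub>v unit_vec ?n 0"
    unfolding B_def using H A v
    by (simp add: assoc_mult_mat_vec[of _ ?n ?n _ ?n] mult_mat_vec[of _ ?n ?n])
  have col0: "B $$ (i, 0) = (if i = 0 then lam else 0)" if "i < ?n" for i
    using arg_cong[OF Be0, of "\<lambda>v. v $ i"] that B by (auto split: if_splits)
  have row0: "B $$ (0, j) = (if j = 0 then lam else 0)" if "j < ?n" for j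
    using col0[OF that] arg_cong[OF symB, of "\<lambda>M. M $$ (j, 0)"] B that by simp
  define B' where "B' = Matrix.mat m m (\<lambda>(i, j). B $$ (Suc i, Suc j))"
  have B': "B' \<in> carrier_mat m m" by (simp add: B'_def)
  define L :: "real \<Rightarrow> real Matrix.mat" where "L x = Matrix.mat 1 1 (\<lambda>_. x)" for x
  have L: "L x \<in> carrier_mat 1 1" for x by (simp add: L_def)
  have B_block: "B = four_block_mat (L lam) (0\<^sub>m 1 m) (0\<^sub>m m 1) B'"
  proof (rule eq_matI)
    fix i j assume "i < dim_row (four_block_mat (L lam) (0\<^sub>m 1 m) (0\<^sub>m m 1) B')"
      "j < dim_col (four_block_mat (L lam) (0\<^sub>m 1 m) (0\<^sub>m m 1) B')"
    then show "B $$ (i, j) = four_block_mat (L lam) (0\<^sub>m 1 m) (0\<^sub>m m 1) B' $$ (i, j)"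
      using col0[of i] row0[of j] by (auto simp: L_def B'_def)
  qed (use B in \<open>auto simp: L_def B'_def\<close>)
  have symB': "transpose_mat B' = B'"
  proof (rule eq_matI)
    fix i j assume "i < dim_row B'" "j < dim_col B'"
    then show "transpose_mat B' $$ (i, j) = B' $$ (i, j)"
      using arg_cong[OF symB, of "\<lambda>M. M $$ (Suc i, Suc j)"] B by (simp add: B'_def)
  qed (auto simp: B'_def)
  \<comment> \<open>Stated for an arbitrary corner and block because it is used twice: to pass
    positivity from \<open>B\<close> down to \<open>B'\<close>, and from \<open>R'\<close> up to
    \<open>Q\<close>.\<close>
  have block_quad: "scalar_prod w (four_block_mat (L x) (0\<^sub>m 1 m) (0\<^sub>m m 1) M *\<^sub>v w)
      = x * (w $ 0)\<^sup>2 + scalar_prod (vec_last w m) (M *\<^sub>v vec_last w m)"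
    if w: "w \<in> carrier_vec ?n" and M: "M \<in> carrier_mat m m" for w M x
  proof -
    have idx: "vec_last w m $ i = w $ Suc i" if "i < m" for i using w that by (simp add: vec_last_def)
    define F where "F = four_block_mat (L x) (0\<^sub>m 1 m) (0\<^sub>m m 1) M"
    have F: "F \<in> carrier_mat ?n ?n"
      unfolding F_def using M L by (metis four_block_carrier_mat plus_1_eq_Suc)
    have entries: "F $$ (0, 0) = x" "\<And>j. j < m \<Longrightarrow> F $$ (0, Suc j) = 0" "\<And>i. i < m \<Longrightarrow> F $$ (Suc i, 0) = 0"
      "\<And>i j. i < m \<Longrightarrow> j < m \<Longrightarrow> F $$ (Suc i, Suc j) = M $$ (i, j)"
      using M L[of x] by (simp_all add: F_def) (simp_all add: L_def)
    have Fw: "(F *\<^sub>v w) $ i = F $$ (i, 0) * w $ 0 + (\<Sum>j<m. F $$ (i, Suc j) * w $ Suc j)" if "i < ?n" for i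
      using that w F
      by (simp add: scalar_prod_def atLeast0LessThan sum.lessThan_Suc_shift del: sum.lessThan_Suc sum.op_ivl_Suc)
    have "scalar_prod w (F *\<^sub>v w) = w $ 0 * (F *\<^sub>v w) $ 0 + (\<Sum>i<m. w $ Suc i * (F *\<^sub>v w) $ Suc i)"
      using F by (simp add: scalar_prod_def[of w] atLeast0LessThan sum.lessThan_Suc_shift del: sum.lessThan_Suc sum.op_ivl_Suc index_mult_mat_vec)
    also have "\<dots> = x * (w $ 0)\<^sup>2 + (\<Sum>i<m. w $ Suc i * (\<Sum>j<m. M $$ (i, j) * w $ Suc j))"
      using Fw entries by (simp add: power2_eq_square del: index_mult_mat_vec)
    also have "(\<Sum>i<m. w $ Suc i * (\<Sum>j<m. M $$ (i, j) * w $ Suc j)) = scalar_prod (vec_last w m) (M *\<^sub>v vec_last w m)"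
      using w M idx by (simp add: scalar_prod_def atLeast0LessThan)
    finally show ?thesis by (simp add: F_def)
  qed
  have psdB': "0 \<le> scalar_prod w (B' *\<^sub>v w)" if w: "w \<in> carrier_vec m" for w
  proof -
    define z where "z = 0\<^sub>v 1 @\<^sub>v w"
    have z: "z \<in> carrier_vec ?n" unfolding z_def using append_carrier_vec[of "0\<^sub>v 1" 1 w m] w by simp
    have dw: "dim_vec w = m" using w by simp
    have "vec_last z m = w" by (rule eq_vecI) (simp_all add: vec_last_def z_def dw)
    moreover have "z $ 0 = 0" by (simp add: z_def)
    ultimately show ?thesis
      using psdB[OF z] block_quad[OF z B', of lam] unfolding B_block[symmetric] by simp
  qed
  obtain R' where "is_psd_sqrt B' R'" using Suc.IH[OF B' symB' psdB'] by blast
  then have R': "R' \<in> carrier_mat m m" "transpose_mat R' = R'" "R' * R' = B'"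
    "\<And>w. w \<in> carrier_vec m \<Longrightarrow> 0 \<le> scalar_prod w (R' *\<^sub>v w)"
    using B' by (auto simp: is_psd_sqrt_def)
  define Q where "Q = four_block_mat (L (sqrt lam)) (0\<^sub>m 1 m) (0\<^sub>m m 1) R'"
  have Q: "Q \<in> carrier_mat ?n ?n" unfolding Q_def using R' L by (metis four_block_carrier_mat plus_1_eq_Suc)
  have symQ: "transpose_mat Q = Q"
  proof -
    have zero_transpose: "transpose_mat (0\<^sub>m a b) = (0\<^sub>m b a :: real Matrix.mat)" for a b
      by (rule eq_matI) auto
    have "transpose_mat (L (sqrt lam)) = L (sqrt lam)" by (rule eq_matI) (auto simp: L_def)
    then show ?thesis
      unfolding Q_def using R'
      by (subst transpose_four_block_mat[OF L[of "sqrt lam"] _ _ R'(1)]) (auto simp: zero_transpose)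
  qed
  have QQ: "Q * Q = B"
  proof -
    have "L (sqrt lam) * L (sqrt lam) = L lam"
      using \<open>lam \<ge> 0\<close> by (intro eq_matI) (auto simp: L_def scalar_prod_def)
    then show ?thesis
      unfolding Q_def B_block using R' L[of "sqrt lam"] L[of "lam"]
      by (subst mult_four_block_mat[of _ 1 1 _ m _ m _ _ 1 _ m]) auto
  qed
  have psdQ: "0 \<le> scalar_prod w (Q *\<^sub>v w)" if "w \<in> carrier_vec ?n" for w
    unfolding Q_def block_quad[OF that R'(1)] using R'(4)[of "vec_last w m"] \<open>lam \<ge> 0\<close> by simp
  define R where "R = H * Q * H"
  have "is_psd_sqrt A R"
    unfolding is_psd_sqrt_def
  proof (intro conjI ballI)
    show "R \<in> carrier_mat (dim_row A) (dim_row A)" using H Q A by (simp add: R_def)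
    show "transpose_mat R = R"
      unfolding R_def using H(1,2) Q symQ
      by (simp add: transpose_mult[of _ ?n ?n _ ?n] assoc_mult_mat[of _ ?n ?n _ ?n _ ?n])
    show "0 \<le> scalar_prod w (R *\<^sub>v w)" if "w \<in> carrier_vec (dim_row A)" for w
    proof -
      have w: "w \<in> carrier_vec ?n" using that A by simp
      have "scalar_prod w (R *\<^sub>v w) = scalar_prod w (H *\<^sub>v (Q *\<^sub>v (H *\<^sub>v w)))"
        unfolding R_def using H(1) Q w by (simp add: assoc_mult_mat_vec[of _ ?n ?n _ ?n])
      also have "\<dots> = scalar_prod (H *\<^sub>v w) (Q *\<^sub>v (H *\<^sub>v w))"
        using H Q w by (intro symmetric_scalar_prod[of _ ?n]) auto
      finally show ?thesis using psdQ[of "H *\<^sub>v w"] H w by simp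
    qed
    have "R * R = H * Q * (H * H) * Q * H"
      unfolding R_def using H(1) Q by (simp add: assoc_mult_mat[of _ ?n ?n _ ?n _ ?n])
    also have "\<dots> = H * (Q * Q) * H"
      unfolding H(3) using H(1) Q by (simp add: assoc_mult_mat[of _ ?n ?n _ ?n _ ?n])
    finally show "R * R = A" unfolding QQ HBH .
  qed
  then show ?case by blast
qed

section \<open>The Fisher norm\<close>

text \<open>The matrix determinant lemma by bordering. Row operations turn the bordered matrix
  \<open>M\<close> into a block triangular one with diagonal blocks 1 and \<open>F\<close>, column
  operations into one with diagonal blocks \<open>sc\<close> and \<open>D\<close>, and neither
  changes the determinant.\<close>

lemma det_diag_plus_const:
  fixes a :: "nat \<Rightarrow> real" and b :: real
  assumes a: "\<And>i. i < d \<Longrightarrow> a i \<noteq> 0"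
  shows "Determinant.det (Matrix.mat d d (\<lambda>(i, k). (if i = k then a i else 0) + b))
    = (\<Prod>i<d. a i) * (1 + b * (\<Sum>i<d. 1 / a i))"
proof -
  define D where "D = Matrix.mat d d (\<lambda>(i, k). if i = k then a i else 0)"
  define F where "F = Matrix.mat d d (\<lambda>(i, k). (if i = k then a i else 0) + b)"
  define r where "r = Matrix.mat 1 d (\<lambda>_. - b)"
  define c where "c x = Matrix.mat d 1 (\<lambda>(i, k). x i :: real)" for x :: "nat \<Rightarrow> real"
  define sc where "sc = Matrix.mat 1 1 (\<lambda>_. 1 + b * (\<Sum>i<d. 1 / a i))"
  define M where "M = four_block_mat (1\<^sub>m 1) r (c (\<lambda>_. 1)) D"
  define P where "P = four_block_mat (1\<^sub>m 1) (0\<^sub>m 1 d) (c (\<lambda>_. - 1)) (1\<^sub>m d)"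
  define Q where "Q = four_block_mat (1\<^sub>m 1) (0\<^sub>m 1 d) (c (\<lambda>i. - 1 / a i)) (1\<^sub>m d)"
  have carr [simp]: "D \<in> carrier_mat d d" "F \<in> carrier_mat d d" "r \<in> carrier_mat 1 d" "c x \<in> carrier_mat d 1"
    "sc \<in> carrier_mat 1 1" for x
    by (auto simp: D_def F_def r_def c_def sc_def)
  have carr2: "M \<in> carrier_mat (1 + d) (1 + d)" "P \<in> carrier_mat (1 + d) (1 + d)" "Q \<in> carrier_mat (1 + d) (1 + d)"
    unfolding M_def P_def Q_def by (rule four_block_carrier_mat; simp)+
  have PM: "P * M = four_block_mat (1\<^sub>m 1) r (0\<^sub>m d 1) F"
  proof -
    have "c (\<lambda>_. - 1) * 1\<^sub>m 1 + 1\<^sub>m d * c (\<lambda>_. 1) = 0\<^sub>m d 1"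
      by (rule eq_matI) (auto simp: c_def)
    moreover have "c (\<lambda>_. - 1) * r + 1\<^sub>m d * D = F"
      by (rule eq_matI) (auto simp: c_def r_def D_def F_def scalar_prod_def)
    moreover have "0\<^sub>m 1 d * c (\<lambda>_. 1) = 0\<^sub>m 1 1" "0\<^sub>m 1 d * D = 0\<^sub>m 1 d"
      by (rule left_mult_zero_mat; simp del: One_nat_def)+
    moreover have "1\<^sub>m 1 * r + 0\<^sub>m 1 d = r"
      by (simp add: left_mult_one_mat[OF carr(3)] right_add_zero_mat[OF carr(3)] del: One_nat_def)
    ultimately show ?thesis
      unfolding P_def M_def
      by (subst mult_four_block_mat[of _ 1 1 _ d _ d _ _ 1 _ d]) (simp_all del: One_nat_def)
  qed
  have MQ: "M * Q = four_block_mat sc r (0\<^sub>m d 1) D"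
  proof -
    have "1\<^sub>m 1 * 1\<^sub>m 1 + r * c (\<lambda>i. - 1 / a i) = sc"
      by (rule eq_matI) (auto simp: c_def r_def sc_def scalar_prod_def sum_distrib_left sum_negf atLeast0LessThan)
    moreover have "c (\<lambda>_. 1) * 1\<^sub>m 1 + D * c (\<lambda>i. - 1 / a i) = 0\<^sub>m d 1"
    proof (rule eq_matI)
      fix i j assume "i < dim_row (0\<^sub>m d 1 :: real Matrix.mat)" "j < dim_col (0\<^sub>m d 1 :: real Matrix.mat)"
      then have i: "i < d" "j = 0" by auto
      have "(\<Sum>k<d. (if i = k then a i else 0) * (- 1 / a k)) = (\<Sum>k<d. if i = k then - 1 else 0)"
        using a by (intro sum.cong) auto
      then show "(c (\<lambda>_. 1) * 1\<^sub>m 1 + D * c (\<lambda>i. - 1 / a i)) $$ (i, j) = 0\<^sub>m d 1 $$ (i, j)"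
        using i by (simp add: c_def D_def scalar_prod_def atLeast0LessThan)
    qed (auto simp: c_def D_def)
    moreover have "1\<^sub>m 1 * 0\<^sub>m 1 d + r * 1\<^sub>m d = r" "c (\<lambda>_. 1) * 0\<^sub>m 1 d + D * 1\<^sub>m d = D"
      by (simp_all add: right_mult_zero_mat[OF carr(4)] right_mult_one_mat[OF carr(3)] right_mult_one_mat[OF carr(1)]
          left_add_zero_mat[OF carr(1)] left_add_zero_mat[OF carr(3)] del: One_nat_def)
    ultimately show ?thesis
      unfolding Q_def M_def by (subst mult_four_block_mat[of _ 1 1 _ d _ d _ _ 1 _ d]) (simp_all del: One_nat_def)
  qed
  have "Determinant.det P = 1" "Determinant.det Q = 1"
    unfolding P_def Q_def by (subst det_four_block_mat_upper_right_zero[of _ 1 _ d]; simp del: One_nat_def)+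
  moreover have "Determinant.det (P * M) = Determinant.det F"
    unfolding PM by (subst det_four_block_mat_lower_left_zero[of _ 1 _ d]) (auto simp del: One_nat_def)
  moreover have "Determinant.det (M * Q) = Determinant.det sc * Determinant.det D"
    unfolding MQ by (subst det_four_block_mat_lower_left_zero[of _ 1 _ d]) (auto simp del: One_nat_def)
  moreover have "Determinant.det sc = 1 + b * (\<Sum>i<d. 1 / a i)"
    by (subst det_single) (auto simp: sc_def)
  moreover have "Determinant.det D = (\<Prod>i<d. a i)"
  proof -
    have "diag_mat D = map a [0..<d]" by (auto simp: diag_mat_def D_def)
    then show ?thesis
      by (subst det_upper_triangular[of _ d]) (auto simp: D_def upper_triangular_def prod.list_conv_set_nth
          atLeast0LessThan simp flip: prod.distinct_set_conv_list)
  qed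
  ultimately have "Determinant.det F = (\<Prod>i<d. a i) * (1 + b * (\<Sum>i<d. 1 / a i))"
    using det_mult[OF carr2(2,1)] det_mult[OF carr2(1,3)] by simp
  then show ?thesis by (simp add: F_def)
qed

text \<open>\<open>minv\<close> strips an option; a nonzero determinant makes the matrix a unit and
  thus excludes \<open>None\<close>.\<close>

lemma minv_inverse:
  assumes A: "A \<in> carrier_mat n n" and det: "Determinant.det A \<noteq> 0"
  shows "minv A \<in> carrier_mat n n" "A * minv A = 1\<^sub>m n" "minv A * A = 1\<^sub>m n"
proof -
  have "A \<in> Units (ring_mat TYPE(real) n ())" by (rule det_non_zero_imp_unit[OF A det])
  then obtain B where "mat_inverse A = Some B"
    using mat_inverse(1)[OF A, where b = "()"] by (cases "mat_inverse A") auto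
  then show "minv A \<in> carrier_mat n n" "A * minv A = 1\<^sub>m n" "minv A * A = 1\<^sub>m n"
    using mat_inverse(2)[OF A] by (auto simp: minv_def)
qed

lemma inverse_mat_unique:
  fixes A :: "real Matrix.mat"
  assumes "A \<in> carrier_mat n n" "B \<in> carrier_mat n n" "C \<in> carrier_mat n n"
    and "B * A = 1\<^sub>m n" "A * C = 1\<^sub>m n"
  shows "B = C"
proof -
  have "B * (A * C) = B * A * C" using assms(1-3) by (simp add: assoc_mult_mat[of _ n n _ n _ n])
  then show ?thesis using assms by simp
qed

lemma det_minv:
  assumes A: "A \<in> carrier_mat n n" and det: "Determinant.det A \<noteq> 0"
  shows "Determinant.det (minv A) = 1 / Determinant.det A"
proof -
  note M = minv_inverse[OF A det]
  have "Determinant.det A * Determinant.det (minv A) = 1" using det_mult[OF A M(1)] M(2) by simp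
  then show ?thesis using det by (simp add: field_simps)
qed

lemma minv_minv:
  assumes A: "A \<in> carrier_mat n n" and det: "Determinant.det A \<noteq> 0"
  shows "minv (minv A) = A"
proof -
  note M = minv_inverse[OF A det]
  have "Determinant.det (minv A) \<noteq> 0" using det by (simp add: det_minv[OF A det])
  note MM = minv_inverse[OF M(1) this]
  show ?thesis by (rule inverse_mat_unique[OF M(1) MM(1) A MM(3) M(3)])
qed

text \<open>With \<open>u\<^sub>0 = - (u\<^sub>1 + \<dots> + u\<^sub>d)\<close> this is a chi-square distance.\<close>
definition fisher_sq :: "nat \<Rightarrow> (nat \<Rightarrow> real) \<Rightarrow> (nat \<Rightarrow> real) \<Rightarrow> real" where
  "fisher_sq d \<theta> u = (\<Sum>j = 1..d. (u j)\<^sup>2 / full d \<theta> j) + (\<Sum>j = 1..d. u j)\<^sup>2 / full d \<theta> 0"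

lemma fisher_carrier [simp]: "fisher d \<theta> \<in> carrier_mat d d"
  by (simp add: fisher_def)

lemma coord_vec_carrier [simp]: "coord_vec d u \<in> carrier_vec d"
  by (simp add: coord_vec_def)

lemma scalar_prod_coord_vec: "scalar_prod (coord_vec d u) (coord_vec d v) = (\<Sum>j = 1..d. u j * v j)"
  unfolding coord_vec_def scalar_prod_def
  by (auto intro!: sum.reindex_bij_witness[of _ "\<lambda>j. j - 1" Suc])

lemma fisher_quadratic_form:
  "scalar_prod (coord_vec d u) (fisher d \<theta> *\<^sub>v coord_vec d u) = fisher_sq d \<theta> u"
proof -
  have "fisher d \<theta> *\<^sub>v coord_vec d u = coord_vec d (\<lambda>j. u j / full d \<theta> j + (\<Sum>j = 1..d. u j) / full d \<theta> 0)"
  proof (rule eq_vecI)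
    fix i assume "i < dim_vec (coord_vec d (\<lambda>j. u j / full d \<theta> j + (\<Sum>j = 1..d. u j) / full d \<theta> 0))"
    then have i: "i < d" by (simp add: coord_vec_def)
    have s: "(\<Sum>k<d. u (Suc k)) = (\<Sum>j = 1..d. u j)"
      by (intro sum.reindex_bij_witness[of _ "\<lambda>j. j - 1" Suc]) auto
    have "(fisher d \<theta> *\<^sub>v coord_vec d u) $ i
       = (\<Sum>k<d. ((if i = k then 1 / full d \<theta> (Suc i) else 0) + 1 / full d \<theta> 0) * u (Suc k))"
      using i by (simp add: fisher_def coord_vec_def scalar_prod_def atLeast0LessThan)
    also have "\<dots> = (\<Sum>k<d. (if i = k then u (Suc i) / full d \<theta> (Suc i) else 0) + u (Suc k) / full d \<theta> 0)"
      by (intro sum.cong) (auto simp: algebra_simps)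
    also have "\<dots> = u (Suc i) / full d \<theta> (Suc i) + (\<Sum>k<d. u (Suc k)) / full d \<theta> 0"
      using i by (simp add: sum.distrib sum_divide_distrib)
    finally show "(fisher d \<theta> *\<^sub>v coord_vec d u) $ i
      = coord_vec d (\<lambda>j. u j / full d \<theta> j + (\<Sum>j = 1..d. u j) / full d \<theta> 0) $ i"
      using i s by (simp add: coord_vec_def)
  qed (auto simp: coord_vec_def fisher_def)
  then show ?thesis
    by (simp add: scalar_prod_coord_vec fisher_sq_def algebra_simps sum.distrib power2_eq_square
        sum_distrib_right flip: sum_divide_distrib)
qed

lemma fisher_symmetric: "transpose_mat (fisher d \<theta>) = fisher d \<theta>"
  by (rule eq_matI) (auto simp: fisher_def)

lemma coord_vec_surj:
  assumes "v \<in> carrier_vec d"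
  obtains u where "v = coord_vec d u"
proof
  show "v = coord_vec d (\<lambda>j. v $ (j - 1))" using assms by (intro eq_vecI) (auto simp: coord_vec_def)
qed

lemma fisher_sq_nonneg: "\<theta> \<in> Theta d \<Longrightarrow> 0 \<le> fisher_sq d \<theta> u"
  unfolding fisher_sq_def using full_pos by (intro add_nonneg_nonneg sum_nonneg divide_nonneg_pos) auto

lemma fisher_msqrt:
  assumes "\<theta> \<in> Theta d"
  shows "is_psd_sqrt (fisher d \<theta>) (msqrt (fisher d \<theta>))"
  unfolding msqrt_def
proof (rule someI_ex, rule is_psd_sqrt_exists[OF fisher_carrier fisher_symmetric])
  fix v :: "real Matrix.vec" assume "v \<in> carrier_vec d"
  then obtain u where "v = coord_vec d u" by (rule coord_vec_surj)
  then show "0 \<le> scalar_prod v (fisher d \<theta> *\<^sub>v v)"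
    using fisher_sq_nonneg[OF assms] by (simp add: fisher_quadratic_form)
qed

lemma wnorm_fisher:
  assumes "\<theta> \<in> Theta d"
  shows "wnorm (fisher d \<theta>) d u = sqrt (fisher_sq d \<theta> u)"
proof -
  define R where "R = msqrt (fisher d \<theta>)"
  have R: "R \<in> carrier_mat d d" "transpose_mat R = R" "R * R = fisher d \<theta>"
    using fisher_msqrt[OF assms] by (auto simp: is_psd_sqrt_def R_def fisher_def)
  have "scalar_prod (R *\<^sub>v coord_vec d u) (R *\<^sub>v coord_vec d u) = scalar_prod (coord_vec d u) (R *\<^sub>v (R *\<^sub>v coord_vec d u))"
    using R by (intro symmetric_scalar_prod[symmetric, of _ d]) auto
  also have "\<dots> = fisher_sq d \<theta> u"
    using R by (simp add: fisher_quadratic_form flip: assoc_mult_mat_vec[of _ d d _ d])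
  finally show ?thesis by (simp add: wnorm_def vnorm_def R_def)
qed

text \<open>The rank-one part contributes \<open>1 + (1 - full d \<theta> 0) / full d \<theta> 0 = 1
  / full d \<theta> 0\<close>, so that state 0 enters like all the others.\<close>

lemma det_fisher:
  assumes "\<theta> \<in> Theta d"
  shows "Determinant.det (fisher d \<theta>) = (\<Prod>j\<le>d. 1 / full d \<theta> j)"
proof -
  have pos: "full d \<theta> j > 0" if "j \<le> d" for j using full_pos[OF assms that] .
  have "Determinant.det (fisher d \<theta>)
      = (\<Prod>i<d. 1 / full d \<theta> (Suc i)) * (1 + 1 / full d \<theta> 0 * (\<Sum>i<d. 1 / (1 / full d \<theta> (Suc i))))"
    unfolding fisher_def using pos by (intro det_diag_plus_const) (auto simp: less_imp_neq[symmetric] Suc_le_eq)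
  also have "(\<Sum>i<d. 1 / (1 / full d \<theta> (Suc i))) = 1 - full d \<theta> 0"
    using sum_full[of d \<theta>] by (simp add: atLeast0AtMost sum.atMost_shift)
  also have "1 + 1 / full d \<theta> 0 * (1 - full d \<theta> 0) = 1 / full d \<theta> 0"
    using pos[of 0] by (simp add: field_simps)
  finally show ?thesis by (simp add: prod.atMost_shift mult.commute)
qed

lemma vec_cauchy_schwarz:
  fixes v w :: "real Matrix.vec"
  assumes "dim_vec v = dim_vec w"
  shows "\<bar>scalar_prod v w\<bar> \<le> vnorm v * vnorm w"
proof -
  have "\<bar>scalar_prod v w\<bar> = sqrt ((\<Sum>i<dim_vec w. v $ i * w $ i)\<^sup>2)"
    by (simp add: scalar_prod_def atLeast0LessThan)
  also have "\<dots> \<le> sqrt ((\<Sum>i<dim_vec w. (v $ i)\<^sup>2) * (\<Sum>i<dim_vec w. (w $ i)\<^sup>2))"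
    by (intro real_sqrt_le_mono Cauchy_Schwarz_ineq_sum)
  finally show ?thesis
    using assms by (simp add: vnorm_def scalar_prod_def atLeast0LessThan power2_eq_square real_sqrt_mult)
qed

text \<open>Insert \<open>minv R * R\<close> between \<open>S\<close> and \<open>u\<close>, move the
  symmetric matrix \<open>minv R\<close> to \<open>S\<close>, and apply Cauchy-Schwarz.\<close>

lemma wnorm_duality:
  assumes "\<theta> \<in> Theta d"
  shows "\<bar>\<Sum>j = 1..d. S j * u j\<bar> \<le> wnorm_dual (fisher d \<theta>) d S * wnorm (fisher d \<theta>) d u"
proof -
  define R where "R = msqrt (fisher d \<theta>)"
  have R: "R \<in> carrier_mat d d" "transpose_mat R = R" "R * R = fisher d \<theta>"
    using fisher_msqrt[OF assms] by (auto simp: is_psd_sqrt_def R_def fisher_def)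
  have "Determinant.det (fisher d \<theta>) > 0"
    unfolding det_fisher[OF assms] using full_pos[OF assms] by (intro prod_pos) auto
  then have "Determinant.det R \<noteq> 0" using det_mult[OF R(1,1)] R(3) by auto
  note M = minv_inverse[OF R(1) this]
  have symM: "transpose_mat (minv R) = minv R"
  proof (rule inverse_mat_unique[OF R(1) _ M(1) _ M(2)])
    have "transpose_mat (minv R) * transpose_mat R = transpose_mat (R * minv R)"
      by (rule transpose_mult[OF R(1) M(1), symmetric])
    then show "transpose_mat (minv R) * R = 1\<^sub>m d" unfolding R(2) M(2) by simp
  qed (use M in auto)
  have "(\<Sum>j = 1..d. S j * u j) = scalar_prod (coord_vec d S) ((minv R * R) *\<^sub>v coord_vec d u)"
    using M by (simp add: scalar_prod_coord_vec)
  also have "\<dots> = scalar_prod (coord_vec d S) (minv R *\<^sub>v (R *\<^sub>v coord_vec d u))"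
    unfolding assoc_mult_mat_vec[OF M(1) R(1) coord_vec_carrier] ..
  also have "\<dots> = scalar_prod (minv R *\<^sub>v coord_vec d S) (R *\<^sub>v coord_vec d u)"
    using M R symM by (intro symmetric_scalar_prod[of _ d]) auto
  also have "\<bar>\<dots>\<bar> \<le> vnorm (minv R *\<^sub>v coord_vec d S) * vnorm (R *\<^sub>v coord_vec d u)"
    using M R by (intro vec_cauchy_schwarz) auto
  finally show ?thesis by (simp add: wnorm_dual_def wnorm_def R_def)
qed

section \<open>The Gaussian density\<close>

text \<open>Each integration is a convolution of two centred normal densities, so the variances add.
  The last factor is the contribution of state 0 to the Fisher form; fixing a coordinate shifts its
  argument, hence the offset \<open>c\<close>.\<close>

lemma nn_integral_normal_density_sum:
  fixes \<mu> \<tau> :: "'i \<Rightarrow> real" and \<tau>0 c :: real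
  assumes "finite I" and "\<tau>0 > 0" and "\<And>i. i \<in> I \<Longrightarrow> \<tau> i > 0"
  shows "(\<integral>\<^sup>+x. ennreal ((\<Prod>i\<in>I. normal_density 0 (sqrt (\<tau> i)) (x i - \<mu> i))
      * normal_density 0 (sqrt \<tau>0) (c + (\<Sum>i\<in>I. x i - \<mu> i))) \<partial>PiM I (\<lambda>_. lborel))
    = ennreal (normal_density 0 (sqrt (\<tau>0 + (\<Sum>i\<in>I. \<tau> i))) c)"
  using assms
proof (induction I arbitrary: c rule: finite_induct)
  case empty
  then show ?case by (simp add: PiM_empty nn_integral_count_space_finite)
next
  case (insert i I)
  interpret product_sigma_finite "\<lambda>_. lborel :: real measure" ..
  define g where "g J c x = ennreal ((\<Prod>i\<in>J. normal_density 0 (sqrt (\<tau> i)) (x i - \<mu> i))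
      * normal_density 0 (sqrt \<tau>0) (c + (\<Sum>i\<in>J. x i - \<mu> i)))" for J c and x :: "'i \<Rightarrow> real"
  define S where "S = \<tau>0 + (\<Sum>i\<in>I. \<tau> i)"
  have S: "S > 0" unfolding S_def using insert.prems by (intro add_pos_nonneg sum_nonneg) (auto simp: less_imp_le)
  have \<tau>: "\<tau> i > 0" using insert.prems by simp
  have meas: "g J c \<in> borel_measurable (PiM J (\<lambda>_. lborel))" if "finite J" for J c
    unfolding g_def using that by measurable
  have IH: "(\<integral>\<^sup>+x. g I c x \<partial>PiM I (\<lambda>_. lborel)) = ennreal (normal_density 0 (sqrt S) c)" for c
    using insert.IH[of c] insert.prems by (simp add: g_def S_def)
  have upd: "g (insert i I) c (x(i := y)) = ennreal (normal_density 0 (sqrt (\<tau> i)) (y - \<mu> i)) * g I (c + (y - \<mu> i)) x"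
    for x y
  proof -
    have "(\<Sum>j\<in>I. (x(i := y)) j - \<mu> j) = (\<Sum>j\<in>I. x j - \<mu> j)"
      "(\<Prod>j\<in>I. normal_density 0 (sqrt (\<tau> j)) ((x(i := y)) j - \<mu> j)) = (\<Prod>j\<in>I. normal_density 0 (sqrt (\<tau> j)) (x j - \<mu> j))"
      using insert.hyps by (auto intro!: sum.cong prod.cong)
    then show ?thesis
      using insert.hyps unfolding g_def by (simp add: ennreal_mult'[symmetric] algebra_simps)
  qed
  have "(\<integral>\<^sup>+x. g (insert i I) c x \<partial>PiM (insert i I) (\<lambda>_. lborel))
      = (\<integral>\<^sup>+y. (\<integral>\<^sup>+x. g (insert i I) c (x(i := y)) \<partial>PiM I (\<lambda>_. lborel)) \<partial>lborel)"
    using insert.hyps by (intro product_nn_integral_insert_rev meas) auto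
  also have "\<dots> = (\<integral>\<^sup>+y. ennreal (normal_density 0 (sqrt S) (c + (y - \<mu> i)) * normal_density 0 (sqrt (\<tau> i)) (y - \<mu> i)) \<partial>lborel)"
    unfolding upd
    by (subst nn_integral_cmult, rule meas[OF insert.hyps(1)], unfold IH)
       (simp add: ennreal_mult'[symmetric] mult.commute)
  also have "\<dots> = (\<integral>\<^sup>+y. ennreal (normal_density 0 (sqrt S) (c + y) * normal_density 0 (sqrt (\<tau> i)) y) \<partial>lborel)"
    by (subst nn_integral_real_affine[where c = 1 and t = "\<mu> i"]) (auto simp: normal_density_def)
  also have "\<dots> = (\<integral>\<^sup>+y. ennreal (normal_density 0 (sqrt S) ((- c) - y) * normal_density 0 (sqrt (\<tau> i)) y) \<partial>lborel)"
    by (intro nn_integral_cong) (simp add: normal_density_def power2_eq_square algebra_simps)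
  also have "\<dots> = ennreal (normal_density 0 (sqrt ((sqrt S)\<^sup>2 + (sqrt (\<tau> i))\<^sup>2)) (- c))"
    using conv_normal_density_zero_mean[of "sqrt S" "sqrt (\<tau> i)"] S \<tau> by (metis real_sqrt_gt_0_iff)
  also have "normal_density 0 (sqrt ((sqrt S)\<^sup>2 + (sqrt (\<tau> i))\<^sup>2)) (- c) = normal_density 0 (sqrt (\<tau>0 + (\<Sum>i\<in>insert i I. \<tau> i))) c"
    using S \<tau> insert.hyps by (simp add: normal_density_def S_def add_ac)
  finally show ?case unfolding g_def .
qed

text \<open>The determinant of the covariance \<open>minv (n F)\<close> is already evaluated here,
  as a product over the states.\<close>

definition gauss_density :: "nat \<Rightarrow> nat \<Rightarrow> (nat \<Rightarrow> real) \<Rightarrow> (nat \<Rightarrow> real) \<Rightarrow> (nat \<Rightarrow> real) \<Rightarrow> real" where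
  "gauss_density n d \<theta> \<mu> x =
     exp (- real n * fisher_sq d \<theta> (\<lambda>j. x j - \<mu> j) / 2) / sqrt ((2 * pi) ^ d * ((\<Prod>j\<le>d. full d \<theta> j) / real n ^ d))"

lemma fisher_sq_measurable [measurable]:
  "(\<lambda>x. fisher_sq d \<theta> (\<lambda>j. x j - \<mu> j)) \<in> borel_measurable (lborel_d d)"
  unfolding fisher_sq_def by measurable

lemma gauss_density_measurable [measurable]: "gauss_density n d \<theta> \<mu> \<in> borel_measurable (lborel_d d)"
  unfolding gauss_density_def by measurable

lemma gauss_density_pos:
  assumes "\<theta> \<in> Theta d" "n \<ge> 1"
  shows "gauss_density n d \<theta> \<mu> x > 0"
  unfolding gauss_density_def using full_pos[OF assms(1)] assms(2)
  by (intro divide_pos_pos) (auto intro!: mult_pos_pos divide_pos_pos prod_pos)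

text \<open>The density is \<open>K\<close> times a product of \<open>d + 1\<close> normal densities
  of variances \<open>full d \<theta> j / n\<close>, the one for state 0 taken at the sum of the
  coordinates. The variances add up to \<open>1 / n\<close>, and the normal density of that variance
  at 0 is \<open>1 / K\<close>.\<close>

lemma gauss_density_integral:
  assumes \<theta>: "\<theta> \<in> Theta d" and n: "n \<ge> 1"
  shows "has_bochner_integral (lborel_d d) (gauss_density n d \<theta> \<mu>) 1"
proof (rule has_bochner_integral_nn_integral)
  define t where "t j = full d \<theta> j / real n" for j
  have t: "t j > 0" if "j \<le> d" for j using full_pos[OF \<theta> that] n by (simp add: t_def)
  define K where "K = sqrt (2 * pi / real n)"
  have K: "K > 0" using n by (simp add: K_def)
  have nd: "normal_density 0 (sqrt a) v = exp (- v\<^sup>2 / (2 * a)) / sqrt (2 * pi * a)" if "a > 0" for a v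
    using that by (simp add: normal_density_def)
  have dens: "gauss_density n d \<theta> \<mu> x = K * ((\<Prod>i\<in>{1..d}. normal_density 0 (sqrt (t i)) (x i - \<mu> i))
      * normal_density 0 (sqrt (t 0)) (0 + (\<Sum>i\<in>{1..d}. x i - \<mu> i)))" for x
  proof -
    define v where "v i = x i - \<mu> i" for i
    define P where "P = (\<Prod>j\<le>d. sqrt (2 * pi * t j))"
    have split: "P = (\<Prod>i\<in>{1..d}. sqrt (2 * pi * t i)) * sqrt (2 * pi * t 0)"
      unfolding P_def by (simp add: atMost_atLeast0 prod.atLeast_Suc_atMost mult.commute)
    have "(\<Prod>i\<in>{1..d}. normal_density 0 (sqrt (t i)) (v i)) = (\<Prod>i\<in>{1..d}. exp (- (v i)\<^sup>2 / (2 * t i)) / sqrt (2 * pi * t i))"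
      using t by (intro prod.cong) (auto simp: nd)
    also have "\<dots> = exp (\<Sum>i\<in>{1..d}. - (v i)\<^sup>2 / (2 * t i)) / (\<Prod>i\<in>{1..d}. sqrt (2 * pi * t i))"
      by (simp add: prod_dividef exp_sum)
    finally have "(\<Prod>i\<in>{1..d}. normal_density 0 (sqrt (t i)) (v i)) * normal_density 0 (sqrt (t 0)) (\<Sum>i\<in>{1..d}. v i)
      = exp ((\<Sum>i\<in>{1..d}. - (v i)\<^sup>2 / (2 * t i)) + - (\<Sum>i\<in>{1..d}. v i)\<^sup>2 / (2 * t 0)) / P"
      using t[of 0] by (simp add: nd split mult_exp_exp)
    also have "(\<Sum>i\<in>{1..d}. - (v i)\<^sup>2 / (2 * t i)) + - (\<Sum>i\<in>{1..d}. v i)\<^sup>2 / (2 * t 0) = - real n * fisher_sq d \<theta> v / 2"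
    proof -
      have "(\<Sum>i\<in>{1..d}. - (v i)\<^sup>2 / (2 * t i)) = (\<Sum>i\<in>{1..d}. (- real n / 2) * ((v i)\<^sup>2 / full d \<theta> i))"
        by (intro sum.cong) (auto simp: t_def)
      then show ?thesis
        by (simp only: sum_distrib_left[symmetric] fisher_sq_def) (simp add: t_def algebra_simps)
    qed
    also have "P = K * sqrt ((2 * pi) ^ d * ((\<Prod>j\<le>d. full d \<theta> j) / real n ^ d))"
    proof -
      have "P = sqrt (\<Prod>j\<le>d. 2 * pi * t j)"
        unfolding P_def by (induction d) (simp_all add: real_sqrt_mult)
      also have "(\<Prod>j\<le>d. 2 * pi * t j) = (2 * pi) ^ Suc d * ((\<Prod>j\<le>d. full d \<theta> j) / real n ^ Suc d)"
        unfolding t_def prod.distrib prod_dividef by simp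
      also have "\<dots> = (2 * pi / real n) * ((2 * pi) ^ d * ((\<Prod>j\<le>d. full d \<theta> j) / real n ^ d))"
        by simp
      finally show ?thesis by (simp only: K_def real_sqrt_mult)
    qed
    finally show ?thesis using K by (simp add: gauss_density_def v_def)
  qed
  have "(\<integral>\<^sup>+x. ennreal (gauss_density n d \<theta> \<mu> x) \<partial>lborel_d d)
    = (\<integral>\<^sup>+x. ennreal K * ennreal ((\<Prod>i\<in>{1..d}. normal_density 0 (sqrt (t i)) (x i - \<mu> i))
      * normal_density 0 (sqrt (t 0)) (0 + (\<Sum>i\<in>{1..d}. x i - \<mu> i))) \<partial>lborel_d d)"
    unfolding dens using K by (intro nn_integral_cong ennreal_mult') auto
  also have "\<dots> = ennreal K * (\<integral>\<^sup>+x. ennreal ((\<Prod>i\<in>{1..d}. normal_density 0 (sqrt (t i)) (x i - \<mu> i))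
      * normal_density 0 (sqrt (t 0)) (0 + (\<Sum>i\<in>{1..d}. x i - \<mu> i))) \<partial>lborel_d d)"
    by (intro nn_integral_cmult) measurable
  also have "\<dots> = ennreal K * ennreal (normal_density 0 (sqrt (t 0 + (\<Sum>i\<in>{1..d}. t i))) 0)"
    using t by (subst nn_integral_normal_density_sum) auto
  also have "t 0 + (\<Sum>i\<in>{1..d}. t i) = 1 / real n"
  proof -
    have "t 0 + (\<Sum>i\<in>{1..d}. t i) = (\<Sum>j = 0..d. full d \<theta> j) / real n"
      by (simp add: t_def sum_divide_distrib add_divide_distrib sum.atLeast_Suc_atMost)
    then show ?thesis by (simp add: sum_full)
  qed
  also have "ennreal K * ennreal (normal_density 0 (sqrt (1 / real n)) 0) = ennreal 1"
    using K n by (simp add: nd ennreal_mult'[symmetric] K_def)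
  finally show "(\<integral>\<^sup>+x. ennreal (gauss_density n d \<theta> \<mu> x) \<partial>lborel_d d) = ennreal 1" .
  show "gauss_density n d \<theta> \<mu> \<in> borel_measurable (lborel_d d)" by (rule gauss_density_measurable)
qed (use gauss_density_pos[OF assms] in \<open>auto simp: less_imp_le\<close>)

lemma gaussian_fisher:
  assumes \<theta>: "\<theta> \<in> Theta d" and n: "n \<ge> 1"
  shows "gaussian d \<mu> (minv (real n \<cdot>\<^sub>m fisher d \<theta>)) = density (lborel_d d) (\<lambda>x. ennreal (gauss_density n d \<theta> \<mu> x))"
proof -
  define A where "A = real n \<cdot>\<^sub>m fisher d \<theta>"
  have A: "A \<in> carrier_mat d d" by (simp add: A_def)
  have det: "Determinant.det A = real n ^ d * (\<Prod>j\<le>d. 1 / full d \<theta> j)"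
    by (simp add: A_def det_fisher[OF \<theta>] carrier_matD(2)[OF fisher_carrier])
  have "Determinant.det A > 0"
    unfolding det using n full_pos[OF \<theta>] by (intro mult_pos_pos prod_pos) auto
  then have nz: "Determinant.det A \<noteq> 0" by simp
  have "Determinant.det (minv A) = (\<Prod>j\<le>d. full d \<theta> j) / real n ^ d"
    unfolding det_minv[OF A nz] det by (simp add: prod_dividef)
  moreover have "scalar_prod (coord_vec d u) (A *\<^sub>v coord_vec d u) = real n * fisher_sq d \<theta> u" for u
  proof -
    have "A *\<^sub>v coord_vec d u = real n \<cdot>\<^sub>v (fisher d \<theta> *\<^sub>v coord_vec d u)"
      unfolding A_def by (rule eq_vecI) (auto simp: fisher_def coord_vec_def)
    then show ?thesis
      by (simp add: scalar_prod_smult_distrib[of _ d] fisher_quadratic_form mult_mat_vec_carrier[of _ d d])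
  qed
  ultimately show ?thesis
    unfolding gaussian_def gauss_density_def Let_def A_def[symmetric] minv_minv[OF A nz]
    by simp
qed

section \<open>Dirichlet integrals\<close>

text \<open>Integration by parts lowers \<open>m\<close> and raises \<open>a\<close>, which is why
  the induction leaves \<open>a\<close> arbitrary.\<close>

lemma has_integral_beta_nat:
  fixes c :: real
  assumes "c \<ge> 0"
  shows "((\<lambda>y. y ^ a * (c - y) ^ m) has_integral (c ^ (a + m + 1) * fact a * fact m / fact (a + m + 1))) {0..c}"
proof (induction m arbitrary: a)
  case 0
  have "((\<lambda>y. y ^ a) has_integral (c ^ Suc a / real (Suc a) - 0 ^ Suc a / real (Suc a))) {0..c}"
    using assms
    by (intro fundamental_theorem_of_calculus)
       (auto intro!: derivative_eq_intros simp del: of_nat_Suc power_Suc simp flip: has_real_derivative_iff_has_vector_derivative)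
  then show ?case by (simp add: fact_Suc field_simps del: of_nat_Suc)
next
  case (Suc m)
  define F where "F y = y ^ Suc a * (c - y) ^ Suc m / real (Suc a)" for y
  define F' where "F' y = y ^ a * (c - y) ^ Suc m - real (Suc m) / real (Suc a) * (y ^ Suc a * (c - y) ^ m)" for y
  have "(F has_real_derivative F' y) (at y within {0..c})" for y
    unfolding F_def F'_def
    by (auto intro!: derivative_eq_intros simp del: of_nat_Suc power_Suc)
       (simp add: field_simps)
  then have "(F' has_integral (F c - F 0)) {0..c}"
    using assms
    by (intro fundamental_theorem_of_calculus) (auto simp flip: has_real_derivative_iff_has_vector_derivative)
  moreover have "((\<lambda>y. real (Suc m) / real (Suc a) * (y ^ Suc a * (c - y) ^ m)) has_integral
      real (Suc m) / real (Suc a) * (c ^ (Suc a + m + 1) * fact (Suc a) * fact m / fact (Suc a + m + 1))) {0..c}"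
    by (intro has_integral_mult_right Suc.IH)
  ultimately have "((\<lambda>y. F' y + real (Suc m) / real (Suc a) * (y ^ Suc a * (c - y) ^ m)) has_integral
     (F c - F 0) + real (Suc m) / real (Suc a) * (c ^ (Suc a + m + 1) * fact (Suc a) * fact m / fact (Suc a + m + 1))) {0..c}"
    by (rule has_integral_add)
  moreover have "(F c - F 0) + real (Suc m) / real (Suc a) * (c ^ (Suc a + m + 1) * fact (Suc a) * fact m / fact (Suc a + m + 1))
     = c ^ (a + Suc m + 1) * fact a * fact (Suc m) / fact (a + Suc m + 1)"
  proof -
    have "fact (Suc a) = real (Suc a) * fact a" "fact (Suc m) = real (Suc m) * fact m" by simp_all
    then show ?thesis by (simp add: F_def del: of_nat_Suc fact_Suc)
  qed
  ultimately show ?case by (simp add: F'_def)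
qed

lemma nn_integral_beta_nat:
  fixes c :: real
  assumes "c \<ge> 0"
  shows "(\<integral>\<^sup>+y. ennreal (if 0 < y \<and> y < c then y ^ a * (c - y) ^ m else 0) \<partial>lborel)
     = ennreal (c ^ (a + m + 1) * fact a * fact m / fact (a + m + 1))"
proof -
  have "(\<integral>\<^sup>+y. ennreal (if 0 < y \<and> y < c then y ^ a * (c - y) ^ m else 0) \<partial>lborel)
    = (\<integral>\<^sup>+y. ennreal (y ^ a * (c - y) ^ m) * indicator {0..c} y \<partial>lborel)"
  proof (rule nn_integral_cong_AE)
    show "AE y in lborel. ennreal (if 0 < y \<and> y < c then y ^ a * (c - y) ^ m else 0)
        = ennreal (y ^ a * (c - y) ^ m) * indicator {0..c} y"
      using AE_lborel_singleton[of 0] AE_lborel_singleton[of c]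
      by eventually_elim (auto simp: indicator_def)
  qed
  also have "\<dots> = ennreal (c ^ (a + m + 1) * fact a * fact m / fact (a + m + 1))"
    by (intro nn_integral_has_integral_lebesgue' has_integral_beta_nat assms) auto
  finally show ?thesis .
qed

text \<open>Fixing one coordinate at \<open>y\<close> leaves the simplex of size
  \<open>c - y\<close>, so the size has to be arbitrary in the induction. The inner integral is a
  multiple of a power of \<open>c - y\<close>, and the outer one a beta integral.\<close>

lemma nn_integral_simplex_monomial:
  fixes a :: "'i \<Rightarrow> nat" and c :: real
  assumes "finite I"
  shows "(\<integral>\<^sup>+x. ennreal (if (\<forall>i\<in>I. 0 < x i) \<and> (\<Sum>i\<in>I. x i) < c
              then (\<Prod>i\<in>I. x i ^ a i) * (c - (\<Sum>i\<in>I. x i)) ^ k else 0) \<partial>PiM I (\<lambda>_. lborel))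
    = ennreal (if 0 < c then c ^ ((\<Sum>i\<in>I. a i) + k + card I) * (\<Prod>i\<in>I. fact (a i)) * fact k
          / fact ((\<Sum>i\<in>I. a i) + k + card I) else 0)"
  using assms
proof (induction I arbitrary: c rule: finite_induct)
  case empty
  then show ?case by (simp add: PiM_empty nn_integral_count_space_finite)
next
  case (insert i I)
  interpret product_sigma_finite "\<lambda>_. lborel :: real measure" ..
  define g where "g J c x = ennreal (if (\<forall>i\<in>J. 0 < x i) \<and> (\<Sum>i\<in>J. x i) < c
              then (\<Prod>i\<in>J. x i ^ a i) * (c - (\<Sum>i\<in>J. x i)) ^ k else 0)" for J c and x :: "'i \<Rightarrow> real"
  define m where "m = (\<Sum>i\<in>I. a i) + k + card I"
  define K :: real where "K = (\<Prod>i\<in>I. fact (a i)) * fact k / fact m"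
  have K: "K \<ge> 0" unfolding K_def by (intro mult_nonneg_nonneg divide_nonneg_nonneg prod_nonneg) auto
  have meas: "g J c \<in> borel_measurable (PiM J (\<lambda>_. lborel))" if "finite J" for J c
    unfolding g_def using that by measurable
  have IH: "(\<integral>\<^sup>+x. g I c x \<partial>PiM I (\<lambda>_. lborel)) = ennreal (if 0 < c then c ^ m * K else 0)" for c
    using insert.IH[of c] by (simp add: g_def m_def K_def mult.assoc)
  have upd: "g (insert i I) c (x(i := y)) = (if 0 < y then ennreal (y ^ a i) * g I (c - y) x else 0)"
    for x y
  proof -
    have "(\<Sum>j\<in>I. (x(i := y)) j) = (\<Sum>j\<in>I. x j)" "(\<Prod>j\<in>I. (x(i := y)) j ^ a j) = (\<Prod>j\<in>I. x j ^ a j)"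
      "(\<forall>j\<in>I. 0 < (x(i := y)) j) \<longleftrightarrow> (\<forall>j\<in>I. 0 < x j)"
      using insert.hyps by (auto intro!: sum.cong prod.cong)
    then show ?thesis
      using insert.hyps unfolding g_def by (auto simp: ennreal_mult'[symmetric] algebra_simps)
  qed
  have "(\<integral>\<^sup>+x. g (insert i I) c x \<partial>PiM (insert i I) (\<lambda>_. lborel))
      = (\<integral>\<^sup>+y. (\<integral>\<^sup>+x. g (insert i I) c (x(i := y)) \<partial>PiM I (\<lambda>_. lborel)) \<partial>lborel)"
    using insert.hyps by (intro product_nn_integral_insert_rev meas) auto
  also have "\<dots> = (\<integral>\<^sup>+y. ennreal K * ennreal (if 0 < y \<and> y < c then y ^ a i * (c - y) ^ m else 0) \<partial>lborel)"
  proof (rule nn_integral_cong)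
    fix y :: real
    show "(\<integral>\<^sup>+x. g (insert i I) c (x(i := y)) \<partial>PiM I (\<lambda>_. lborel))
      = ennreal K * ennreal (if 0 < y \<and> y < c then y ^ a i * (c - y) ^ m else 0)"
    proof (cases "0 < y")
      case True
      then have "(\<integral>\<^sup>+x. g (insert i I) c (x(i := y)) \<partial>PiM I (\<lambda>_. lborel))
        = ennreal (y ^ a i) * (\<integral>\<^sup>+x. g I (c - y) x \<partial>PiM I (\<lambda>_. lborel))"
        unfolding upd by (simp add: nn_integral_cmult meas insert.hyps)
      also have "\<dots> = ennreal K * ennreal (if 0 < y \<and> y < c then y ^ a i * (c - y) ^ m else 0)"
        unfolding IH using True K by (auto simp: ennreal_mult[symmetric] mult_ac)
      finally show ?thesis .
    qed (simp add: upd)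
  qed
  also have "\<dots> = ennreal K * (\<integral>\<^sup>+y. ennreal (if 0 < y \<and> y < c then y ^ a i * (c - y) ^ m else 0) \<partial>lborel)"
    by (intro nn_integral_cmult) measurable
  also have "\<dots> = ennreal (if 0 < c then K * (c ^ (a i + m + 1) * fact (a i) * fact m / fact (a i + m + 1)) else 0)"
  proof (cases "0 < c")
    case True
    then show ?thesis
      unfolding nn_integral_beta_nat[OF less_imp_le[OF True]] using K by (subst ennreal_mult'[symmetric]) auto
  next
    case False
    then have "(if 0 < y \<and> y < c then y ^ a i * (c - y) ^ m else 0) = 0" for y by auto
    then show ?thesis using False by simp
  qed
  also have "K * (c ^ (a i + m + 1) * fact (a i) * fact m / fact (a i + m + 1))
     = c ^ ((\<Sum>i\<in>insert i I. a i) + k + card (insert i I)) * (\<Prod>i\<in>insert i I. fact (a i)) * fact k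
          / fact ((\<Sum>i\<in>insert i I. a i) + k + card (insert i I))"
    using insert.hyps by (simp add: K_def m_def add_ac mult_ac del: fact_Suc)
  finally show ?case unfolding g_def .
qed

definition dir_weight :: "nat \<Rightarrow> (nat \<Rightarrow> nat) \<Rightarrow> (nat \<Rightarrow> real) \<Rightarrow> real" where
  "dir_weight d N x = indicator (Theta d) x * (\<Prod>j\<le>d. full d x j ^ N j)"

lemma Theta_measurable [measurable]: "Theta d \<in> sets (lborel_d d)"
proof -
  have "Theta d = {x \<in> space (lborel_d d). (\<forall>j\<in>{1..d}. 0 < x j) \<and> (\<Sum>j = 1..d. x j) < 1}"
    by (auto simp: Theta_def space_PiM)
  also have "\<dots> \<in> sets (lborel_d d)" by measurable
  finally show ?thesis .
qed

lemma full_measurable [measurable]: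
  assumes "j \<le> d"
  shows "(\<lambda>x. full d x j) \<in> borel_measurable (lborel_d d)"
  using assms unfolding full_def by (cases "j = 0") auto

lemma dir_weight_measurable [measurable]: "dir_weight d N \<in> borel_measurable (lborel_d d)"
  unfolding dir_weight_def by measurable

lemma dir_weight_nonneg: "0 \<le> dir_weight d N x"
proof (cases "x \<in> Theta d")
  case True
  then have "0 \<le> (\<Prod>j\<le>d. full d x j ^ N j)"
    using full_pos[OF True] by (intro prod_nonneg ballI zero_le_power less_imp_le) auto
  then show ?thesis using True by (simp add: dir_weight_def)
qed (simp add: dir_weight_def)

lemma has_integral_dir_weight:
  "has_bochner_integral (lborel_d d) (dir_weight d N) ((\<Prod>j\<le>d. fact (N j)) / fact ((\<Sum>j\<le>d. N j) + d))"
proof (rule has_bochner_integral_nn_integral)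
  have split: "(\<Sum>j\<le>d. N j) = (\<Sum>j = 1..d. N j) + N 0" "(\<Prod>j\<le>d. fact (N j) :: real) = (\<Prod>j = 1..d. fact (N j)) * fact (N 0)"
    by (simp_all add: atMost_atLeast0 sum.atLeast_Suc_atMost prod.atLeast_Suc_atMost)
  have "(\<integral>\<^sup>+x. ennreal (dir_weight d N x) \<partial>lborel_d d)
    = (\<integral>\<^sup>+x. ennreal (if (\<forall>i\<in>{1..d}. 0 < x i) \<and> (\<Sum>i\<in>{1..d}. x i) < 1
              then (\<Prod>i\<in>{1..d}. x i ^ N i) * (1 - (\<Sum>i\<in>{1..d}. x i)) ^ N 0 else 0) \<partial>lborel_d d)"
  proof (rule nn_integral_cong)
    fix x assume "x \<in> space (lborel_d d)"
    then have x: "x \<in> Rd d" by (simp add: space_PiM)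
    have "(\<Prod>j\<le>d. full d x j ^ N j) = (\<Prod>i\<in>{1..d}. x i ^ N i) * (1 - (\<Sum>i\<in>{1..d}. x i)) ^ N 0"
    proof -
      have "(\<Prod>j\<le>d. full d x j ^ N j) = full d x 0 ^ N 0 * (\<Prod>j = 1..d. full d x j ^ N j)"
        by (simp add: atMost_atLeast0 prod.atLeast_Suc_atMost)
      also have "(\<Prod>j = 1..d. full d x j ^ N j) = (\<Prod>j = 1..d. x j ^ N j)"
        by (intro prod.cong) (auto simp: full_def)
      finally show ?thesis by (simp add: full_def mult.commute)
    qed
    then show "ennreal (dir_weight d N x) = ennreal (if (\<forall>i\<in>{1..d}. 0 < x i) \<and> (\<Sum>i\<in>{1..d}. x i) < 1
              then (\<Prod>i\<in>{1..d}. x i ^ N i) * (1 - (\<Sum>i\<in>{1..d}. x i)) ^ N 0 else 0)"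
      using x by (auto simp: dir_weight_def Theta_def indicator_def)
  qed
  also have "\<dots> = ennreal ((\<Prod>j\<le>d. fact (N j)) / fact ((\<Sum>j\<le>d. N j) + d))"
    by (subst nn_integral_simplex_monomial) (simp_all add: split)
  finally show "(\<integral>\<^sup>+x. ennreal (dir_weight d N x) \<partial>lborel_d d) = ennreal ((\<Prod>j\<le>d. fact (N j)) / fact ((\<Sum>j\<le>d. N j) + d))" .
  show "dir_weight d N \<in> borel_measurable (lborel_d d)" by (rule dir_weight_measurable)
  show "0 \<le> (\<Prod>j\<le>d. fact (N j) :: real) / fact ((\<Sum>j\<le>d. N j) + d)"
    by (intro divide_nonneg_nonneg prod_nonneg) auto
qed (simp add: dir_weight_nonneg)

lemma dir_weight_upd:
  assumes "j \<le> d"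
  shows "dir_weight d (N(j := N j + k)) x = dir_weight d N x * full d x j ^ k"
proof -
  have "(\<Prod>i\<le>d. full d x i ^ (N(j := N j + k)) i) = (\<Prod>i\<le>d. full d x i ^ N i) * full d x j ^ k"
    using assms by (subst (1 2) prod.remove[of _ j]) (auto simp: power_add intro!: prod.cong)
  then show ?thesis by (simp add: dir_weight_def)
qed

text \<open>Dirichlet with parameters \<open>N j + 1\<close>: the posterior for a flat prior.\<close>
definition dir_density :: "nat \<Rightarrow> (nat \<Rightarrow> nat) \<Rightarrow> (nat \<Rightarrow> real) \<Rightarrow> real" where
  "dir_density d N x = fact ((\<Sum>j\<le>d. N j) + d) / (\<Prod>j\<le>d. fact (N j)) * dir_weight d N x"

lemma dir_density_measurable [measurable]: "dir_density d N \<in> borel_measurable (lborel_d d)"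
  unfolding dir_density_def by measurable

lemma dir_density_nonneg: "0 \<le> dir_density d N x"
  unfolding dir_density_def by (intro mult_nonneg_nonneg divide_nonneg_nonneg prod_nonneg dir_weight_nonneg) auto

text \<open>Multiplying by a power of a coordinate only raises one count, so a moment is a quotient
  of two Dirichlet normalizing constants.\<close>

lemma dir_density_moment:
  assumes "j \<le> d"
  shows "has_bochner_integral (lborel_d d) (\<lambda>x. dir_density d N x * full d x j ^ k)
    (pochhammer (real (N j) + 1) k / pochhammer (real ((\<Sum>j\<le>d. N j) + d) + 1) k)"
proof -
  define n where "n = (\<Sum>j\<le>d. N j)"
  have s: "(\<Sum>i\<le>d. (N(j := N j + k)) i) = n + k"
    unfolding n_def using assms by (subst (1 2) sum.remove[of _ j]) (auto intro!: sum.cong)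
  have p: "(\<Prod>i\<le>d. fact ((N(j := N j + k)) i)) * fact (N j) = (\<Prod>i\<le>d. fact (N i)) * (fact (N j + k) :: real)"
    using assms by (subst (1 2) prod.remove[of _ j]) (auto intro!: prod.cong)
  have poch: "pochhammer (real m + 1) k = fact (m + k) / fact m" for m
    using pochhammer_product[of m "m + k" "1 :: real"]
    by (simp add: pochhammer_fact[symmetric] add.commute divide_simps)
  have "has_bochner_integral (lborel_d d) (\<lambda>x. fact (n + d) / (\<Prod>j\<le>d. fact (N j)) * dir_weight d (N(j := N j + k)) x)
    (fact (n + d) / (\<Prod>j\<le>d. fact (N j)) * ((\<Prod>i\<le>d. fact ((N(j := N j + k)) i)) / fact (n + k + d)))"
    by (intro has_bochner_integral_mult_right) (use has_integral_dir_weight[of d "N(j := N j + k)"] s in simp)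
  also have "(\<lambda>x. fact (n + d) / (\<Prod>j\<le>d. fact (N j)) * dir_weight d (N(j := N j + k)) x) = (\<lambda>x. dir_density d N x * full d x j ^ k)"
    by (simp add: dir_weight_upd[OF assms] dir_density_def n_def mult.assoc)
  also have "(\<Prod>i\<le>d. fact ((N(j := N j + k)) i)) = (\<Prod>i\<le>d. fact (N i)) * (fact (N j + k) :: real) / fact (N j)"
    using p by (simp add: field_simps)
  also have "fact (n + d) / (\<Prod>j\<le>d. fact (N j)) * ((\<Prod>i\<le>d. fact (N i)) * (fact (N j + k) :: real) / fact (N j) / fact (n + k + d))
    = pochhammer (real (N j) + 1) k / pochhammer (real (n + d) + 1) k"
  proof -
    have "(\<Prod>j\<le>d. fact (N j)) \<noteq> (0::real)" by (simp add: prod_zero_iff)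
    then show ?thesis unfolding poch by (simp add: add_ac del: of_nat_add)
  qed
  finally show ?thesis by (simp add: n_def)
qed

lemma dir_density_integral: "has_bochner_integral (lborel_d d) (dir_density d N) 1"
  using dir_density_moment[of 0 d N 0] by simp

section \<open>The logarithm of the prior is Lipschitz\<close>

text \<open>The restriction to \<open>{1..d}\<close> keeps every point of the line in
  \<open>Rd d\<close>.\<close>

definition along :: "nat \<Rightarrow> (nat \<Rightarrow> real) \<Rightarrow> (nat \<Rightarrow> real) \<Rightarrow> real \<Rightarrow> (nat \<Rightarrow> real)" where
  "along d z h t = (\<lambda>j\<in>{1..d}. z j + t * h j)"

lemma along_Rd: "along d z h t \<in> Rd d"
  by (auto simp: along_def)

lemma along_0: "z \<in> Rd d \<Longrightarrow> along d z h 0 = z"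
  by (auto simp: along_def fun_eq_iff PiE_def extensional_def restrict_def)

lemma along_along: "along d (along d z h s) h t = along d z h (s + t)"
  by (auto simp: along_def fun_eq_iff algebra_simps)

text \<open>\<open>grad\<close> is built from \<open>deriv\<close>, which has a value even where
  there is no derivative; the Frechet quotient in \<open>C1_on\<close> is what makes
  \<open>grad\<close> the true differential. It is composed with the line, where the increment has
  Euclidean length \<open>|t| * L\<close>.\<close>

lemma directional_derivative:
  assumes C1: "C1_on d f U" and z: "z \<in> U" "z \<in> Rd d"
  shows "((\<lambda>t. f (along d z h t)) has_real_derivative (\<Sum>j = 1..d. grad d f z j * h j)) (at 0)"
proof -
  define G where "G = (\<Sum>j = 1..d. grad d f z j * h j)"
  have frechet: "((\<lambda>y. (f y - f z - (\<Sum>j = 1..d. grad d f z j * (y j - z j)))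
                  / L2_set (\<lambda>j. y j - z j) {1..d}) \<longlongrightarrow> 0) (at z within Rd d)"
    using C1 z by (simp add: C1_on_def)
  show ?thesis
  \<comment> \<open>In the zero direction the line never leaves \<open>z\<close>, and the punctured
    limit at \<open>z\<close> says nothing; the function is then constant along it.\<close>
  proof (cases "\<forall>j\<in>{1..d}. h j = 0")
    case True
    then have "along d z h t = along d z h 0" for t by (auto simp: along_def fun_eq_iff)
    then have "(\<lambda>t. f (along d z h t)) = (\<lambda>t. f (along d z h 0))" by metis
    moreover have "G = 0" using True by (simp add: G_def)
    ultimately show ?thesis using G_def by auto
  next
    case False
    then obtain k where k: "k \<in> {1..d}" "h k \<noteq> 0" by blast
    define L where "L = L2_set h {1..d}"
    have "L \<noteq> 0" using k L2_set_eq_0_iff[of "{1..d}" h] by (auto simp: L_def)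
    then have L: "L > 0" using L2_set_nonneg[of h "{1..d}"] by (simp add: L_def less_le)
    have "((\<lambda>t. along d z h t) \<longlongrightarrow> along d z h 0) (at 0)"
    proof -
      have "continuous_on UNIV (\<lambda>t. along d z h t)"
      proof (rule continuous_on_coordinatewise_then_product)
        show "continuous_on UNIV (\<lambda>t. along d z h t i)" for i
          by (cases "i \<in> {1..d}") (auto simp: along_def intro!: continuous_intros)
      qed
      then show ?thesis by (auto simp: continuous_on_def)
    qed
    then have "((\<lambda>t. along d z h t) \<longlongrightarrow> z) (at 0)" using along_0[OF z(2)] by simp
    moreover have "eventually (\<lambda>t. along d z h t \<in> Rd d \<and> along d z h t \<noteq> z) (at 0)"
    proof -
      have "along d z h t \<noteq> z" if "t \<noteq> 0" for t
        using k that by (auto simp: along_def fun_eq_iff)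
      then show ?thesis using along_Rd by (auto simp: eventually_at_filter)
    qed
    ultimately have "filterlim (\<lambda>t. along d z h t) (at z within Rd d) (at 0)"
      by (auto simp: filterlim_at)
    from filterlim_compose[OF frechet this]
    have lim: "((\<lambda>t. (f (along d z h t) - f z - t * G) / (\<bar>t\<bar> * L)) \<longlongrightarrow> 0) (at 0)"
    proof (rule Lim_transform_eventually, intro always_eventually allI)
      fix t
      have "(\<Sum>j = 1..d. grad d f z j * (along d z h t j - z j)) = t * G"
        by (simp add: along_def G_def sum_distrib_left mult_ac)
      moreover have "L2_set (\<lambda>j. along d z h t j - z j) {1..d} = \<bar>t\<bar> * L"
      proof -
        have "L2_set (\<lambda>j. along d z h t j - z j) {1..d} = L2_set (\<lambda>j. t * h j) {1..d}"
          by (rule L2_set_cong) (auto simp: along_def)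
        also have "\<dots> = \<bar>t\<bar> * L"
          by (simp add: L_def L2_set_def power_mult_distrib real_sqrt_mult flip: sum_distrib_left)
        finally show ?thesis .
      qed
      ultimately show "(f (along d z h t) - f z - (\<Sum>j = 1..d. grad d f z j * (along d z h t j - z j)))
          / L2_set (\<lambda>j. along d z h t j - z j) {1..d} = (f (along d z h t) - f z - t * G) / (\<bar>t\<bar> * L)"
        by simp
    qed
    have "((\<lambda>t. \<bar>(f (along d z h t) - f z - t * G) / (\<bar>t\<bar> * L)\<bar> * L) \<longlongrightarrow> \<bar>0\<bar> * L) (at 0)"
      by (intro tendsto_intros lim)
    then have lim0: "((\<lambda>t. \<bar>(f (along d z h t) - f z - t * G) / (\<bar>t\<bar> * L)\<bar> * L) \<longlongrightarrow> 0) (at 0)"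
      by simp
    have "((\<lambda>t. \<bar>(f (along d z h t) - f z) / t - G\<bar>) \<longlongrightarrow> 0) (at 0)"
    proof (rule Lim_transform_eventually[OF lim0])
      show "\<forall>\<^sub>F t in at 0. \<bar>(f (along d z h t) - f z - t * G) / (\<bar>t\<bar> * L)\<bar> * L = \<bar>(f (along d z h t) - f z) / t - G\<bar>"
      proof -
        have "\<bar>(f (along d z h t) - f z - t * G) / (\<bar>t\<bar> * L)\<bar> * L = \<bar>(f (along d z h t) - f z) / t - G\<bar>"
          if t: "t \<noteq> 0" for t
        proof -
          have "(f (along d z h t) - f z) / t - G = (f (along d z h t) - f z - t * G) / t"
            using t by (simp add: field_simps)
          then show ?thesis using L by (simp add: abs_divide abs_mult)
        qed
        then show ?thesis by (auto simp: eventually_at_filter)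
      qed
    qed
    then have "((\<lambda>t. (f (along d z h t) - f z) / t) \<longlongrightarrow> G) (at 0)"
      by (simp add: tendsto_rabs_zero_iff LIM_zero_iff)
    then show ?thesis using along_0[OF z(2)] by (simp add: has_field_derivative_iff G_def)
  qed
qed

text \<open>The chain rule must start from a genuine partial derivative, which the directional
  derivative along the unit vector \<open>e\<close> provides.\<close>

lemma grad_ln:
  assumes C1: "C1_on d f U" and z: "z \<in> U" "z \<in> Rd d" and pos: "f z > 0" and j: "j \<in> {1..d}"
  shows "grad d (\<lambda>x. ln (f x)) z j = grad d f z j / f z"
proof -
  define e where "e i = (if i = j then 1 else 0 :: real)" for i
  have upd: "z(j := z j + t) = along d z e t" for t
    using z(2) j by (auto simp: along_def e_def fun_eq_iff PiE_def extensional_def restrict_def)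
  have "((\<lambda>t. f (z(j := z j + t))) has_real_derivative grad d f z j) (at 0)"
    using directional_derivative[OF C1 z, of e] j by (simp add: upd e_def if_distrib cong: if_cong)
  then have "((\<lambda>t. f (z(j := t))) has_real_derivative grad d f z j) (at (z j))"
    using DERIV_shift[of "\<lambda>t. f (z(j := t))" "grad d f z j" 0 "z j"] by (simp add: add.commute)
  then have "((\<lambda>t. ln (f (z(j := t)))) has_real_derivative (1 / f z * grad d f z j)) (at (z j))"
    using pos by (auto intro!: derivative_eq_intros)
  then show ?thesis using j by (simp add: grad_def DERIV_imp_deriv)
qed

section \<open>Convexity of the Fisher ellipsoid and the mean value estimate\<close>

lemma fisher_sq_convex:
  assumes "\<theta> \<in> Theta d" "0 \<le> t" "t \<le> 1"
  shows "fisher_sq d \<theta> (\<lambda>j. (1 - t) * u j + t * v j) \<le> (1 - t) * fisher_sq d \<theta> u + t * fisher_sq d \<theta> v"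
proof -
  have sq: "((1 - t) * a + t * b)\<^sup>2 / c \<le> (1 - t) * (a\<^sup>2 / c) + t * (b\<^sup>2 / c)" if "c > 0" for a b c :: real
  proof -
    have "(1 - t) * a\<^sup>2 + t * b\<^sup>2 - ((1 - t) * a + t * b)\<^sup>2 = t * (1 - t) * (a - b)\<^sup>2"
      by (simp add: power2_eq_square algebra_simps)
    moreover have "0 \<le> t * (1 - t) * (a - b)\<^sup>2" using assms by (intro mult_nonneg_nonneg) auto
    ultimately have "((1 - t) * a + t * b)\<^sup>2 \<le> (1 - t) * a\<^sup>2 + t * b\<^sup>2" by linarith
    then have "((1 - t) * a + t * b)\<^sup>2 / c \<le> ((1 - t) * a\<^sup>2 + t * b\<^sup>2) / c"
      using that by (intro divide_right_mono) auto
    then show ?thesis by (simp add: add_divide_distrib)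
  qed
  have "(\<Sum>j = 1..d. (1 - t) * u j + t * v j) = (1 - t) * (\<Sum>j = 1..d. u j) + t * (\<Sum>j = 1..d. v j)"
    by (simp add: sum.distrib sum_distrib_left)
  then have "fisher_sq d \<theta> (\<lambda>j. (1 - t) * u j + t * v j)
     \<le> (\<Sum>j = 1..d. (1 - t) * ((u j)\<^sup>2 / full d \<theta> j) + t * ((v j)\<^sup>2 / full d \<theta> j))
      + ((1 - t) * ((\<Sum>j = 1..d. u j)\<^sup>2 / full d \<theta> 0) + t * ((\<Sum>j = 1..d. v j)\<^sup>2 / full d \<theta> 0))"
    unfolding fisher_sq_def by (simp only:, intro add_mono sum_mono sq full_pos[OF assms(1)]) auto
  also have "\<dots> = (1 - t) * fisher_sq d \<theta> u + t * fisher_sq d \<theta> v"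
    by (simp add: fisher_sq_def sum.distrib sum_distrib_left algebra_simps)
  finally show ?thesis .
qed

lemma Ustar_eq:
  assumes "\<theta>s \<in> Theta d" "s \<ge> 0"
  shows "Ustar n d \<theta>s s = {\<theta> \<in> Rd d. fisher_sq d \<theta>s (\<lambda>j. \<theta> j - \<theta>s j) \<le> s\<^sup>2 * (real d / real n)}"
proof -
  have "sqrt a \<le> s * sqrt b \<longleftrightarrow> a \<le> s\<^sup>2 * b" for a b
  proof -
    have "s * sqrt b = sqrt (s\<^sup>2 * b)" using assms(2) by (simp add: real_sqrt_mult)
    then show ?thesis by simp
  qed
  then show ?thesis by (simp add: Ustar_def wnorm_fisher[OF assms(1)])
qed

lemma Ustar_convex:
  assumes \<theta>s: "\<theta>s \<in> Theta d" and s: "s \<ge> 0" and xy: "x \<in> Ustar n d \<theta>s s" "y \<in> Ustar n d \<theta>s s"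
    and t: "0 \<le> t" "t \<le> 1"
  shows "along d x (\<lambda>j. y j - x j) t \<in> Ustar n d \<theta>s s"
proof -
  have "fisher_sq d \<theta>s (\<lambda>j. along d x (\<lambda>j. y j - x j) t j - \<theta>s j)
      = fisher_sq d \<theta>s (\<lambda>j. (1 - t) * (x j - \<theta>s j) + t * (y j - \<theta>s j))"
    unfolding fisher_sq_def
    by (intro arg_cong2[of _ _ _ _ "(+)"] sum.cong arg_cong2[of _ _ _ _ "(/)"] arg_cong[of _ _ "\<lambda>x. x\<^sup>2"])
       (auto simp: along_def algebra_simps)
  also have "\<dots> \<le> (1 - t) * fisher_sq d \<theta>s (\<lambda>j. x j - \<theta>s j) + t * fisher_sq d \<theta>s (\<lambda>j. y j - \<theta>s j)"
    by (rule fisher_sq_convex[OF \<theta>s t])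
  also have "\<dots> \<le> (1 - t) * (s\<^sup>2 * (real d / real n)) + t * (s\<^sup>2 * (real d / real n))"
    using xy t unfolding Ustar_eq[OF \<theta>s s] by (intro add_mono mult_left_mono) auto
  also have "\<dots> = ((1 - t) + t) * (s\<^sup>2 * (real d / real n))" by (rule distrib_right[symmetric])
  also have "\<dots> = s\<^sup>2 * (real d / real n)" by simp
  finally show ?thesis unfolding Ustar_eq[OF \<theta>s s] using along_Rd by blast
qed

text \<open>Mean value theorem on the segment from \<open>x\<close> to \<open>y\<close>, which stays
  in the convex ellipsoid, followed by duality of the two norms.\<close>

lemma ln_prior_lipschitz:
  assumes \<theta>s: "\<theta>s \<in> Theta d" and s: "s \<ge> 0" and \<delta>: "delta01 n d \<theta>s p s \<le> ereal \<delta>"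
    and xy: "x \<in> Ustar n d \<theta>s s" "y \<in> Ustar n d \<theta>s s"
  shows "\<bar>ln (p y) - ln (p x)\<bar> \<le> \<delta> * sqrt (fisher_sq d \<theta>s (\<lambda>j. y j - x j))"
proof -
  let ?U = "Ustar n d \<theta>s s"
  have C1: "C1_on d p ?U" and pos: "\<And>\<theta>. \<theta> \<in> ?U \<Longrightarrow> 0 < p \<theta>"
    using \<delta> by (auto simp: delta01_def split: if_splits)
  have dual: "wnorm_dual (fisher d \<theta>s) d (grad d (\<lambda>x. ln (p x)) z) \<le> \<delta>" if "z \<in> ?U" for z
  proof -
    have "ereal (wnorm_dual (fisher d \<theta>s) d (grad d (\<lambda>x. ln (p x)) z)) \<le> delta01 n d \<theta>s p s"
      using C1 pos that by (auto simp: delta01_def intro: SUP_upper)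
    then show ?thesis using \<delta> by (metis ereal_less_eq(3) order_trans)
  qed
  define h where "h = (\<lambda>j. y j - x j)"
  define g where "g t = along d x h t" for t
  have gU: "g t \<in> ?U" if "0 \<le> t" "t \<le> 1" for t
    using Ustar_convex[OF \<theta>s s xy that] by (simp add: g_def h_def)
  have URd: "z \<in> Rd d" if "z \<in> ?U" for z using that by (simp add: Ustar_def)
  define D where "D t = (\<Sum>j = 1..d. grad d (\<lambda>x. ln (p x)) (g t) j * h j)" for t
  \<comment> \<open>\<open>C1_on\<close> differentiates in the whole space, so this derivative is
    two-sided even at an endpoint on the boundary of the ellipsoid.\<close>
  have der: "((\<lambda>t. ln (p (g t))) has_real_derivative D t) (at t)" if t: "0 \<le> t" "t \<le> 1" for t
  proof -
    note z = gU[OF t] URd[OF gU[OF t]]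
    have "((\<lambda>r. p (along d (g t) h r)) has_real_derivative (\<Sum>j = 1..d. grad d p (g t) j * h j)) (at 0)"
      by (rule directional_derivative[OF C1 z])
    then have "((\<lambda>r. p (g (t + r))) has_real_derivative (\<Sum>j = 1..d. grad d p (g t) j * h j)) (at 0)"
      by (simp add: g_def along_along)
    then have "((\<lambda>r. p (g r)) has_real_derivative (\<Sum>j = 1..d. grad d p (g t) j * h j)) (at t)"
      using DERIV_shift[of "\<lambda>r. p (g r)" _ 0 t] by (simp add: add.commute)
    then have "((\<lambda>r. ln (p (g r))) has_real_derivative (1 / p (g t) * (\<Sum>j = 1..d. grad d p (g t) j * h j))) (at t)"
      using pos[OF gU[OF t]] by (auto intro!: derivative_eq_intros)
    moreover have "1 / p (g t) * (\<Sum>j = 1..d. grad d p (g t) j * h j) = D t"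
      unfolding D_def sum_distrib_left
      by (intro sum.cong refl) (simp add: grad_ln[OF C1 z pos[OF gU[OF t]]])
    ultimately show ?thesis by simp
  qed
  obtain \<xi> where \<xi>: "0 < \<xi>" "\<xi> < 1" "ln (p (g 1)) - ln (p (g 0)) = (1 - 0) * D \<xi>"
    using MVT2[of 0 1 "\<lambda>t. ln (p (g t))" D] der by auto
  have "g 0 = x" using along_0[OF URd[OF xy(1)]] by (simp add: g_def)
  moreover have "g 1 = y"
    using URd[OF xy(2)] by (auto simp: g_def along_def h_def fun_eq_iff PiE_def extensional_def restrict_def)
  ultimately have "\<bar>ln (p y) - ln (p x)\<bar> = \<bar>D \<xi>\<bar>" using \<xi> by simp
  also have "\<dots> \<le> wnorm_dual (fisher d \<theta>s) d (grad d (\<lambda>x. ln (p x)) (g \<xi>)) * wnorm (fisher d \<theta>s) d h"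
    unfolding D_def by (rule wnorm_duality[OF \<theta>s])
  also have "\<dots> \<le> \<delta> * wnorm (fisher d \<theta>s) d h"
    using \<xi> fisher_sq_nonneg[OF \<theta>s]
    by (intro mult_right_mono dual gU) (auto simp: wnorm_fisher[OF \<theta>s])
  finally show ?thesis by (simp add: wnorm_fisher[OF \<theta>s] h_def)
qed

section \<open>Total variation bounds\<close>

text \<open>With total mass \<open>F\<close> and mass \<open>G\<close> of \<open>U\<close> the
  difference is \<open>b / F - (a / G) * ((F - G) / F)\<close>, and both terms lie between 0 and
  \<open>(F - G) / F\<close>. Used for the general and for the flat posterior, it moves between a
  law and its restriction to \<open>U\<close>.\<close>

lemma renormalized_restriction_bound:
  fixes f :: "'a \<Rightarrow> real"
  assumes f: "integrable M f" "\<And>x. f x \<ge> 0" and [measurable]: "A \<in> sets M" "U \<in> sets M"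
    and pos: "(\<integral>x. indicator U x * f x \<partial>M) > 0"
  shows "\<bar>(\<integral>x. indicator A x * f x \<partial>M) / (\<integral>x. f x \<partial>M)
      - (\<integral>x. indicator (A \<inter> U) x * f x \<partial>M) / (\<integral>x. indicator U x * f x \<partial>M)\<bar>
    \<le> ((\<integral>x. f x \<partial>M) - (\<integral>x. indicator U x * f x \<partial>M)) / (\<integral>x. f x \<partial>M)"
proof -
  have int: "integrable M (\<lambda>x. indicator B x * f x)" if "B \<in> sets M" for B
    using integrable_mult_indicator[OF that f(1)] by simp
  define F G a b where "F = (\<integral>x. f x \<partial>M)" and "G = (\<integral>x. indicator U x * f x \<partial>M)"
    and "a = (\<integral>x. indicator (A \<inter> U) x * f x \<partial>M)" and "b = (\<integral>x. indicator (A - U) x * f x \<partial>M)"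
  have a: "0 \<le> a" unfolding a_def using f(2) by (auto intro!: integral_nonneg_AE)
  have aG: "a \<le> G" unfolding a_def G_def
    using f(2) by (intro integral_mono int) (auto simp: indicator_def)
  have GF: "G \<le> F" unfolding G_def F_def
    using f by (intro integral_mono int) (auto simp: indicator_def)
  have b: "0 \<le> b" unfolding b_def using f(2) by (auto intro!: integral_nonneg_AE)
  have "b + G = (\<integral>x. indicator (A - U) x * f x + indicator U x * f x \<partial>M)"
    unfolding b_def G_def by (intro Bochner_Integration.integral_add[symmetric] int) auto
  also have "\<dots> \<le> F" unfolding F_def
    using f by (intro integral_mono Bochner_Integration.integrable_add int) (auto simp: indicator_def)
  finally have bF: "b \<le> F - G" by simp
  have "a + b = (\<integral>x. indicator (A \<inter> U) x * f x + indicator (A - U) x * f x \<partial>M)"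
    unfolding a_def b_def by (intro Bochner_Integration.integral_add[symmetric] int) auto
  also have "\<dots> = (\<integral>x. indicator A x * f x \<partial>M)"
    by (intro Bochner_Integration.integral_cong) (auto simp: indicator_def)
  finally have ab: "(\<integral>x. indicator A x * f x \<partial>M) = a + b" by simp
  have G: "G > 0" using pos by (simp add: G_def)
  then have F: "F > 0" using GF by simp
  have eq: "(a + b) / F - a / G = b / F - (a / G) * ((F - G) / F)"
    using G F by (simp add: field_simps)
  have "0 \<le> b / F" "b / F \<le> (F - G) / F" using b bF F by (auto intro: divide_right_mono)
  moreover have "0 \<le> (a / G) * ((F - G) / F)"
    using a G GF F by (auto intro!: mult_nonneg_nonneg)
  moreover have "(a / G) * ((F - G) / F) \<le> 1 * ((F - G) / F)"
    by (rule mult_right_mono) (use aG G GF F in auto)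
  ultimately have "\<bar>(a + b) / F - a / G\<bar> \<le> (F - G) / F" unfolding eq by linarith
  then show ?thesis by (simp add: ab a_def F_def G_def)
qed

lemma integral_indicator_diff_le:
  fixes u v w :: "'a \<Rightarrow> real"
  assumes "integrable M u" "integrable M v" "integrable M w" "A \<in> sets M"
    and "\<And>x. \<bar>u x - v x\<bar> \<le> w x"
  shows "\<bar>(\<integral>x. indicator A x * u x \<partial>M) - (\<integral>x. indicator A x * v x \<partial>M)\<bar> \<le> (\<integral>x. w x \<partial>M)"
proof -
  have int: "integrable M (\<lambda>x. indicator A x * f x)" if "integrable M f" for f :: "'a \<Rightarrow> real"
    using integrable_mult_indicator[OF assms(4) that] by simp
  have "(\<integral>x. indicator A x * u x \<partial>M) - (\<integral>x. indicator A x * v x \<partial>M)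
      = (\<integral>x. indicator A x * u x - indicator A x * v x \<partial>M)"
    by (intro Bochner_Integration.integral_diff[symmetric] int assms)
  also have "\<bar>\<dots>\<bar> \<le> (\<integral>x. \<bar>indicator A x * u x - indicator A x * v x\<bar> \<partial>M)"
    by (rule integral_abs_bound)
  also have "\<dots> \<le> (\<integral>x. w x \<partial>M)"
  proof (rule integral_mono)
    show "integrable M (\<lambda>x. \<bar>indicator A x * u x - indicator A x * v x\<bar>)"
      by (intro integrable_abs Bochner_Integration.integrable_diff int assms)
    show "\<bar>indicator A x * u x - indicator A x * v x\<bar> \<le> w x" for x
      using assms(5)[of x] by (auto simp: indicator_def intro: order_trans[OF abs_ge_zero])
  qed fact
  finally show ?thesis .
qed

text \<open>A chi-square bound controls total variation; the Cauchy-Schwarz step is replaced by the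
  pointwise inequality \<open>2 \<bar>y - 1\<bar> \<le> (y - 1)\<^sup>2 / \<kappa> + \<kappa>\<close>.\<close>
lemma reweighting_bound:
  fixes p g :: "'a \<Rightarrow> real"
  assumes int: "integrable M p" "integrable M (\<lambda>x. p x * g x)" "integrable M (\<lambda>x. p x * (g x)\<^sup>2)"
    and p: "\<And>x. p x \<ge> 0" and A: "A \<in> sets M"
    and D: "(\<integral>x. p x \<partial>M) > 0" and Z: "(\<integral>x. p x * g x \<partial>M) > 0" and \<kappa>: "\<kappa> > 0"
    and le: "(\<integral>x. p x * (g x)\<^sup>2 \<partial>M) * (\<integral>x. p x \<partial>M) \<le> (1 + \<kappa>\<^sup>2) * (\<integral>x. p x * g x \<partial>M)\<^sup>2"
  shows "\<bar>(\<integral>x. indicator A x * (p x * g x) \<partial>M) / (\<integral>x. p x * g x \<partial>M)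
     - (\<integral>x. indicator A x * p x \<partial>M) / (\<integral>x. p x \<partial>M)\<bar> \<le> \<kappa>"
proof -
  define D Z W where "D = (\<integral>x. p x \<partial>M)" and "Z = (\<integral>x. p x * g x \<partial>M)" and "W = (\<integral>x. p x * (g x)\<^sup>2 \<partial>M)"
  have DZ: "D > 0" "Z > 0" using D Z by (auto simp: D_def Z_def)
  \<comment> \<open>The density of the reweighted law with respect to the normalized
    \<open>p\<close>; hypothesis \<open>le\<close> says that its second moment is at most
    \<open>1 + \<kappa>^2\<close>.\<close>
  define y where "y x = g x * D / Z" for x
  define w where "w x = (1 / (2 * \<kappa>)) * (D / Z\<^sup>2 * (p x * (g x)\<^sup>2) - 2 / Z * (p x * g x) + 1 / D * p x) + \<kappa> / 2 * (1 / D * p x)" for x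
  have w_int: "integrable M w" unfolding w_def
    by (intro Bochner_Integration.integrable_add Bochner_Integration.integrable_diff integrable_mult_right int)
  have "\<bar>(\<integral>x. indicator A x * (1 / Z * (p x * g x)) \<partial>M) - (\<integral>x. indicator A x * (1 / D * p x) \<partial>M)\<bar> \<le> (\<integral>x. w x \<partial>M)"
  proof (rule integral_indicator_diff_le)
    fix x
    have "2 * \<bar>y x - 1\<bar> * \<kappa> \<le> (y x - 1)\<^sup>2 + \<kappa>\<^sup>2"
      using sum_squares_bound[of "\<bar>y x - 1\<bar>" \<kappa>] by simp
    then have amgm: "\<bar>y x - 1\<bar> \<le> 1 / (2 * \<kappa>) * (y x - 1)\<^sup>2 + \<kappa> / 2"
      using \<kappa> by (simp add: divide_simps) (simp add: power2_eq_square algebra_simps)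
    have "1 / Z * (p x * g x) - 1 / D * p x = p x / D * (y x - 1)"
      using DZ by (simp add: y_def field_simps)
    then have "\<bar>1 / Z * (p x * g x) - 1 / D * p x\<bar> = p x / D * \<bar>y x - 1\<bar>"
      using DZ p[of x] by (simp add: abs_mult)
    also have "\<dots> \<le> p x / D * (1 / (2 * \<kappa>) * (y x - 1)\<^sup>2 + \<kappa> / 2)"
      using DZ p[of x] by (intro mult_left_mono amgm) auto
    also have "\<dots> = w x"
      using DZ \<kappa> by (simp add: w_def y_def power2_eq_square field_simps)
    finally show "\<bar>1 / Z * (p x * g x) - 1 / D * p x\<bar> \<le> w x" .
  qed (auto intro!: integrable_mult_right int w_int A)
  also have "(\<integral>x. w x \<partial>M) = (1 / (2 * \<kappa>)) * (D / Z\<^sup>2 * W - 2 / Z * Z + 1 / D * D) + \<kappa> / 2 * (1 / D * D)"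
    unfolding w_def D_def Z_def W_def
    by (simp add: int Bochner_Integration.integrable_add Bochner_Integration.integrable_diff)
  also have "\<dots> \<le> \<kappa>"
  proof -
    have "D / Z\<^sup>2 * W \<le> 1 + \<kappa>\<^sup>2"
    proof -
      have "W * D / Z\<^sup>2 \<le> (1 + \<kappa>\<^sup>2) * Z\<^sup>2 / Z\<^sup>2"
        using le by (intro divide_right_mono) (auto simp: D_def Z_def W_def)
      then show ?thesis using DZ by (simp add: mult.commute)
    qed
    then have "(1 / (2 * \<kappa>)) * (D / Z\<^sup>2 * W - 1) \<le> (1 / (2 * \<kappa>)) * \<kappa>\<^sup>2"
      using \<kappa> by (intro mult_left_mono) auto
    also have "\<dots> = \<kappa> / 2" using \<kappa> by (simp add: power2_eq_square)
    finally have le': "(1 / (2 * \<kappa>)) * (D / Z\<^sup>2 * W - 1) \<le> \<kappa> / 2" .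
    have "D / Z\<^sup>2 * W - 2 / Z * Z + 1 / D * D = D / Z\<^sup>2 * W - 1" "1 / D * D = 1" using DZ by simp_all
    then show ?thesis using le' by (simp only:)
  qed
  finally show ?thesis
    by (simp add: D_def Z_def mult.left_commute[of "indicator A _"])
qed

text \<open>Here \<open>\<integral> p L\<close> bounds the Kullback-Leibler divergence of \<open>p\<close> from \<open>q\<close>, and
  \<open>(\<surd>p - \<surd>q)\<^sup>2 \<le> q - p + p L\<close> because \<open>2 - 2 \<surd>(q / p) \<le> ln (p / q)\<close>.\<close>
lemma kl_bound:
  fixes p q L :: "'a \<Rightarrow> real"
  assumes int: "integrable M p" "integrable M q" "integrable M (\<lambda>x. p x * L x)"
    and p: "\<And>x. p x \<ge> 0" and q: "\<And>x. q x > 0" and A: "A \<in> sets M"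
    and pq: "(\<integral>x. p x \<partial>M) = 1" "(\<integral>x. q x \<partial>M) = 1"
    and L: "\<And>x. p x > 0 \<Longrightarrow> ln (p x / q x) \<le> L x"
    and \<kappa>: "\<kappa> > 0" "(\<integral>x. p x * L x \<partial>M) \<le> \<kappa>\<^sup>2"
  shows "\<bar>(\<integral>x. indicator A x * p x \<partial>M) - (\<integral>x. indicator A x * q x \<partial>M)\<bar> \<le> 5 / 2 * \<kappa>"
proof -
  \<comment> \<open>Dominates \<open>|p x - q x|\<close>, factored as a difference times a sum of
    square roots: the first term covers the squared difference, the second the squared sum. They
    integrate to at most \<open>\<kappa> / 2\<close> and to \<open>2 * \<kappa>\<close>.\<close>
  define w where "w x = 1 / (2 * \<kappa>) * (q x - p x + p x * L x) + \<kappa> * (p x + q x)" for x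
  have w_int: "integrable M w" unfolding w_def
    by (intro Bochner_Integration.integrable_add Bochner_Integration.integrable_diff integrable_mult_right int)
  have "\<bar>(\<integral>x. indicator A x * p x \<partial>M) - (\<integral>x. indicator A x * q x \<partial>M)\<bar> \<le> (\<integral>x. w x \<partial>M)"
  proof (rule integral_indicator_diff_le)
    fix x
    define a b where "a = sqrt (p x)" and "b = sqrt (q x)"
    have ab: "a \<ge> 0" "b > 0" "p x = a\<^sup>2" "q x = b\<^sup>2" using p[of x] q[of x] by (auto simp: a_def b_def)
    have hell: "(a - b)\<^sup>2 \<le> q x - p x + p x * L x"
    proof (cases "a = 0")
      case False
      then have a: "a > 0" using ab by simp
      have "ln ((b / a)\<^sup>2) = - ln (p x / q x)"
        using a ab by (simp add: ln_div power_divide)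
      then have "2 * ln (b / a) = - ln (p x / q x)"
        using a ab by (simp add: ln_realpow)
      moreover have "ln (b / a) \<le> b / a - 1" using a ab by (intro ln_le_minus_one) auto
      moreover have "ln (p x / q x) \<le> L x" using a ab by (intro L) auto
      ultimately have "2 - 2 * (b / a) \<le> L x" by linarith
      then have "a\<^sup>2 * (2 - 2 * (b / a)) \<le> a\<^sup>2 * L x" by (intro mult_left_mono) auto
      moreover have "a\<^sup>2 * (2 - 2 * (b / a)) = 2 * a\<^sup>2 - 2 * a * b" using a by (simp add: power2_eq_square field_simps)
      ultimately show ?thesis using ab by (simp add: power2_eq_square algebra_simps)
    qed (simp add: ab)
    have "2 * (\<bar>a - b\<bar> * (\<kappa> * (a + b))) \<le> (a - b)\<^sup>2 + \<kappa>\<^sup>2 * (a + b)\<^sup>2"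
      using sum_squares_bound[of "\<bar>a - b\<bar>" "\<kappa> * (a + b)"] by (simp add: power_mult_distrib)
    also have "\<bar>a - b\<bar> * (\<kappa> * (a + b)) = \<kappa> * \<bar>p x - q x\<bar>"
    proof -
      have "p x - q x = (a - b) * (a + b)" using ab by (simp add: power2_eq_square algebra_simps)
      then show ?thesis using ab by (simp add: abs_mult)
    qed
    also have "\<kappa>\<^sup>2 * (a + b)\<^sup>2 \<le> \<kappa>\<^sup>2 * (2 * (p x + q x))"
    proof (rule mult_left_mono)
      show "(a + b)\<^sup>2 \<le> 2 * (p x + q x)"
        using sum_squares_bound[of a b] ab by (simp add: power2_eq_square algebra_simps)
    qed simp
    finally have "2 * \<kappa> * \<bar>p x - q x\<bar> \<le> (q x - p x + p x * L x) + 2 * \<kappa>\<^sup>2 * (p x + q x)"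
      using hell by (simp add: algebra_simps)
    then have "\<bar>p x - q x\<bar> \<le> ((q x - p x + p x * L x) + 2 * \<kappa>\<^sup>2 * (p x + q x)) / (2 * \<kappa>)"
      using \<kappa> by (simp add: pos_le_divide_eq mult.commute)
    also have "\<dots> = w x" using \<kappa> by (simp add: w_def add_divide_distrib power2_eq_square)
    finally show "\<bar>p x - q x\<bar> \<le> w x" .
  qed (auto intro!: int w_int A)
  also have "(\<integral>x. w x \<partial>M) = 1 / (2 * \<kappa>) * (\<integral>x. p x * L x \<partial>M) + \<kappa> * 2"
    unfolding w_def by (simp add: int pq)
  also have "\<dots> \<le> 1 / (2 * \<kappa>) * \<kappa>\<^sup>2 + \<kappa> * 2" using \<kappa> by (intro add_mono mult_left_mono) auto
  also have "\<dots> = 5 / 2 * \<kappa>" using \<kappa> by (simp add: power2_eq_square)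
  finally show ?thesis .
qed

text \<open>Contraction by one half towards \<open>m\<close> costs a factor 2 per coordinate; this
  is the source of \<open>2 ^ d\<close> in the tail bound.\<close>

lemma nn_integral_PiM_halve:
  fixes m :: "'i \<Rightarrow> real"
  assumes "finite I" and "f \<in> borel_measurable (PiM I (\<lambda>_. lborel))"
  shows "(\<integral>\<^sup>+x. f (\<lambda>i\<in>I. (x i + m i) / 2) \<partial>PiM I (\<lambda>_. lborel)) = 2 ^ card I * (\<integral>\<^sup>+x. f x \<partial>PiM I (\<lambda>_. lborel))"
  using assms
proof (induction I arbitrary: f rule: finite_induct)
  case empty
  then show ?case by (simp add: PiM_empty nn_integral_count_space_finite restrict_def)
next
  case (insert i I)
  interpret product_sigma_finite "\<lambda>_. lborel :: real measure" ..
  note [measurable] = insert.prems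
  define F where "F = (\<lambda>y. \<integral>\<^sup>+x. f (x(i := y)) \<partial>PiM I (\<lambda>_. lborel))"
  have F [measurable]: "F \<in> borel_measurable borel"
  proof -
    interpret I: sigma_finite_measure "PiM I (\<lambda>_. lborel :: real measure)" by (rule sigma_finite[OF insert.hyps(1)])
    have "(\<lambda>(y, x). f (x(i := y))) \<in> borel_measurable (lborel \<Otimes>\<^sub>M PiM I (\<lambda>_. lborel))"
      by measurable
    from I.borel_measurable_nn_integral[OF this] show ?thesis by (simp add: F_def)
  qed
  have upd: "(\<lambda>j\<in>insert i I. ((x(i := y)) j + m j) / 2) = (\<lambda>j\<in>I. (x j + m j) / 2)(i := (y + m i) / 2)" for x y
    using insert.hyps(2) by (auto simp: fun_eq_iff)
  have meas: "(\<lambda>x. f (\<lambda>j\<in>insert i I. (x j + m j) / 2)) \<in> borel_measurable (PiM (insert i I) (\<lambda>_. lborel))"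
    by measurable
  have "(\<integral>\<^sup>+x. f (\<lambda>j\<in>insert i I. (x j + m j) / 2) \<partial>PiM (insert i I) (\<lambda>_. lborel))
     = (\<integral>\<^sup>+y. (\<integral>\<^sup>+x. f ((\<lambda>j\<in>I. (x j + m j) / 2)(i := (y + m i) / 2)) \<partial>PiM I (\<lambda>_. lborel)) \<partial>lborel)"
    unfolding product_nn_integral_insert_rev[OF insert.hyps meas] upd ..
  also have "\<dots> = (\<integral>\<^sup>+y. 2 ^ card I * F ((y + m i) / 2) \<partial>lborel)"
    unfolding F_def by (intro nn_integral_cong, subst insert.IH[symmetric]) auto
  also have "\<dots> = 2 ^ card I * (\<integral>\<^sup>+y. F ((y + m i) / 2) \<partial>lborel)"
    by (intro nn_integral_cmult) measurable
  also have "(\<integral>\<^sup>+y. F ((y + m i) / 2) \<partial>lborel) = 2 * (\<integral>\<^sup>+y. F y \<partial>lborel)"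
    by (subst nn_integral_real_affine[where c = 2 and t = "- m i"]) auto
  also have "(\<integral>\<^sup>+y. F y \<partial>lborel) = (\<integral>\<^sup>+x. f x \<partial>PiM (insert i I) (\<lambda>_. lborel))"
    unfolding F_def by (rule product_nn_integral_insert_rev[OF insert.hyps insert.prems, symmetric])
  finally show ?case using insert.hyps by (simp add: mult_ac)
qed

section \<open>The posterior for a flat prior\<close>

lemma measure_density_real:
  fixes f :: "'a \<Rightarrow> real"
  assumes f: "integrable M f" "\<And>x. f x \<ge> 0" and B: "B \<in> sets M"
  shows "measure (density M (\<lambda>x. ennreal (f x))) B = (\<integral>x. indicator B x * f x \<partial>M)"
proof -
  have "emeasure (density M (\<lambda>x. ennreal (f x))) B = (\<integral>\<^sup>+x. ennreal (f x) * indicator B x \<partial>M)"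
    using f B by (intro emeasure_density) auto
  also have "\<dots> = (\<integral>\<^sup>+x. ennreal (indicator B x * f x) \<partial>M)"
    by (intro nn_integral_cong) (auto simp: indicator_def)
  also have "\<dots> = ennreal (\<integral>x. indicator B x * f x \<partial>M)"
    using integrable_mult_indicator[OF B f(1)] f(2) by (intro nn_integral_eq_integral) auto
  finally have "measure (density M (\<lambda>x. ennreal (f x))) B = enn2real (ennreal (\<integral>x. indicator B x * f x \<partial>M))"
    by (simp add: measure_def)
  then show ?thesis using f(2) by (simp add: integral_nonneg_AE)
qed

text \<open>State 0 loses its special role here, because its increment is minus the sum of the other
  increments.\<close>

lemma fisher_sq_full:
  "fisher_sq d \<theta> (\<lambda>j. x j - y j) = (\<Sum>j\<le>d. (full d x j - full d y j)\<^sup>2 / full d \<theta> j)"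
proof -
  have "(\<Sum>j\<le>d. (full d x j - full d y j)\<^sup>2 / full d \<theta> j)
    = (full d x 0 - full d y 0)\<^sup>2 / full d \<theta> 0 + (\<Sum>j = 1..d. (full d x j - full d y j)\<^sup>2 / full d \<theta> j)"
    by (simp add: atMost_atLeast0 sum.atLeast_Suc_atMost)
  also have "(\<Sum>j = 1..d. (full d x j - full d y j)\<^sup>2 / full d \<theta> j) = (\<Sum>j = 1..d. (x j - y j)\<^sup>2 / full d \<theta> j)"
    by (intro sum.cong) (auto simp: full_def)
  also have "(full d x 0 - full d y 0)\<^sup>2 = (\<Sum>j = 1..d. x j - y j)\<^sup>2"
    by (simp add: full_def sum_subtractf power2_commute)
  finally show ?thesis by (simp add: fisher_sq_def)
qed

lemma fisher_sq_add_le: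
  assumes "\<theta> \<in> Theta d"
  shows "fisher_sq d \<theta> (\<lambda>j. x j - z j) \<le> 2 * fisher_sq d \<theta> (\<lambda>j. x j - y j) + 2 * fisher_sq d \<theta> (\<lambda>j. y j - z j)"
proof -
  have "fisher_sq d \<theta> (\<lambda>j. x j - z j)
     \<le> (\<Sum>j\<le>d. 2 * ((full d x j - full d y j)\<^sup>2 / full d \<theta> j) + 2 * ((full d y j - full d z j)\<^sup>2 / full d \<theta> j))"
    unfolding fisher_sq_full
  proof (rule sum_mono)
    fix j assume "j \<in> {..d}"
    then have pos: "full d \<theta> j > 0" using full_pos[OF assms] by simp
    have "(full d x j - full d z j)\<^sup>2 \<le> 2 * (full d x j - full d y j)\<^sup>2 + 2 * (full d y j - full d z j)\<^sup>2"
      using sum_squares_bound[of "full d x j - full d y j" "full d y j - full d z j"]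
      by (simp add: power2_eq_square algebra_simps)
    then have "(full d x j - full d z j)\<^sup>2 / full d \<theta> j
        \<le> (2 * (full d x j - full d y j)\<^sup>2 + 2 * (full d y j - full d z j)\<^sup>2) / full d \<theta> j"
      using pos by (intro divide_right_mono) auto
    then show "(full d x j - full d z j)\<^sup>2 / full d \<theta> j
        \<le> 2 * ((full d x j - full d y j)\<^sup>2 / full d \<theta> j) + 2 * ((full d y j - full d z j)\<^sup>2 / full d \<theta> j)"
      by (simp add: add_divide_distrib)
  qed
  then show ?thesis by (simp add: fisher_sq_full sum.distrib sum_distrib_left)
qed

lemma theta_min_le: "j \<le> d \<Longrightarrow> theta_min d \<theta> \<le> full d \<theta> j"
  by (auto simp: theta_min_def intro!: Min_le)

lemma theta_min_pos: "\<theta> \<in> Theta d \<Longrightarrow> theta_min d \<theta> > 0"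
  by (auto simp: theta_min_def full_pos)

lemma theta_min_le_1:
  assumes "\<theta> \<in> Theta d"
  shows "theta_min d \<theta> \<le> 1"
proof -
  have "theta_min d \<theta> \<le> full d \<theta> 0" by (rule theta_min_le) simp
  also have "\<dots> \<le> (\<Sum>j = 0..d. full d \<theta> j)"
    using full_pos[OF assms] by (intro member_le_sum) (auto simp: less_imp_le)
  finally show ?thesis by (simp add: sum_full)
qed

text \<open>A single summand is at most the whole chi-square distance, and
  \<open>theta_min d \<theta> \<le> full d \<theta> j\<close> turns the bound into a relative one
  that is uniform over the states.\<close>

lemma relative_error:
  assumes \<theta>: "\<theta> \<in> Theta d" and le: "fisher_sq d \<theta> (\<lambda>j. x j - \<theta> j) \<le> \<eta>\<^sup>2 * theta_min d \<theta>" and "\<eta> \<ge> 0" "j \<le> d"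
  shows "\<bar>full d x j - full d \<theta> j\<bar> \<le> \<eta> * full d \<theta> j"
proof -
  have pos: "full d \<theta> i > 0" if "i \<le> d" for i using full_pos[OF \<theta> that] .
  have "(full d x j - full d \<theta> j)\<^sup>2 / full d \<theta> j \<le> fisher_sq d \<theta> (\<lambda>j. x j - \<theta> j)"
    unfolding fisher_sq_full using pos \<open>j \<le> d\<close> by (intro member_le_sum) (auto simp: less_imp_le)
  also have "\<dots> \<le> \<eta>\<^sup>2 * full d \<theta> j"
    using theta_min_le[OF \<open>j \<le> d\<close>] by (intro order_trans[OF le] mult_left_mono) auto
  finally have "(full d x j - full d \<theta> j)\<^sup>2 \<le> \<eta>\<^sup>2 * full d \<theta> j * full d \<theta> j"
    using pos[OF \<open>j \<le> d\<close>] by (simp add: pos_divide_le_eq)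
  then have "(full d x j - full d \<theta> j)\<^sup>2 \<le> (\<eta> * full d \<theta> j)\<^sup>2"
    by (simp add: power2_eq_square mult_ac)
  then show ?thesis
    using pos[OF \<open>j \<le> d\<close>] \<open>\<eta> \<ge> 0\<close> by (simp add: abs_le_square_iff[symmetric] abs_mult)
qed

lemma mem_Theta_iff_full: "x \<in> Theta d \<longleftrightarrow> x \<in> Rd d \<and> (\<forall>j\<le>d. 0 < full d x j)"
proof
  assume x: "x \<in> Rd d \<and> (\<forall>j\<le>d. 0 < full d x j)"
  have "0 < x j" if "j \<in> {1..d}" for j
    using x[THEN conjunct2, rule_format, of j] that by (auto simp: full_def)
  moreover have "(\<Sum>j = 1..d. x j) < 1"
    using x[THEN conjunct2, rule_format, of 0] by (auto simp: full_def)
  ultimately show "x \<in> Theta d" using x by (auto simp: Theta_def)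
qed (auto simp: full_pos Theta_def)

lemma full_midpoint:
  "j \<le> d \<Longrightarrow> full d (\<lambda>i\<in>{1..d}. (x i + y i) / 2) j = (full d x j + full d y j) / 2"
  by (auto simp: full_def sum.distrib add_divide_distrib diff_divide_distrib simp flip: sum_divide_distrib)

lemma midpoint_Theta:
  assumes "x \<in> Theta d" "y \<in> Theta d"
  shows "(\<lambda>i\<in>{1..d}. (x i + y i) / 2) \<in> Theta d"
proof -
  have "(\<lambda>i\<in>{1..d}. (x i + y i) / 2) \<in> Rd d" by auto
  moreover have "0 < full d (\<lambda>i\<in>{1..d}. (x i + y i) / 2) j" if "j \<le> d" for j
    unfolding full_midpoint[OF that] using full_pos[OF assms(1) that] full_pos[OF assms(2) that] by simp
  ultimately show ?thesis unfolding mem_Theta_iff_full by blast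
qed

text \<open>Uniform concavity of the log-likelihood, from \<open>x y = z\<^sup>2 (1 - (x - y)\<^sup>2 / (4 z\<^sup>2))\<close> for the
  midpoint \<open>z\<close>.\<close>
lemma dir_density_midpoint:
  assumes x: "x \<in> Theta d" and y: "y \<in> Theta d" and z: "z = (\<lambda>i\<in>{1..d}. (x i + y i) / 2)"
  shows "dir_density d N x * dir_density d N y
    \<le> (dir_density d N z)\<^sup>2 * exp (- (\<Sum>j\<le>d. real (N j) * ((full d x j - full d y j)\<^sup>2 / (4 * (full d z j)\<^sup>2))))"
proof -
  define c :: real where "c = fact ((\<Sum>j\<le>d. N j) + d) / (\<Prod>j\<le>d. fact (N j))"
  define u where "u j = (full d x j - full d y j)\<^sup>2 / (4 * (full d z j)\<^sup>2)" for j
  have zT: "z \<in> Theta d" unfolding z by (rule midpoint_Theta[OF x y])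
  have fz: "full d z j = (full d x j + full d y j) / 2" if "j \<le> d" for j
    unfolding z by (rule full_midpoint[OF that])
  have dens: "dir_density d N v = c * (\<Prod>j\<le>d. full d v j ^ N j)" if "v \<in> Theta d" for v
    using that by (simp add: dir_density_def dir_weight_def c_def)
  have factor: "full d x j ^ N j * full d y j ^ N j \<le> (full d z j ^ N j)\<^sup>2 * exp (- (real (N j) * u j))"
    if j: "j \<le> d" for j
  proof -
    have pos: "full d x j > 0" "full d y j > 0" "full d z j > 0"
      using full_pos[OF x j] full_pos[OF y j] full_pos[OF zT j] by auto
    have "(full d z j)\<^sup>2 * (1 - u j) = (full d z j)\<^sup>2 - (full d x j - full d y j)\<^sup>2 / 4"
      using pos by (simp add: u_def right_diff_distrib)
    also have "\<dots> = full d x j * full d y j"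
      unfolding fz[OF j] by (simp add: field_simps power2_eq_square)
    finally have "full d x j * full d y j = (full d z j)\<^sup>2 * (1 - u j)" by simp
    also have "\<dots> \<le> (full d z j)\<^sup>2 * exp (- u j)"
      using exp_ge_add_one_self[of "- u j"] by (intro mult_left_mono) auto
    finally have "(full d x j * full d y j) ^ N j \<le> ((full d z j)\<^sup>2 * exp (- u j)) ^ N j"
      using pos by (intro power_mono) auto
    then show ?thesis
      by (simp add: power_mult_distrib exp_of_nat_mult[symmetric] mult.commute flip: power_mult)
  qed
  have "dir_density d N x * dir_density d N y = c\<^sup>2 * (\<Prod>j\<le>d. full d x j ^ N j * full d y j ^ N j)"
    by (simp add: dens x y prod.distrib power2_eq_square)
  also have "\<dots> \<le> c\<^sup>2 * (\<Prod>j\<le>d. (full d z j ^ N j)\<^sup>2 * exp (- (real (N j) * u j)))"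
    using full_pos[OF x] full_pos[OF y]
    by (intro mult_left_mono prod_mono conjI factor) (auto simp: less_imp_le)
  also have "\<dots> = (dir_density d N z)\<^sup>2 * exp (- (\<Sum>j\<le>d. real (N j) * u j))"
    by (simp add: dens zT prod.distrib power_mult_distrib exp_sum flip: sum_negf prod_power_distrib)
  finally show ?thesis by (simp add: u_def)
qed

section \<open>Relative entropy and the maximum likelihood estimate\<close>

definition entropy_gap :: "real \<Rightarrow> real" where
  "entropy_gap y = y - 1 - ln y"

lemma entropy_gap_nonneg: "y > 0 \<Longrightarrow> entropy_gap y \<ge> 0"
  using ln_le_minus_one[of y] by (simp add: entropy_gap_def)

lemma entropy_gap_eq_0: "y > 0 \<Longrightarrow> entropy_gap y = 0 \<Longrightarrow> y = 1"
  using ln_eq_minus_one[of y] by (simp add: entropy_gap_def)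

text \<open>The difference has derivative \<open>x^3 / (1 + x)\<close>, whose sign is that of
  \<open>x\<close>, so its minimum is at 0. The bound therefore holds on the whole half-line and not
  only for small \<open>t\<close>, which makes the later bound on the log density ratio
  global.\<close>

lemma ln_add_one_le_cubic:
  assumes "t > -1"
  shows "ln (1 + t) \<le> t - t\<^sup>2 / 2 + t ^ 3 / (3 :: real)"
proof -
  define f where "f t = t - t\<^sup>2 / 2 + t ^ 3 / 3 - ln (1 + t)" for t :: real
  have der: "(f has_real_derivative (x ^ 3 / (1 + x))) (at x)" if "x > -1" for x
    unfolding f_def using that
    by (auto intro!: derivative_eq_intros simp: field_simps power2_eq_square power3_eq_cube)
  have "f 0 \<le> f t"
  proof (cases "t \<ge> 0")
    case True
    show ?thesis
    proof (rule DERIV_nonneg_imp_nondecreasing[OF True])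
      fix x assume "0 \<le> x" "x \<le> t"
      then show "\<exists>y. (f has_real_derivative y) (at x) \<and> 0 \<le> y" using der[of x] by (intro exI[of _ "x ^ 3 / (1 + x)"]) auto
    qed
  next
    case False
    show ?thesis
    proof (rule DERIV_nonpos_imp_nonincreasing[of t 0])
      fix x assume "t \<le> x" "x \<le> 0"
      then show "\<exists>y. (f has_real_derivative y) (at x) \<and> y \<le> 0"
        using der[of x] assms by (intro exI[of _ "x ^ 3 / (1 + x)"]) (auto simp: divide_nonpos_pos power3_eq_cube mult_nonneg_nonpos)
    qed (use False in auto)
  qed
  then show ?thesis by (simp add: f_def)
qed

text \<open>For \<open>y \<ge> 2\<close> the gap is at least \<open>1 - ln 2\<close>, which exceeds
  \<open>1 / 6\<close>; this follows from the tangent of the logarithm at 2. So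
  \<open>t = y - 1\<close> is below 1, and \<open>t^2 * (1 / 2 - t / 3)\<close> is at least
  \<open>t^2 / 6\<close>.\<close>

lemma entropy_gap_quadratic:
  assumes "y > 0" "entropy_gap y < 1 / 6"
  shows "(y - 1)\<^sup>2 / 6 \<le> entropy_gap y"
proof -
  have "y < 2"
  proof (rule ccontr)
    assume "\<not> y < 2"
    have "ln (y / 2) \<le> y / 2 - 1" using assms by (intro ln_le_minus_one) auto
    then have "ln y \<le> y / 2 - 1 + ln 2" using assms by (simp add: ln_div)
    then have "entropy_gap y \<ge> 1 - ln 2" using \<open>\<not> y < 2\<close> by (simp add: entropy_gap_def)
    then show False using assms(2) ln2_le_25_over_36 by simp
  qed
  define t where "t = y - 1"
  have t: "t > -1" "t < 1" using assms \<open>y < 2\<close> by (auto simp: t_def)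
  have "entropy_gap y = t - ln (1 + t)" by (simp add: entropy_gap_def t_def)
  also have "\<dots> \<ge> t\<^sup>2 / 2 - t ^ 3 / 3" using ln_add_one_le_cubic[OF t(1)] by simp
  also have "t\<^sup>2 / 2 - t ^ 3 / 3 = t\<^sup>2 * (1 / 2 - t / 3)"
    by (simp add: power2_eq_square power3_eq_cube algebra_simps)
  also have "\<dots> \<ge> t\<^sup>2 * (1 / 6)" using t by (intro mult_left_mono) auto
  finally show ?thesis by (simp add: t_def)
qed

text \<open>Every state is observed; with a zero count the infimum of \<open>nll\<close> would not
  be attained in the open simplex.\<close>

locale counts =
  fixes d n :: nat and \<theta>s :: "nat \<Rightarrow> real" and N :: "nat \<Rightarrow> nat"
  assumes d: "1 \<le> d" and n: "1 \<le> n" and \<theta>s: "\<theta>s \<in> Theta d" and N: "N \<in> comps d n"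
    and Npos: "\<And>j. j \<le> d \<Longrightarrow> 1 \<le> N j"
begin

lemma sum_N: "(\<Sum>j\<le>d. N j) = n"
  using N by (simp add: comps_def)

definition mle :: "nat \<Rightarrow> real" where
  "mle = (\<lambda>j\<in>{1..d}. real (N j) / real n)"

lemma full_mle: "j \<le> d \<Longrightarrow> full d mle j = real (N j) / real n"
proof -
  have "real n = real (N 0) + (\<Sum>j = 1..d. real (N j))"
    unfolding sum_N[symmetric] by (simp add: atMost_atLeast0 sum.atLeast_Suc_atMost)
  then have "full d mle 0 = real (N 0) / real n"
    using n by (simp add: full_def mle_def field_simps flip: sum_divide_distrib)
  then show "j \<le> d \<Longrightarrow> full d mle j = real (N j) / real n"
    by (cases "j = 0") (auto simp: full_def mle_def)
qed

lemma mle_Theta: "mle \<in> Theta d"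
  unfolding mem_Theta_iff_full using Npos n full_mle by (force simp: mle_def)

text \<open>\<open>n\<close> times the Kullback-Leibler divergence of \<open>x\<close> from the maximum likelihood estimate.\<close>
definition V :: "(nat \<Rightarrow> real) \<Rightarrow> real" where
  "V x = (\<Sum>j\<le>d. real (N j) * entropy_gap (full d x j / full d mle j))"

lemma V_term_nonneg:
  assumes "x \<in> Theta d" "j \<le> d"
  shows "0 \<le> real (N j) * entropy_gap (full d x j / full d mle j)"
  using full_pos[OF assms] full_pos[OF mle_Theta assms(2)] by (auto intro!: mult_nonneg_nonneg entropy_gap_nonneg)

lemma V_nonneg: "x \<in> Theta d \<Longrightarrow> 0 \<le> V x"
  unfolding V_def by (intro sum_nonneg V_term_nonneg) auto

text \<open>Adding \<open>n * full d x j - N j\<close> to each summand leaves the sum unchanged, as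
  both parts have total \<open>n\<close>, and turns the summand into a nonnegative entropy
  gap.\<close>

lemma V_eq:
  assumes x: "x \<in> Theta d"
  shows "V x = (\<Sum>j\<le>d. real (N j) * ln (full d mle j)) - (\<Sum>j\<le>d. real (N j) * ln (full d x j))"
proof -
  have "V x = (\<Sum>j\<le>d. (real n * full d x j - real (N j)) + (real (N j) * ln (full d mle j) - real (N j) * ln (full d x j)))"
    unfolding V_def
  proof (rule sum.cong)
    fix j assume "j \<in> {..d}"
    then have j: "j \<le> d" by simp
    have e: "real (N j) = real n * full d mle j" using full_mle[OF j] n by simp
    show "real (N j) * entropy_gap (full d x j / full d mle j)
      = (real n * full d x j - real (N j)) + (real (N j) * ln (full d mle j) - real (N j) * ln (full d x j))"
      unfolding entropy_gap_def e using full_pos[OF x j] full_pos[OF mle_Theta j]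
      by (simp add: ln_div algebra_simps)
  qed simp
  also have "\<dots> = (real n * (\<Sum>j\<le>d. full d x j) - real (\<Sum>j\<le>d. N j))
     + ((\<Sum>j\<le>d. real (N j) * ln (full d mle j)) - (\<Sum>j\<le>d. real (N j) * ln (full d x j)))"
    by (simp add: sum.distrib sum_subtractf sum_distrib_left)
  also have "(\<Sum>j\<le>d. full d x j) = 1" using sum_full[of d x] by (simp add: atLeast0AtMost)
  finally show ?thesis by (simp add: sum_N)
qed

lemma nll_eq:
  assumes "x \<in> Theta d"
  shows "real n * nll n d N x = - (\<Sum>j\<le>d. real (N j) * ln (full d x j))"
  using n by (simp add: nll_def atLeast0AtMost sum_distrib_left)

text \<open>\<open>n * nll\<close> exceeds its value at \<open>mle\<close> by exactly
  \<open>V\<close>. As all counts are positive, \<open>V\<close> vanishes only where every ratio to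
  \<open>mle\<close> is 1.\<close>

lemma is_MLE_iff: "is_MLE n d N t \<longleftrightarrow> t = mle"
proof -
  have nV: "real n * nll n d N x = real n * nll n d N mle + V x" if "x \<in> Theta d" for x
    using V_eq[OF that] nll_eq[OF that] nll_eq[OF mle_Theta] by simp
  have le_iff: "nll n d N x \<le> nll n d N y \<longleftrightarrow> V x \<le> V y" if "x \<in> Theta d" "y \<in> Theta d" for x y
  proof -
    have "nll n d N x \<le> nll n d N y \<longleftrightarrow> real n * nll n d N x \<le> real n * nll n d N y" using n by simp
    then show ?thesis using nV that by simp
  qed
  have V0: "V mle = 0"
    unfolding V_def
  proof (rule sum.neutral, rule ballI)
    fix j assume "j \<in> {..d}"
    then have "full d mle j \<noteq> 0" using full_pos[OF mle_Theta, of j] by simp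
    then show "real (N j) * entropy_gap (full d mle j / full d mle j) = 0" by (simp add: entropy_gap_def)
  qed
  show ?thesis
  proof
    assume t: "is_MLE n d N t"
    then have tT: "t \<in> Theta d" by (simp add: is_MLE_def)
    have "V t \<le> V mle" using t mle_Theta le_iff[OF tT mle_Theta] by (simp add: is_MLE_def)
    then have "V t = 0" using V_nonneg[OF tT] V0 by simp
    then have zero: "\<forall>j\<in>{..d}. real (N j) * entropy_gap (full d t j / full d mle j) = 0"
      unfolding V_def by (subst (asm) sum_nonneg_eq_0_iff) (auto intro: V_term_nonneg[OF tT])
    have "full d t j = full d mle j" if "j \<le> d" for j
    proof -
      have "entropy_gap (full d t j / full d mle j) = 0"
        using zero that Npos[OF that] by (metis atMost_iff mult_eq_0_iff of_nat_eq_0_iff not_one_le_zero)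
      then show ?thesis
        using full_pos[OF tT that] full_pos[OF mle_Theta that]
          entropy_gap_eq_0[of "full d t j / full d mle j"] by simp
    qed
    then have "t j = mle j" if "j \<in> {1..d}" for j
      using that by (force simp: full_def)
    moreover have "t \<in> Rd d" "mle \<in> Rd d" using tT mle_Theta by (auto simp: Theta_def)
    ultimately show "t = mle" by (intro PiE_ext) auto
  next
    assume "t = mle"
    then show "is_MLE n d N t"
      using mle_Theta le_iff[OF mle_Theta] V0 V_nonneg by (simp add: is_MLE_def)
  qed
qed

lemma MLE_eq: "MLE n d N = mle"
  unfolding MLE_def is_MLE_iff by simp

abbreviation p :: "(nat \<Rightarrow> real) \<Rightarrow> real" where
  "p \<equiv> dir_density d N"

lemma p_eq_V:
  assumes x: "x \<in> Theta d"
  shows "p x = p mle * exp (- V x)"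
proof -
  have prod_exp: "(\<Prod>j\<le>d. full d y j ^ N j) = exp (\<Sum>j\<le>d. real (N j) * ln (full d y j))" if "y \<in> Theta d" for y
    using full_pos[OF that] by (simp add: exp_sum exp_of_nat_mult)
  show ?thesis
    using x mle_Theta
    by (simp add: dir_density_def dir_weight_def prod_exp V_eq mult_exp_exp)
qed

lemma p_pos: "x \<in> Theta d \<Longrightarrow> p x > 0"
  using full_pos[of x d] by (auto simp: dir_density_def dir_weight_def intro!: mult_pos_pos divide_pos_pos prod_pos)

lemma p_outside: "x \<notin> Theta d \<Longrightarrow> p x = 0"
  by (simp add: dir_density_def dir_weight_def)

text \<open>Concavity between \<open>x\<close> and \<open>mle\<close>, with the curvature factor
  dropped, bounds \<open>sqrt (p x * p mle)\<close> by the value of \<open>p\<close> at the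
  midpoint, and \<open>p x\<close> is \<open>exp (- V x / 2)\<close> times that root. Half of the
  exponent is the gain; the other half becomes a density of known mass, so that \<open>p mle\<close>
  never has to be estimated.\<close>

lemma p_tail_pointwise:
  assumes x: "x \<in> Theta d" and V: "t \<le> V x"
  shows "p x \<le> exp (- t / 2) * p (\<lambda>i\<in>{1..d}. (x i + mle i) / 2)"
proof -
  let ?z = "\<lambda>i\<in>{1..d}. (x i + mle i) / 2"
  define c where "c = p mle"
  have c: "c > 0" unfolding c_def by (rule p_pos[OF mle_Theta])
  have "p x * p mle \<le> (p ?z)\<^sup>2 * exp (- (\<Sum>j\<le>d. real (N j) * ((full d x j - full d mle j)\<^sup>2 / (4 * (full d ?z j)\<^sup>2))))"
    by (rule dir_density_midpoint[OF x mle_Theta refl])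
  also have "\<dots> \<le> (p ?z)\<^sup>2 * 1"
    by (intro mult_left_mono) (auto intro!: sum_nonneg)
  finally have "c * exp (- V x) * c \<le> (p ?z)\<^sup>2" using p_eq_V[OF x] by (simp add: c_def)
  moreover have "(c * exp (- V x / 2))\<^sup>2 = c * exp (- V x) * c"
    by (simp add: power_mult_distrib power2_eq_square mult_exp_exp)
  ultimately have "c * exp (- V x / 2) \<le> p ?z"
    using dir_density_nonneg by (metis power2_le_imp_le)
  moreover have "p x = exp (- V x / 2) * (c * exp (- V x / 2))"
    using p_eq_V[OF x] by (simp add: c_def mult.left_commute mult_exp_exp)
  ultimately have "p x \<le> exp (- V x / 2) * p ?z" by (simp add: mult_left_mono)
  also have "\<dots> \<le> exp (- t / 2) * p ?z"
    using V by (intro mult_right_mono dir_density_nonneg) auto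
  finally show ?thesis .
qed

lemma integrable_p: "integrable (lborel_d d) p" and integral_p: "(\<integral>x. p x \<partial>lborel_d d) = 1"
  using dir_density_integral[of d N] by (auto simp: has_bochner_integral_iff)

text \<open>The midpoint map contracts towards \<open>mle\<close> by one half, so the pointwise
  bound integrates to \<open>2 ^ d\<close> times the total mass 1 of \<open>p\<close>.\<close>

lemma p_tail:
  assumes A: "A \<in> sets (lborel_d d)" and V: "\<And>x. x \<in> A \<Longrightarrow> x \<in> Theta d \<Longrightarrow> t \<le> V x"
  shows "(\<integral>x. indicator A x * p x \<partial>lborel_d d) \<le> 2 ^ d * exp (- t / 2)"
proof -
  have nn_p: "(\<integral>\<^sup>+x. ennreal (p x) \<partial>lborel_d d) = 1"
    using nn_integral_eq_integral[OF integrable_p] dir_density_nonneg integral_p by simp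
  have "ennreal (\<integral>x. indicator A x * p x \<partial>lborel_d d) = (\<integral>\<^sup>+x. ennreal (indicator A x * p x) \<partial>lborel_d d)"
    using integrable_mult_indicator[OF A integrable_p] dir_density_nonneg
    by (intro nn_integral_eq_integral[symmetric]) auto
  also have "\<dots> \<le> (\<integral>\<^sup>+x. ennreal (exp (- t / 2)) * ennreal (p (\<lambda>i\<in>{1..d}. (x i + mle i) / 2)) \<partial>lborel_d d)"
  proof (rule nn_integral_mono)
    fix x
    show "ennreal (indicator A x * p x) \<le> ennreal (exp (- t / 2)) * ennreal (p (\<lambda>i\<in>{1..d}. (x i + mle i) / 2))"
    proof (cases "x \<in> A \<and> x \<in> Theta d")
      case True
      then have "indicator A x * p x \<le> exp (- t / 2) * p (\<lambda>i\<in>{1..d}. (x i + mle i) / 2)"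
        using p_tail_pointwise[of x t] V[of x] by simp
      then show ?thesis by (simp add: ennreal_mult'[symmetric] ennreal_leI)
    next
      case False
      then have "indicator A x * p x = 0" by (auto simp: p_outside indicator_def)
      then show ?thesis by (simp only: ennreal_0 zero_le)
    qed
  qed
  also have "\<dots> = ennreal (exp (- t / 2)) * (\<integral>\<^sup>+x. ennreal (p (\<lambda>i\<in>{1..d}. (x i + mle i) / 2)) \<partial>lborel_d d)"
  proof (rule nn_integral_cmult)
    have "(\<lambda>x. \<lambda>i\<in>{1..d}. (x i + mle i) / 2) \<in> measurable (lborel_d d) (lborel_d d)"
      by measurable
    from measurable_compose[OF this dir_density_measurable]
    show "(\<lambda>x. ennreal (p (\<lambda>i\<in>{1..d}. (x i + mle i) / 2))) \<in> borel_measurable (lborel_d d)" by simp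
  qed
  also have "(\<integral>\<^sup>+x. ennreal (p (\<lambda>i\<in>{1..d}. (x i + mle i) / 2)) \<partial>lborel_d d)
     = 2 ^ card {1..d} * (\<integral>\<^sup>+x. ennreal (p x) \<partial>lborel_d d)"
    by (rule nn_integral_PiM_halve[OF _ measurable_compose[OF dir_density_measurable measurable_ennreal]]) simp
  also have "ennreal (exp (- t / 2)) * (2 ^ card {1..d} * (\<integral>\<^sup>+x. ennreal (p x) \<partial>lborel_d d)) = ennreal (2 ^ d * exp (- t / 2))"
    unfolding nn_p by (simp add: ennreal_mult' ennreal_power[symmetric] mult.commute)
  finally show ?thesis by (subst (asm) ennreal_le_iff) auto
qed

end

section \<open>The divergence of the Dirichlet from the Gaussian distribution\<close>

text \<open>With \<open>e = d + 1\<close> the number \<open>M\<close> is the total Dirichlet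
  parameter, and \<open>r1\<close>, \<open>r2\<close>, \<open>r3\<close> are the factors of the
  first three moments common to all states. Their alternating sums occur in the moments about 1; the
  leading terms cancel there, and over a common denominator the cancellation is exact.\<close>

lemma dir_ratio_bounds:
  fixes n e :: real
  assumes n: "n \<ge> 1" and e: "e \<ge> 1"
  defines "M \<equiv> n + e"
  defines "r1 \<equiv> n / M" and "r2 \<equiv> n\<^sup>2 / (M * (M + 1))" and "r3 \<equiv> n ^ 3 / (M * (M + 1) * (M + 2))"
  shows "0 \<le> r3" "r3 \<le> r2" "r2 \<le> r1" "r1 \<le> 1" "1 - r1 \<le> e / n" "1 - r2 \<le> 3 * e / n"
    "r2 - 2 * r1 + 1 = (e\<^sup>2 + e) / (M * (M + 1)) - r2 / n"
    "(e\<^sup>2 + e) / (M * (M + 1)) \<le> 2 * e\<^sup>2 / n\<^sup>2"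
    "r3 - 3 * r2 + 3 * r1 - 1 \<le> 7 * e / n\<^sup>2"
proof -
  have M: "M \<ge> n" "M \<ge> 2" "M > 0" using n e by (auto simp: M_def)
  show "0 \<le> r3" using n M by (simp add: r3_def)
  have "r3 = r2 * (n / (M + 2))" by (simp add: r3_def r2_def power2_eq_square power3_eq_cube)
  also have "\<dots> \<le> r2 * 1" using n M by (intro mult_left_mono) (auto simp: r2_def)
  finally show "r3 \<le> r2" by simp
  have "r2 = r1 * (n / (M + 1))" by (simp add: r1_def r2_def power2_eq_square)
  also have "\<dots> \<le> r1 * 1" using n M by (intro mult_left_mono) (auto simp: r1_def)
  finally show "r2 \<le> r1" by simp
  show "r1 \<le> 1" using M by (simp add: r1_def)
  have "1 - r1 = e / M" using M by (simp add: r1_def M_def field_simps)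
  also have "\<dots> \<le> e / n" using M n e by (intro divide_left_mono) auto
  finally show "1 - r1 \<le> e / n" .
  have MM: "n\<^sup>2 \<le> M * (M + 1)" using M n by (simp add: power2_eq_square mult_mono)
  have "1 - r2 = (M * (M + 1) - n\<^sup>2) / (M * (M + 1))"
    using M by (simp add: r2_def diff_divide_distrib)
  also have "\<dots> \<le> (3 * e * (M + 1)) / (M * (M + 1))"
  proof (rule divide_right_mono)
    have "n * 1 \<le> n * e" using n e by (intro mult_left_mono) auto
    moreover have "3 * e * (M + 1) - (M * (M + 1) - n\<^sup>2) = (n * e - n * 1) + 2 * e\<^sup>2 + 2 * e"
      by (simp add: M_def power2_eq_square algebra_simps)
    moreover have "e\<^sup>2 \<ge> 0" by simp
    ultimately show "M * (M + 1) - n\<^sup>2 \<le> 3 * e * (M + 1)" using e by linarith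
  qed (use M in auto)
  also have "\<dots> = 3 * e / M" using M by simp
  also have "\<dots> \<le> 3 * e / n" using M n e by (intro divide_left_mono) auto
  finally show "1 - r2 \<le> 3 * e / n" .
  show "r2 - 2 * r1 + 1 = (e\<^sup>2 + e) / (M * (M + 1)) - r2 / n"
  proof -
    have "r2 / n = n / (M * (M + 1))" using n by (simp add: r2_def power2_eq_square)
    moreover have "r1 = n * (M + 1) / (M * (M + 1))" using M by (simp add: r1_def)
    moreover have "1 = M * (M + 1) / (M * (M + 1))" using M by simp
    ultimately have "r2 - 2 * r1 + 1 - ((e\<^sup>2 + e) / (M * (M + 1)) - r2 / n)
      = (n\<^sup>2 - 2 * (n * (M + 1)) + M * (M + 1) - (e\<^sup>2 + e) + n) / (M * (M + 1))"
      unfolding r2_def by (simp only: add_divide_distrib diff_divide_distrib times_divide_eq_right)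
    also have "n\<^sup>2 - 2 * (n * (M + 1)) + M * (M + 1) - (e\<^sup>2 + e) + n = 0"
      by (simp add: M_def power2_eq_square algebra_simps)
    finally show ?thesis by simp
  qed
  have "(e\<^sup>2 + e) / (M * (M + 1)) \<le> (2 * e\<^sup>2) / n\<^sup>2"
    using MM n e by (intro frac_le) (auto simp: power2_eq_square)
  then show "(e\<^sup>2 + e) / (M * (M + 1)) \<le> 2 * e\<^sup>2 / n\<^sup>2" .
  show "r3 - 3 * r2 + 3 * r1 - 1 \<le> 7 * e / n\<^sup>2"
  proof -
    define P where "P = M * (M + 1) * (M + 2)"
    have P: "P > 0" using M by (simp add: P_def)
    have "r2 = n\<^sup>2 * (M + 2) / P" "r1 = n * ((M + 1) * (M + 2)) / P" "1 = P / P" "r3 = n ^ 3 / P"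
      using M by (simp_all add: r1_def r2_def r3_def P_def)
    then have "r3 - 3 * r2 + 3 * r1 - 1 = (n ^ 3 - 3 * (n\<^sup>2 * (M + 2)) + 3 * (n * ((M + 1) * (M + 2))) - P) / P"
      by (simp only: add_divide_distrib diff_divide_distrib times_divide_eq_right)
    also have "n ^ 3 - 3 * (n\<^sup>2 * (M + 2)) + 3 * (n * ((M + 1) * (M + 2))) - P
        = 3 * n * e + 4 * n - e ^ 3 - 3 * e\<^sup>2 - 2 * e"
      by (simp add: P_def M_def power2_eq_square power3_eq_cube algebra_simps)
    also have "\<dots> / P \<le> (7 * e * n) / P"
    proof (rule divide_right_mono)
      have "n * 1 \<le> n * e" using n e by (intro mult_left_mono) auto
      moreover have "7 * e * n - (3 * n * e + 4 * n - e ^ 3 - 3 * e\<^sup>2 - 2 * e)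
          = 4 * (n * e - n * 1) + e ^ 3 + 3 * e\<^sup>2 + 2 * e"
        by (simp add: algebra_simps)
      moreover have "e ^ 3 \<ge> 0" "e\<^sup>2 \<ge> 0" using e by auto
      ultimately have "0 \<le> 7 * e * n - (3 * n * e + 4 * n - e ^ 3 - 3 * e\<^sup>2 - 2 * e)"
        using e by (simp only:) (intro add_nonneg_nonneg; simp)
      then show "3 * n * e + 4 * n - e ^ 3 - 3 * e\<^sup>2 - 2 * e \<le> 7 * e * n" by simp
    qed (use P in simp)
    also have "\<dots> \<le> (7 * e * n) / (n\<^sup>2 * n)"
    proof (rule divide_left_mono)
      have "n\<^sup>2 * n \<le> M * (M + 1) * (M + 2)" using MM M n by (intro mult_mono) auto
      then show "n\<^sup>2 * n \<le> P" by (simp add: P_def)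
    qed (use n e P in auto)
    also have "\<dots> = 7 * e / n\<^sup>2" using n by simp
    finally show ?thesis .
  qed
qed

text \<open>With \<open>a = N j\<close> the numbers \<open>m1\<close>, \<open>m2\<close>,
  \<open>m3\<close> are the moments of \<open>full d x j / full d mle j\<close> under the Dirichlet
  law, so the two combinations are its second and third moment about 1. Summed over the states,
  \<open>B\<close> is of order \<open>d^2 / (n * theta_min)\<close>. The third moment is bounded
  from above only because it enters the divergence with a positive weight.\<close>

lemma dir_centered_moments:
  fixes a n e :: real
  assumes a: "a \<ge> 1" and n: "n \<ge> 1" and e: "e \<ge> 1"
  defines "M \<equiv> n + e"
  defines "m1 \<equiv> n / a * ((a + 1) / M)" and "m2 \<equiv> (n / a)\<^sup>2 * ((a + 1) * (a + 2) / (M * (M + 1)))"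
    and "m3 \<equiv> (n / a) ^ 3 * ((a + 1) * (a + 2) * (a + 3) / (M * (M + 1) * (M + 2)))"
    and "B \<equiv> 7 * a * e\<^sup>2 / n\<^sup>2 + 27 * e / n + 17 / a"
  shows "\<bar>a * (m2 - 2 * m1 + 1) - (1 - a / n)\<bar> \<le> B" and "a * (m3 - 3 * m2 + 3 * m1 - 1) \<le> B"
proof -
  define r1 r2 r3 where "r1 = n / M" and "r2 = n\<^sup>2 / (M * (M + 1))" and "r3 = n ^ 3 / (M * (M + 1) * (M + 2))"
  note R = dir_ratio_bounds[OF n e, folded M_def, folded r1_def r2_def r3_def]
  have M: "M > 0" using n e by (simp add: M_def)
  \<comment> \<open>With \<open>1 / a\<close> an atom subject to \<open>a * i = 1\<close>, the
    expansions in \<open>1 / a\<close> become polynomial identities.\<close>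
  define i where "i = 1 / a"
  have ai: "a * i = 1" using a by (simp add: i_def)
  have shift: "(a + c) / a = 1 + c * i" for c using a by (simp add: i_def add_divide_distrib)
  have m1: "m1 = r1 * (1 + i)"
  proof -
    have "m1 = r1 * ((a + 1) / a)" by (simp add: m1_def r1_def)
    then show ?thesis unfolding shift by simp
  qed
  have m2: "m2 = r2 * ((1 + i) * (1 + 2 * i))"
  proof -
    have "m2 = r2 * (((a + 1) / a) * ((a + 2) / a))" by (simp add: m2_def r2_def power2_eq_square)
    then show ?thesis unfolding shift by simp
  qed
  have m3: "m3 = r3 * ((1 + i) * (1 + 2 * i) * (1 + 3 * i))"
  proof -
    have "m3 = r3 * (((a + 1) / a) * ((a + 2) / a) * ((a + 3) / a))" by (simp add: m3_def r3_def power3_eq_cube)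
    then show ?thesis unfolding shift by simp
  qed
  have inv: "0 < 1 / a" "1 / a \<le> 1" "1 / a\<^sup>2 \<le> 1 / a" using a by (auto simp: power2_eq_square field_simps)
  define q where "q = (e\<^sup>2 + e) / (M * (M + 1))"
  have q: "0 \<le> q" "q \<le> 2 * e\<^sup>2 / n\<^sup>2" using R(8) M e by (auto simp: q_def)
  have "a * (m2 - 2 * m1 + 1) - (1 - a / n)
    = a * (r2 - 2 * r1 + 1) + a / n + ((a * i) * (3 * r2 - 2 * r1) - 1) + (a * i) * i * 2 * r2"
    unfolding m1 m2 by (simp add: algebra_simps)
  then have "a * (m2 - 2 * m1 + 1) - (1 - a / n) = a * (r2 - 2 * r1 + 1) + a / n + (3 * r2 - 2 * r1 - 1) + 2 * r2 / a"
    unfolding ai by (simp add: i_def)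
  also have "a * (r2 - 2 * r1 + 1) + a / n = a * q + a * ((1 - r2) / n)"
    unfolding R(7) q_def[symmetric] by (simp add: algebra_simps diff_divide_distrib)
  finally have e1: "a * (m2 - 2 * m1 + 1) - (1 - a / n) = a * q + a * ((1 - r2) / n) + (3 * r2 - 2 * r1 - 1) + 2 * r2 / a" .
  have q_le: "0 \<le> a * q" "a * q \<le> 2 * (a * e\<^sup>2 / n\<^sup>2)"
  proof -
    have "a * q \<le> a * (2 * e\<^sup>2 / n\<^sup>2)" using q a by (intro mult_left_mono) auto
    also have "a * (2 * e\<^sup>2 / n\<^sup>2) = 2 * (a * e\<^sup>2 / n\<^sup>2)" by simp
    finally show "a * q \<le> 2 * (a * e\<^sup>2 / n\<^sup>2)" .
    show "0 \<le> a * q" using q a by simp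
  qed
  have s_le: "0 \<le> a * ((1 - r2) / n)" "a * ((1 - r2) / n) \<le> 3 * (a * e\<^sup>2 / n\<^sup>2)"
  proof -
    show "0 \<le> a * ((1 - r2) / n)" using R a n by auto
    have "(1 - r2) / n \<le> 3 * e / n / n" using R(6) n by (intro divide_right_mono) auto
    also have "\<dots> \<le> 3 * e\<^sup>2 / n\<^sup>2" using e n by (simp add: power2_eq_square divide_right_mono)
    finally have "a * ((1 - r2) / n) \<le> a * (3 * e\<^sup>2 / n\<^sup>2)" using a by (intro mult_left_mono) auto
    also have "a * (3 * e\<^sup>2 / n\<^sup>2) = 3 * (a * e\<^sup>2 / n\<^sup>2)" by simp
    finally show "a * ((1 - r2) / n) \<le> 3 * (a * e\<^sup>2 / n\<^sup>2)" .
  qed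
  have en: "0 < e / n" using e n by simp
  have r2a: "0 \<le> 2 * r2 / a" "2 * r2 / a \<le> 2 * (1 / a)"
    using R a by (auto intro!: divide_right_mono)
  have d12: "- 9 * (e / n) \<le> 3 * r2 - 2 * r1 - 1" "3 * r2 - 2 * r1 - 1 \<le> 2 * (e / n)"
    using R(3-6) by auto
  have nn: "0 \<le> a * e\<^sup>2 / n\<^sup>2" using a by simp
  have B: "B = 7 * (a * e\<^sup>2 / n\<^sup>2) + 27 * (e / n) + 17 * (1 / a)" by (simp add: B_def)
  show "\<bar>a * (m2 - 2 * m1 + 1) - (1 - a / n)\<bar> \<le> B"
    unfolding e1 B using q_le s_le r2a d12 nn en inv by (intro abs_leI) linarith+
  have e3: "a * (m3 - 3 * m2 + 3 * m1 - 1)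
     = a * (r3 - 3 * r2 + 3 * r1 - 1) + (6 * r3 - 9 * r2 + 3 * r1) + (11 * r3 - 6 * r2) * (1 / a) + 6 * r3 * (1 / a\<^sup>2)"
  proof -
    have "a * (m3 - 3 * m2 + 3 * m1 - 1) = a * (r3 - 3 * r2 + 3 * r1 - 1) + (a * i) * (6 * r3 - 9 * r2 + 3 * r1)
        + (a * i) * i * (11 * r3 - 6 * r2) + (a * i) * i * i * (6 * r3)"
      unfolding m1 m2 m3 by (simp add: algebra_simps)
    then show ?thesis unfolding ai by (simp add: i_def power2_eq_square)
  qed
  have "a * (r3 - 3 * r2 + 3 * r1 - 1) \<le> a * (7 * e / n\<^sup>2)"
    using R(9) a by (intro mult_left_mono) auto
  also have "\<dots> \<le> a * (7 * e\<^sup>2 / n\<^sup>2)"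
    using a e n by (intro mult_left_mono divide_right_mono) (auto simp: power2_eq_square)
  also have "a * (7 * e\<^sup>2 / n\<^sup>2) = 7 * (a * e\<^sup>2 / n\<^sup>2)" by simp
  finally have t1: "a * (r3 - 3 * r2 + 3 * r1 - 1) \<le> 7 * (a * e\<^sup>2 / n\<^sup>2)" .
  have t2: "6 * r3 - 9 * r2 + 3 * r1 \<le> 27 * (e / n)" using R(2-6) by auto
  have "(11 * r3 - 6 * r2) * (1 / a) \<le> 11 * (1 / a)"
    using R inv by (intro mult_right_mono) auto
  moreover have "6 * r3 * (1 / a\<^sup>2) \<le> 6 * 1 * (1 / a)"
    using R inv by (intro mult_mono) auto
  ultimately show "a * (m3 - 3 * m2 + 3 * m1 - 1) \<le> B"
    unfolding e3 B using t1 t2 by linarith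
qed

text \<open>\<open>fact (n + k) / fact n\<close> is a product of \<open>k\<close> factors
  \<open>n * (1 + i / n)\<close> with \<open>i \<le> k\<close>, each at most
  \<open>n * exp (k / n)\<close>.\<close>

lemma ln_fact_add_le:
  assumes "n \<ge> 1"
  shows "ln (fact (n + k)) \<le> ln (fact n) + real k * ln (real n) + (real k)\<^sup>2 / real n"
proof (induction k)
  case (Suc k)
  have n: "real n > 0" using assms by simp
  have "ln (fact (n + Suc k)) = ln (real (n + Suc k)) + ln (fact (n + k))"
    by (simp add: ln_mult_pos del: of_nat_Suc of_nat_add)
  also have "ln (real (n + Suc k)) \<le> ln (real n) + real (Suc k) / real n"
  proof -
    have "real (n + Suc k) = real n * (1 + real (Suc k) / real n)" using n by (simp add: field_simps)
    then have "ln (real (n + Suc k)) = ln (real n) + ln (1 + real (Suc k) / real n)"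
      using n by (simp only:) (rule ln_mult_pos, auto intro: add_pos_nonneg)
    also have "ln (1 + real (Suc k) / real n) \<le> real (Suc k) / real n"
      by (rule ln_add_one_self_le_self) auto
    finally show ?thesis by simp
  qed
  also have "ln (real n) + real (Suc k) / real n + ln (fact (n + k))
     \<le> ln (real n) + real (Suc k) / real n + (ln (fact n) + real k * ln (real n) + (real k)\<^sup>2 / real n)"
    using Suc.IH by simp
  also have "\<dots> = ln (fact n) + real (Suc k) * ln (real n) + (real (Suc k) + (real k)\<^sup>2) / real n"
    by (simp add: algebra_simps add_divide_distrib)
  also have "\<dots> \<le> ln (fact n) + real (Suc k) * ln (real n) + (real (Suc k))\<^sup>2 / real n"
    using n by (intro add_left_mono divide_right_mono) (auto simp: power2_eq_square algebra_simps)
  finally show ?case by simp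
qed simp

section \<open>The log density ratio and its expectation under the Dirichlet law\<close>

context counts
begin

definition rat :: "nat \<Rightarrow> real" where
  "rat j = full d mle j / full d \<theta>s j"

definition dev :: "(nat \<Rightarrow> real) \<Rightarrow> nat \<Rightarrow> real" where
  "dev x j = full d x j / full d mle j - 1"

text \<open>The log ratio of the two densities at their common mode \<open>mle\<close>.\<close>

definition log_norm :: real where
  "log_norm = ln (p mle) + ln ((2 * pi) ^ d * ((\<Prod>j\<le>d. full d \<theta>s j) / real n ^ d)) / 2"

definition log_ratio_bound :: "(nat \<Rightarrow> real) \<Rightarrow> real" where
  "log_ratio_bound x = log_norm + (\<Sum>j\<le>d. real (N j) * ((rat j - 1) / 2 * (dev x j)\<^sup>2 + (dev x j) ^ 3 / 3))"

text \<open>To second order \<open>V\<close> has the weights \<open>n / full d mle j\<close>, the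
  Gaussian exponent has \<open>n / full d \<theta>s j\<close>; the mismatch is the term with
  \<open>rat j - 1\<close>. The cubic inequality for the logarithm bounds the rest on the whole
  simplex.\<close>

lemma log_ratio_le:
  assumes x: "x \<in> Theta d"
  shows "ln (p x / gauss_density n d \<theta>s mle x) \<le> log_ratio_bound x"
proof -
  define G where "G = (2 * pi) ^ d * ((\<Prod>j\<le>d. full d \<theta>s j) / real n ^ d)"
  have G: "G > 0" unfolding G_def using full_pos[OF \<theta>s] n by (intro mult_pos_pos divide_pos_pos prod_pos) auto
  have t: "dev x j > -1" "full d x j = full d mle j * (1 + dev x j)" if "j \<le> d" for j
    using full_pos[OF x that] full_pos[OF mle_Theta that] by (auto simp: dev_def field_simps)
  have Nj: "real (N j) = real n * full d mle j" if "j \<le> d" for j using full_mle[OF that] n by simp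
  have "ln (p x) = ln (p mle) - V x"
    using p_eq_V[OF x] p_pos[OF mle_Theta] by (simp add: ln_mult)
  moreover have "ln (gauss_density n d \<theta>s mle x) = - real n * fisher_sq d \<theta>s (\<lambda>j. x j - mle j) / 2 - ln G / 2"
    unfolding gauss_density_def G_def[symmetric] using G by (simp add: ln_div ln_sqrt)
  ultimately have log_eq: "ln (p x / gauss_density n d \<theta>s mle x)
     = log_norm + (real n / 2 * fisher_sq d \<theta>s (\<lambda>j. x j - mle j) - V x)"
    using p_pos[OF x] gauss_density_pos[OF \<theta>s n, of mle x] by (simp add: ln_div log_norm_def G_def)
  have "real n / 2 * fisher_sq d \<theta>s (\<lambda>j. x j - mle j) - V x
    = (\<Sum>j\<le>d. real n / 2 * ((full d x j - full d mle j)\<^sup>2 / full d \<theta>s j) - real (N j) * entropy_gap (full d x j / full d mle j))"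
    by (simp add: fisher_sq_full V_def sum_subtractf sum_distrib_left)
  also have "\<dots> \<le> (\<Sum>j\<le>d. real (N j) * ((rat j - 1) / 2 * (dev x j)\<^sup>2 + (dev x j) ^ 3 / 3))"
  proof (rule sum_mono)
    fix j assume "j \<in> {..d}"
    then have j: "j \<le> d" by simp
    have m: "full d mle j > 0" using full_pos[OF mle_Theta j] .
    have "real n / 2 * ((full d x j - full d mle j)\<^sup>2 / full d \<theta>s j) = real (N j) * (rat j / 2 * (dev x j)\<^sup>2)"
      unfolding Nj[OF j] t(2)[OF j] rat_def by (simp add: power2_eq_square algebra_simps)
    moreover have "real (N j) * entropy_gap (full d x j / full d mle j) \<ge> real (N j) * ((dev x j)\<^sup>2 / 2 - (dev x j) ^ 3 / 3)"
    proof (rule mult_left_mono)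
      have "full d x j / full d mle j = 1 + dev x j" by (simp add: dev_def)
      then show "(dev x j)\<^sup>2 / 2 - (dev x j) ^ 3 / 3 \<le> entropy_gap (full d x j / full d mle j)"
        using ln_add_one_le_cubic[OF t(1)[OF j]] by (simp add: entropy_gap_def)
    qed simp
    moreover have "real (N j) * ((rat j - 1) / 2 * (dev x j)\<^sup>2 + (dev x j) ^ 3 / 3)
      = real (N j) * (rat j / 2 * (dev x j)\<^sup>2) - real (N j) * ((dev x j)\<^sup>2 / 2 - (dev x j) ^ 3 / 3)"
      by (simp add: algebra_simps diff_divide_distrib)
    ultimately show "real n / 2 * ((full d x j - full d mle j)\<^sup>2 / full d \<theta>s j) - real (N j) * entropy_gap (full d x j / full d mle j)
      \<le> real (N j) * ((rat j - 1) / 2 * (dev x j)\<^sup>2 + (dev x j) ^ 3 / 3)"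
      by linarith
  qed
  finally show ?thesis unfolding log_eq log_ratio_bound_def by (rule add_left_mono)
qed

text \<open>By Stirling the Dirichlet density at its mode is close to that of a Gaussian with the
  covariance at \<open>mle\<close>, and the quotient of the determinants leaves half the sum of
  \<open>ln (rat j)\<close>. The \<open>fact (N j)\<close> stand in the denominator, where the lower
  Stirling bound has no error term; errors come only from \<open>fact n\<close> and from the
  \<open>d\<close> further factors of \<open>fact (n + d)\<close>.\<close>

lemma log_norm_le: "log_norm \<le> 1 / (4 * real n) + (real d)\<^sup>2 / real n - (\<Sum>j\<le>d. ln (rat j)) / 2"
proof -
  have nn: "real n > 0" using n by simp
  have Nr: "real (N j) > 0" if "j \<le> d" for j using Npos[OF that] by simp
  have sumN': "(\<Sum>j\<le>d. real (N j)) = real n" using sum_N by (metis of_nat_sum)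
  have fpos: "(\<Prod>j\<le>d. fact (N j) :: real) > 0" by (intro prod_pos) auto
  have mpos: "(\<Prod>j\<le>d. full d mle j ^ N j) > 0" using full_pos[OF mle_Theta] by (intro prod_pos) auto
  have tpos: "(\<Prod>j\<le>d. full d \<theta>s j) > 0" using full_pos[OF \<theta>s] by (intro prod_pos) auto
  have "ln (p mle) = ln (fact (n + d)) - ln (\<Prod>j\<le>d. fact (N j)) + ln (\<Prod>j\<le>d. full d mle j ^ N j)"
    using mle_Theta fpos mpos by (simp add: dir_density_def dir_weight_def sum_N ln_mult_pos ln_divide_pos)
  also have "ln (\<Prod>j\<le>d. fact (N j) :: real) = (\<Sum>j\<le>d. ln (fact (N j)))"
    by (rule ln_prod) auto
  also have "ln (\<Prod>j\<le>d. full d mle j ^ N j) = (\<Sum>j\<le>d. real (N j) * ln (real (N j)) - real (N j) * ln (real n))"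
  proof -
    have "ln (\<Prod>j\<le>d. full d mle j ^ N j) = (\<Sum>j\<le>d. ln (full d mle j ^ N j))"
      using full_pos[OF mle_Theta, THEN less_imp_neq] by (intro ln_prod) auto
    also have "\<dots> = (\<Sum>j\<le>d. real (N j) * ln (real (N j)) - real (N j) * ln (real n))"
    proof (rule sum.cong)
      fix j assume "j \<in> {..d}"
      then have j: "j \<le> d" by simp
      show "ln (full d mle j ^ N j) = real (N j) * ln (real (N j)) - real (N j) * ln (real n)"
        using Nr[OF j] nn full_mle[OF j] by (simp add: ln_realpow ln_divide_pos algebra_simps)
    qed simp
    finally show ?thesis .
  qed
  finally have lnp: "ln (p mle) = ln (fact (n + d)) - (\<Sum>j\<le>d. ln (fact (N j)))
      + (\<Sum>j\<le>d. real (N j) * ln (real (N j))) - real n * ln (real n)"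
    by (simp add: sum_subtractf sumN' flip: sum_distrib_right)
  have lnG: "ln ((2 * pi) ^ d * ((\<Prod>j\<le>d. full d \<theta>s j) / real n ^ d))
     = real d * ln (2 * pi) + (\<Sum>j\<le>d. ln (full d \<theta>s j)) - real d * ln (real n)"
  proof -
    have "ln (\<Prod>j\<le>d. full d \<theta>s j) = (\<Sum>j\<le>d. ln (full d \<theta>s j))"
      using full_pos[OF \<theta>s, THEN less_imp_neq] by (intro ln_prod) auto
    then show ?thesis using tpos nn by (simp add: ln_mult_pos ln_divide_pos ln_realpow algebra_simps)
  qed
  have lnN: "(\<Sum>j\<le>d. real (N j) * ln (real (N j)) - real (N j) + (ln (2 * pi) + ln (real (N j))) / 2) \<le> (\<Sum>j\<le>d. ln (fact (N j)))"
  proof (rule sum_mono)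
    fix j assume "j \<in> {..d}"
    then have j: "j \<le> d" by simp
    have "ln (2 * pi * real (N j)) = ln (2 * pi) + ln (real (N j))"
      using Nr[OF j] by (intro ln_mult_pos) auto
    then show "real (N j) * ln (real (N j)) - real (N j) + (ln (2 * pi) + ln (real (N j))) / 2 \<le> ln (fact (N j))"
      using ln_fact_lower[OF Npos[OF j]] by simp
  qed
  define S SN St L Ln where "S = (\<Sum>j\<le>d. real (N j) * ln (real (N j)))" and "SN = (\<Sum>j\<le>d. ln (real (N j)))"
    and "St = (\<Sum>j\<le>d. ln (full d \<theta>s j))" and "L = ln (2 * pi)" and "Ln = ln (real n)"
  have h1: "(\<Sum>j\<le>d. real (N j) * ln (real (N j)) - real (N j) + (ln (2 * pi) + ln (real (N j))) / 2)
    = S - real n + (real d * L + L) / 2 + SN / 2"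
  proof -
    have "(\<Sum>j\<le>d. (ln (2 * pi) + ln (real (N j))) / 2) = (real d * L + L) / 2 + SN / 2"
      by (simp add: SN_def L_def sum.distrib add_divide_distrib distrib_right flip: sum_divide_distrib)
    then show ?thesis by (simp add: sum.distrib sum_subtractf sumN' S_def)
  qed
  have h2: "ln (2 * pi * real n) = L + Ln"
    unfolding L_def Ln_def using nn by (intro ln_mult_pos) auto
  have h3: "(\<Sum>j\<le>d. ln (rat j)) = SN - (real d * Ln + Ln) - St"
  proof -
    have "(\<Sum>j\<le>d. ln (rat j)) = (\<Sum>j\<le>d. ln (real (N j)) - ln (real n) - ln (full d \<theta>s j))"
    proof (rule sum.cong)
      fix j assume "j \<in> {..d}"
      then have j: "j \<le> d" by simp
      have "ln (rat j) = ln (full d mle j) - ln (full d \<theta>s j)"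
        unfolding rat_def by (rule ln_divide_pos[OF full_pos[OF mle_Theta j] full_pos[OF \<theta>s j]])
      also have "ln (full d mle j) = ln (real (N j)) - ln (real n)"
        unfolding full_mle[OF j] by (rule ln_divide_pos[OF Nr[OF j] nn])
      finally show "ln (rat j) = ln (real (N j)) - ln (real n) - ln (full d \<theta>s j)" .
    qed simp
    then show ?thesis by (simp add: sum_subtractf SN_def St_def Ln_def distrib_right)
  qed
  \<comment> \<open>What remains is linear in the logarithms; abstract variables separate it from
    their definitions.\<close>
  have arith: "(A - F + S - P) + (DL + St - DLn) / 2 \<le> r + q - R / 2"
    if "A \<le> f + DLn + q" "f \<le> P - m + (L + Ln) / 2 + r" "S - m + (DL + L) / 2 + SN / 2 \<le> F"
      "R = SN - (DLn + Ln) - St"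
    for A F S P DL St DLn r q R f m L Ln SN :: real
    using that by (simp add: field_simps)
  show ?thesis
    unfolding log_norm_def lnp lnG S_def[symmetric] St_def[symmetric] L_def[symmetric] Ln_def[symmetric]
    using lnN[unfolded h1] h2 h3 ln_fact_add_le[OF n, of d] ln_fact_upper[OF n]
    by (intro arith) (simp_all add: Ln_def)
qed

text \<open>The raw moments of \<open>full d x j / full d mle j\<close> under \<open>p\<close>,
  whose total parameter is \<open>n + d + 1\<close>.\<close>

definition p_moment :: "nat \<Rightarrow> nat \<Rightarrow> real" where
  "p_moment j k = (real n / real (N j)) ^ k * (pochhammer (real (N j) + 1) k / pochhammer (real n + (real d + 1)) k)"

lemma p_moment:
  assumes j: "j \<le> d"
  shows "has_bochner_integral (lborel_d d) (\<lambda>x. p x * (full d x j / full d mle j) ^ k) (p_moment j k)"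
proof -
  have "has_bochner_integral (lborel_d d) (\<lambda>x. (real n / real (N j)) ^ k * (p x * full d x j ^ k)) (p_moment j k)"
    unfolding p_moment_def
    using dir_density_moment[OF j, of N k] by (intro has_bochner_integral_mult_right) (simp add: sum_N add_ac)
  moreover have "(real n / real (N j)) ^ k * (p x * full d x j ^ k) = p x * (full d x j / full d mle j) ^ k" for x
    by (simp add: full_mle[OF j] power_divide power_mult_distrib)
  ultimately show ?thesis by simp
qed

lemma p_dev_moments:
  assumes j: "j \<le> d"
  shows "has_bochner_integral (lborel_d d) (\<lambda>x. p x * (dev x j)\<^sup>2) (p_moment j 2 - 2 * p_moment j 1 + 1)"
    and "has_bochner_integral (lborel_d d) (\<lambda>x. p x * (dev x j) ^ 3)
      (p_moment j 3 - 3 * p_moment j 2 + 3 * p_moment j 1 - 1)"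
proof -
  define y where "y x = full d x j / full d mle j" for x
  have m: "has_bochner_integral (lborel_d d) (\<lambda>x. p x * y x ^ k) (p_moment j k)" for k
    unfolding y_def by (rule p_moment[OF j])
  have one: "has_bochner_integral (lborel_d d) p 1" by (rule dir_density_integral)
  have "has_bochner_integral (lborel_d d) (\<lambda>x. (p x * y x ^ 2 - 2 * (p x * y x ^ 1)) + p x)
     ((p_moment j 2 - 2 * p_moment j 1) + 1)"
    by (intro has_bochner_integral_add has_bochner_integral_diff has_bochner_integral_mult_right m one)
  also have "(\<lambda>x. (p x * y x ^ 2 - 2 * (p x * y x ^ 1)) + p x) = (\<lambda>x. p x * (dev x j)\<^sup>2)"
    by (simp add: fun_eq_iff dev_def y_def[symmetric] power2_eq_square algebra_simps)
  finally show "has_bochner_integral (lborel_d d) (\<lambda>x. p x * (dev x j)\<^sup>2) (p_moment j 2 - 2 * p_moment j 1 + 1)" .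
  have "has_bochner_integral (lborel_d d) (\<lambda>x. ((p x * y x ^ 3 - 3 * (p x * y x ^ 2)) + 3 * (p x * y x ^ 1)) - p x)
     (((p_moment j 3 - 3 * p_moment j 2) + 3 * p_moment j 1) - 1)"
    by (intro has_bochner_integral_add has_bochner_integral_diff has_bochner_integral_mult_right m one)
  also have "(\<lambda>x. ((p x * y x ^ 3 - 3 * (p x * y x ^ 2)) + 3 * (p x * y x ^ 1)) - p x) = (\<lambda>x. p x * (dev x j) ^ 3)"
    by (simp add: fun_eq_iff dev_def y_def[symmetric] power2_eq_square power3_eq_cube algebra_simps)
  finally show "has_bochner_integral (lborel_d d) (\<lambda>x. p x * (dev x j) ^ 3)
      (p_moment j 3 - 3 * p_moment j 2 + 3 * p_moment j 1 - 1)" .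
qed

lemma log_ratio_bound_integral:
  "has_bochner_integral (lborel_d d) (\<lambda>x. p x * log_ratio_bound x)
    (log_norm + (\<Sum>j\<le>d. real (N j) * ((rat j - 1) / 2 * (p_moment j 2 - 2 * p_moment j 1 + 1)
       + (p_moment j 3 - 3 * p_moment j 2 + 3 * p_moment j 1 - 1) / 3)))"
proof -
  define T where "T j x = real (N j) * ((rat j - 1) / 2 * (p x * (dev x j)\<^sup>2) + (1 / 3) * (p x * (dev x j) ^ 3))" for j x
  have T: "has_bochner_integral (lborel_d d) (T j)
      (real (N j) * ((rat j - 1) / 2 * (p_moment j 2 - 2 * p_moment j 1 + 1)
       + (1 / 3) * (p_moment j 3 - 3 * p_moment j 2 + 3 * p_moment j 1 - 1)))" if "j \<le> d" for j
    unfolding T_def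
    by (intro has_bochner_integral_mult_right has_bochner_integral_add p_dev_moments that)
  have "has_bochner_integral (lborel_d d) (\<lambda>x. log_norm * p x + (\<Sum>j\<le>d. T j x))
    (log_norm * 1 + (\<Sum>j\<le>d. real (N j) * ((rat j - 1) / 2 * (p_moment j 2 - 2 * p_moment j 1 + 1)
       + (1 / 3) * (p_moment j 3 - 3 * p_moment j 2 + 3 * p_moment j 1 - 1))))"
    by (intro has_bochner_integral_add has_bochner_integral_mult_right has_bochner_integral_sum dir_density_integral T) auto
  also have "(\<lambda>x. log_norm * p x + (\<Sum>j\<le>d. T j x)) = (\<lambda>x. p x * log_ratio_bound x)"
  proof
    fix x
    have "(\<Sum>j\<le>d. T j x) = p x * (\<Sum>j\<le>d. real (N j) * ((rat j - 1) / 2 * (dev x j)\<^sup>2 + (dev x j) ^ 3 / 3))"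
      unfolding sum_distrib_left by (intro sum.cong) (auto simp: T_def algebra_simps)
    then show "log_norm * p x + (\<Sum>j\<le>d. T j x) = p x * log_ratio_bound x"
      by (simp add: log_ratio_bound_def distrib_left mult.commute)
  qed
  finally show ?thesis by simp
qed

text \<open>The expected quadratic mismatch is \<open>(rat j - 1) / 2 * (1 - N j / n)\<close> up to
  a multiple of \<open>B j\<close>, and its part \<open>(rat j - 1) / 2\<close> is cancelled by the
  linear part of \<open>- ln (rat j) / 2\<close>. There remain the squares
  \<open>(rat j - 1)^2\<close>, which sum to at most \<open>s^2 * d / (n * theta_min)\<close>, a
  term of favourable sign, and the moment errors. The constants add up to \<open>206 + 1\<close>,
  below \<open>15^2\<close>.\<close>

lemma kl_flat_le:
  assumes rat: "\<And>j. j \<le> d \<Longrightarrow> \<bar>rat j - 1\<bar> \<le> 1 / 2" and s: "s \<ge> 1"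
    and chi: "fisher_sq d \<theta>s (\<lambda>j. mle j - \<theta>s j) \<le> s\<^sup>2 * (real d / real n)"
  shows "(\<integral>x. p x * log_ratio_bound x \<partial>lborel_d d) \<le> (15 * s * real d / sqrt (real n * theta_min d \<theta>s))\<^sup>2"
proof -
  define T where "T = 1 / (real n * theta_min d \<theta>s)"
  define e where "e = real d + 1"
  have nn: "real n \<ge> 1" using n by simp
  have dd: "real d \<ge> 1" using d by simp
  have e: "e \<ge> 1" "e \<le> 2 * real d" using dd by (auto simp: e_def)
  have tm: "theta_min d \<theta>s > 0" "theta_min d \<theta>s \<le> 1" using theta_min_pos[OF \<theta>s] theta_min_le_1[OF \<theta>s] by auto
  have T: "1 / real n \<le> T" "T > 0"
    unfolding T_def using tm nn by (auto intro!: divide_left_mono mult_left_le)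
  define B where "B j = 7 * real (N j) * e\<^sup>2 / (real n)\<^sup>2 + 27 * e / real n + 17 / real (N j)" for j
  define A where "A j = real (N j) * (p_moment j 2 - 2 * p_moment j 1 + 1)" for j
  define C where "C j = real (N j) * (p_moment j 3 - 3 * p_moment j 2 + 3 * p_moment j 1 - 1)" for j
  have mom: "\<bar>A j - (1 - real (N j) / real n)\<bar> \<le> B j" "C j \<le> B j" if j: "j \<le> d" for j
  proof -
    have a: "real (N j) \<ge> 1" using Npos[OF j] by simp
    note D = dir_centered_moments[OF a nn e(1)]
    have m1: "p_moment j 1 = real n / real (N j) * ((real (N j) + 1) / (real n + e))"
      by (simp add: p_moment_def e_def)
    have m2: "p_moment j 2 = (real n / real (N j))\<^sup>2 * ((real (N j) + 1) * (real (N j) + 2) / ((real n + e) * (real n + e + 1)))"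
      by (simp add: p_moment_def e_def pochhammer_Suc numeral_2_eq_2 add_ac)
    have m3: "p_moment j 3 = (real n / real (N j)) ^ 3 * ((real (N j) + 1) * (real (N j) + 2) * (real (N j) + 3)
        / ((real n + e) * (real n + e + 1) * (real n + e + 2)))"
      by (simp add: p_moment_def e_def pochhammer_Suc numeral_3_eq_3 add_ac)
    show "\<bar>A j - (1 - real (N j) / real n)\<bar> \<le> B j" "C j \<le> B j"
      using D unfolding A_def C_def B_def m1 m2 m3 by auto
  qed
  have B_nonneg: "B j \<ge> 0" for j using nn e by (auto simp: B_def)
  have term_le: "real (N j) * ((rat j - 1) / 2 * (p_moment j 2 - 2 * p_moment j 1 + 1)
       + (p_moment j 3 - 3 * p_moment j 2 + 3 * p_moment j 1 - 1) / 3) - ln (rat j) / 2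
     \<le> (rat j - 1)\<^sup>2 - (rat j - 1) * (real (N j) / real n) / 2 + B j" if j: "j \<le> d" for j
  proof -
    have r: "rat j \<ge> 1 / 2" "\<bar>rat j - 1\<bar> \<le> 1 / 2" using rat[OF j] by linarith+
    have "real (N j) * ((rat j - 1) / 2 * (p_moment j 2 - 2 * p_moment j 1 + 1)
       + (p_moment j 3 - 3 * p_moment j 2 + 3 * p_moment j 1 - 1) / 3) = (rat j - 1) / 2 * A j + C j / 3"
    proof -
      have "u * (v * X + Y / 3) = v * (u * X) + (u * Y) / 3" for u v X Y :: real by (simp add: algebra_simps)
      then show ?thesis unfolding A_def C_def .
    qed
    also have "(rat j - 1) / 2 * A j = (rat j - 1) / 2 * (1 - real (N j) / real n) + (rat j - 1) / 2 * (A j - (1 - real (N j) / real n))"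
      by (simp flip: distrib_left)
    also have "(rat j - 1) / 2 * (A j - (1 - real (N j) / real n)) \<le> 1 / 4 * B j"
    proof -
      have "(rat j - 1) / 2 * (A j - (1 - real (N j) / real n)) \<le> \<bar>(rat j - 1) / 2\<bar> * \<bar>A j - (1 - real (N j) / real n)\<bar>"
        by (metis abs_ge_self abs_mult)
      also have "\<dots> \<le> 1 / 4 * B j"
        using r mom(1)[OF j] by (intro mult_mono) auto
      finally show ?thesis .
    qed
    finally have 1: "real (N j) * ((rat j - 1) / 2 * (p_moment j 2 - 2 * p_moment j 1 + 1)
       + (p_moment j 3 - 3 * p_moment j 2 + 3 * p_moment j 1 - 1) / 3)
      \<le> (rat j - 1) / 2 * (1 - real (N j) / real n) + 1 / 4 * B j + C j / 3" by simp
    have "- ln (rat j) = ln (1 / rat j)" using r by (simp add: ln_div)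
    also have "\<dots> \<le> 1 / rat j - 1" using r by (intro ln_le_minus_one) auto
    also have "\<dots> = (rat j - 1)\<^sup>2 / rat j - (rat j - 1)"
      using r by (simp add: field_simps power2_eq_square)
    also have "(rat j - 1)\<^sup>2 / rat j \<le> (rat j - 1)\<^sup>2 / (1 / 2)" using r by (intro divide_left_mono) auto
    finally have 2: "- ln (rat j) \<le> 2 * (rat j - 1)\<^sup>2 - (rat j - 1)" by simp
    have 3: "(rat j - 1) / 2 * (1 - real (N j) / real n) = (rat j - 1) / 2 - (rat j - 1) * (real (N j) / real n) / 2"
      by (simp only: right_diff_distrib mult_1_right times_divide_eq_left)
    have arith: "X - l / 2 \<le> S - Q / 2 + b"
      if "X \<le> u / 2 - Q / 2 + 1 / 4 * b + c / 3" "- l \<le> 2 * S - u" "c \<le> b" "0 \<le> b" for X l S Q b u c :: real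
      using that by argo
    show ?thesis by (rule arith[OF 1[unfolded 3] 2 mom(2)[OF j] B_nonneg])
  qed
  have "(\<integral>x. p x * log_ratio_bound x \<partial>lborel_d d)
    = log_norm + (\<Sum>j\<le>d. real (N j) * ((rat j - 1) / 2 * (p_moment j 2 - 2 * p_moment j 1 + 1)
       + (p_moment j 3 - 3 * p_moment j 2 + 3 * p_moment j 1 - 1) / 3))"
    using log_ratio_bound_integral by (rule has_bochner_integral_integral_eq)
  also have "\<dots> \<le> 1 / (4 * real n) + (real d)\<^sup>2 / real n
     + (\<Sum>j\<le>d. real (N j) * ((rat j - 1) / 2 * (p_moment j 2 - 2 * p_moment j 1 + 1)
       + (p_moment j 3 - 3 * p_moment j 2 + 3 * p_moment j 1 - 1) / 3) - ln (rat j) / 2)"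
    using log_norm_le by (simp add: sum_subtractf sum_divide_distrib)
  also have "\<dots> \<le> 1 / (4 * real n) + (real d)\<^sup>2 / real n
     + (\<Sum>j\<le>d. (rat j - 1)\<^sup>2 - (rat j - 1) * (real (N j) / real n) / 2 + B j)"
    by (intro add_left_mono sum_mono term_le) auto
  also have "\<dots> = 1 / (4 * real n) + (real d)\<^sup>2 / real n
     + ((\<Sum>j\<le>d. (rat j - 1)\<^sup>2) - (\<Sum>j\<le>d. (rat j - 1) * (real (N j) / real n)) / 2 + (\<Sum>j\<le>d. B j))"
    by (simp add: sum.distrib sum_subtractf sum_divide_distrib)
  \<comment> \<open>The 0 bounds the cross term from below: both probability vectors sum to 1, so
    the sum of \<open>(rat j - 1) * N j / n\<close> equals that of
    \<open>full d \<theta>s j * (rat j - 1)^2\<close>. The 204 comes from the sum of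
    \<open>B j\<close>, using \<open>e = d + 1 \<le> 2 * d\<close>.\<close>
  also have "\<dots> \<le> 2 * ((real d)\<^sup>2 * T) + (s\<^sup>2 * real d * T - 0 / 2 + 204 * ((real d)\<^sup>2 * T))"
  proof (intro add_mono diff_mono divide_right_mono)
    have "(real d)\<^sup>2 \<ge> 1" using dd by simp
    then have "1 / (4 * real n) \<le> (real d)\<^sup>2 * (1 / real n)"
      using nn by (simp add: field_simps)
    also have "\<dots> \<le> (real d)\<^sup>2 * T" using T by (intro mult_left_mono) auto
    finally have "1 / (4 * real n) \<le> (real d)\<^sup>2 * T" .
    moreover have "(real d)\<^sup>2 * (1 / real n) \<le> (real d)\<^sup>2 * T" using T by (intro mult_left_mono) auto
    ultimately show "1 / (4 * real n) + (real d)\<^sup>2 / real n \<le> 2 * ((real d)\<^sup>2 * T)" by simp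
  next
    have "(\<Sum>j\<le>d. (rat j - 1)\<^sup>2) \<le> (\<Sum>j\<le>d. (1 / theta_min d \<theta>s) * ((full d mle j - full d \<theta>s j)\<^sup>2 / full d \<theta>s j))"
    proof (rule sum_mono)
      fix j assume "j \<in> {..d}"
      then have j: "j \<le> d" by simp
      have pos: "full d \<theta>s j > 0" using full_pos[OF \<theta>s j] .
      have "(rat j - 1)\<^sup>2 = (1 / full d \<theta>s j) * ((full d mle j - full d \<theta>s j)\<^sup>2 / full d \<theta>s j)"
        using pos by (simp add: rat_def field_simps power2_eq_square)
      also have "\<dots> \<le> (1 / theta_min d \<theta>s) * ((full d mle j - full d \<theta>s j)\<^sup>2 / full d \<theta>s j)"
        using pos tm theta_min_le[OF j] by (intro mult_right_mono divide_left_mono) auto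
      finally show "(rat j - 1)\<^sup>2 \<le> (1 / theta_min d \<theta>s) * ((full d mle j - full d \<theta>s j)\<^sup>2 / full d \<theta>s j)" .
    qed
    also have "\<dots> = (1 / theta_min d \<theta>s) * fisher_sq d \<theta>s (\<lambda>j. mle j - \<theta>s j)"
      by (simp add: fisher_sq_full sum_distrib_left)
    also have "\<dots> \<le> (1 / theta_min d \<theta>s) * (s\<^sup>2 * (real d / real n))"
      using tm by (intro mult_left_mono chi) auto
    also have "\<dots> = s\<^sup>2 * real d * T" by (simp add: T_def)
    finally show "(\<Sum>j\<le>d. (rat j - 1)\<^sup>2) \<le> s\<^sup>2 * real d * T" .
  next
    have "(\<Sum>j\<le>d. (rat j - 1) * (real (N j) / real n))
      = (\<Sum>j\<le>d. full d \<theta>s j * (rat j - 1)\<^sup>2 + (full d mle j - full d \<theta>s j))"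
    proof (rule sum.cong)
      fix j assume "j \<in> {..d}"
      then have j: "j \<le> d" by simp
      show "(rat j - 1) * (real (N j) / real n) = full d \<theta>s j * (rat j - 1)\<^sup>2 + (full d mle j - full d \<theta>s j)"
        unfolding full_mle[OF j, symmetric] rat_def using full_pos[OF \<theta>s j]
        by (simp add: field_simps power2_eq_square)
    qed simp
    also have "\<dots> = (\<Sum>j\<le>d. full d \<theta>s j * (rat j - 1)\<^sup>2) + ((\<Sum>j\<le>d. full d mle j) - (\<Sum>j\<le>d. full d \<theta>s j))"
      by (simp add: sum.distrib sum_subtractf)
    also have "(\<Sum>j\<le>d. full d mle j) - (\<Sum>j\<le>d. full d \<theta>s j) = 0"
      using sum_full[of d mle] sum_full[of d \<theta>s] by (simp add: atLeast0AtMost)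
    finally have eq: "(\<Sum>j\<le>d. (rat j - 1) * (real (N j) / real n)) = (\<Sum>j\<le>d. full d \<theta>s j * (rat j - 1)\<^sup>2) + 0" .
    have "0 \<le> (\<Sum>j\<le>d. full d \<theta>s j * (rat j - 1)\<^sup>2)"
      using full_pos[OF \<theta>s, THEN less_imp_le] by (intro sum_nonneg mult_nonneg_nonneg) auto
    then show "0 \<le> (\<Sum>j\<le>d. (rat j - 1) * (real (N j) / real n))" using eq by simp
  next
    have "(\<Sum>j\<le>d. B j) \<le> (\<Sum>j\<le>d. 7 * e\<^sup>2 / (real n)\<^sup>2 * real (N j) + (27 * e * T + 34 * T))"
    proof (rule sum_mono)
      fix j assume "j \<in> {..d}"
      then have j: "j \<le> d" by simp
      have pos: "full d \<theta>s j > 0" using full_pos[OF \<theta>s j] .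
      have "rat j \<ge> 1 / 2" using rat[OF j] by linarith
      then have "full d \<theta>s j \<le> 2 * full d mle j" using pos by (simp add: rat_def field_simps)
      then have "theta_min d \<theta>s \<le> 2 * (real (N j) / real n)"
        using theta_min_le[OF j, of \<theta>s] full_mle[OF j] by simp
      then have "real n * theta_min d \<theta>s \<le> 2 * real (N j)" using nn by (simp add: field_simps)
      then have "34 / (2 * real (N j)) \<le> 34 / (real n * theta_min d \<theta>s)"
        using tm nn Npos[OF j] by (intro divide_left_mono mult_pos_pos) auto
      then have "17 / real (N j) \<le> 34 * T" by (simp add: T_def)
      moreover have "27 * e * (1 / real n) \<le> 27 * e * T" using T e by (intro mult_left_mono) auto
      moreover have "7 * real (N j) * e\<^sup>2 / (real n)\<^sup>2 = 7 * e\<^sup>2 / (real n)\<^sup>2 * real (N j)"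
        "27 * e / real n = 27 * e * (1 / real n)" by simp_all
      ultimately show "B j \<le> 7 * e\<^sup>2 / (real n)\<^sup>2 * real (N j) + (27 * e * T + 34 * T)"
        unfolding B_def by (simp only:)
    qed
    also have "\<dots> = 7 * e\<^sup>2 / (real n)\<^sup>2 * (\<Sum>j\<le>d. real (N j)) + e * (27 * e * T + 34 * T)"
    proof -
      have "(\<Sum>j\<le>d. k * real (N j) + c) = k * (\<Sum>j\<le>d. real (N j)) + e * c" for k c
        by (simp only: sum.distrib sum_distrib_left[symmetric]) (simp add: e_def)
      then show ?thesis .
    qed
    also have "(\<Sum>j\<le>d. real (N j)) = real n" using sum_N by (metis of_nat_sum)
    also have "7 * e\<^sup>2 / (real n)\<^sup>2 * real n = 7 * e\<^sup>2 * (1 / real n)" using nn by (simp add: power2_eq_square)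
    also have "\<dots> + e * (27 * e * T + 34 * T) \<le> 7 * e\<^sup>2 * T + e * (27 * e * T + 34 * T)"
      using T by (intro add_right_mono mult_left_mono) auto
    also have "\<dots> = 34 * (e\<^sup>2 * T) + 34 * (e * T)" by (simp add: power2_eq_square algebra_simps)
    also have "\<dots> \<le> 34 * (4 * (real d)\<^sup>2 * T) + 34 * (2 * (real d)\<^sup>2 * T)"
    proof (intro add_mono mult_left_mono mult_right_mono)
      have "e\<^sup>2 \<le> (2 * real d)\<^sup>2" using e by (intro power_mono) auto
      then show "e\<^sup>2 \<le> 4 * (real d)\<^sup>2" by simp
      have "real d * 1 \<le> real d * real d" using dd by (intro mult_left_mono) auto
      then show "e \<le> 2 * (real d)\<^sup>2" using e(2) unfolding power2_eq_square by linarith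
    qed (use T in auto)
    also have "\<dots> = 204 * ((real d)\<^sup>2 * T)" by simp
    finally show "(\<Sum>j\<le>d. B j) \<le> 204 * ((real d)\<^sup>2 * T)" .
  qed auto
  also have "\<dots> = 206 * ((real d)\<^sup>2 * T) + s\<^sup>2 * real d * T" by simp
  also have "\<dots> \<le> 206 * (s\<^sup>2 * (real d)\<^sup>2 * T) + s\<^sup>2 * (real d)\<^sup>2 * T"
  proof (intro add_mono mult_left_mono mult_right_mono)
    have s2: "s\<^sup>2 \<ge> 1" using s by simp
    show "(real d)\<^sup>2 \<le> s\<^sup>2 * (real d)\<^sup>2" using s2 by (simp add: mult_le_cancel_right1)
    show "real d \<le> (real d)\<^sup>2" using dd by (simp add: power2_eq_square)
  qed (use T in auto)
  also have "\<dots> \<le> 225 * (s\<^sup>2 * (real d)\<^sup>2 * T)" using T by simp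
  also have "\<dots> = (15 * s * real d / sqrt (real n * theta_min d \<theta>s))\<^sup>2"
    using tm nn by (simp add: T_def power_divide power_mult_distrib)
  finally show ?thesis .
qed

end

section \<open>The posterior for a general prior\<close>

text \<open>The constant \<open>1 / 400\<close> makes relative errors at most \<open>1 / 10\<close>
  on \<open>U\<close> and \<open>1 / 20\<close> at \<open>mle\<close>; \<open>10 \<le> s\<close>
  lets \<open>exp (- c * d * s^2)\<close> absorb the factors \<open>2 ^ d\<close> and
  \<open>exp (s * d / 3)\<close>.\<close>

locale good_counts = counts +
  fixes s \<delta> :: real and \<pi>0 :: "(nat \<Rightarrow> real) \<Rightarrow> real"
  assumes s: "10 \<le> s" and small: "s\<^sup>2 * real d / (real n * theta_min d \<theta>s) \<le> 1 / 400"
    and chi: "fisher_sq d \<theta>s (\<lambda>j. mle j - \<theta>s j) \<le> s\<^sup>2 * (real d / real n)"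
    and prior: "prior_density d \<pi>0"
    and \<delta>: "delta01 n d \<theta>s \<pi>0 (2 * s) \<le> ereal \<delta>" "0 \<le> \<delta>" "\<delta> \<le> sqrt (real n * real d) / 6"
begin

section \<open>Geometry of the ellipsoid and the likelihood outside it\<close>

definition R :: real where "R = s\<^sup>2 * (real d / real n)"

abbreviation U :: "(nat \<Rightarrow> real) set" where "U \<equiv> Ustar n d \<theta>s (2 * s)"

lemma real_n_pos: "real n > 0"
  using n by simp

lemma R_nonneg: "0 \<le> R"
  by (simp add: R_def)

lemma R_le: "R \<le> theta_min d \<theta>s / 400"
proof -
  have "s\<^sup>2 * real d / (real n * theta_min d \<theta>s) = R / theta_min d \<theta>s" by (simp add: R_def)
  then show ?thesis using small theta_min_pos[OF \<theta>s] by (simp add: pos_divide_le_eq)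
qed

lemma U_eq: "U = {x \<in> Rd d. fisher_sq d \<theta>s (\<lambda>j. x j - \<theta>s j) \<le> 4 * R}"
proof -
  have e: "(2 * s)\<^sup>2 * (real d / real n) = 4 * R" by (simp add: R_def power_mult_distrib)
  show ?thesis using Ustar_eq[OF \<theta>s, of "2 * s" n] s unfolding e by simp
qed

lemma rel_U: "x \<in> U \<Longrightarrow> j \<le> d \<Longrightarrow> \<bar>full d x j - full d \<theta>s j\<bar> \<le> 1 / 10 * full d \<theta>s j"
  using R_le by (intro relative_error[OF \<theta>s]) (auto simp: U_eq power2_eq_square)

lemma rel_mle: "j \<le> d \<Longrightarrow> \<bar>full d mle j - full d \<theta>s j\<bar> \<le> 1 / 20 * full d \<theta>s j"
  using R_le order_trans[OF chi[folded R_def] R_le]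
  by (intro relative_error[OF \<theta>s]) (auto simp: power2_eq_square)

lemma rat_near_1:
  assumes j: "j \<le> d"
  shows "\<bar>rat j - 1\<bar> \<le> 1 / 20"
proof -
  have pos: "full d \<theta>s j > 0" using full_pos[OF \<theta>s j] .
  have "rat j - 1 = (full d mle j - full d \<theta>s j) / full d \<theta>s j" using pos by (simp add: rat_def field_simps)
  then have "\<bar>rat j - 1\<bar> = \<bar>full d mle j - full d \<theta>s j\<bar> / full d \<theta>s j" using pos by (simp add: abs_divide)
  also have "\<dots> \<le> 1 / 20" using rel_mle[OF j] pos by (simp add: pos_divide_le_eq)
  finally show ?thesis .
qed

lemma U_Theta: "U \<subseteq> Theta d"
proof
  fix x assume x: "x \<in> U"
  have "0 < full d x j" if j: "j \<le> d" for j
  proof -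
    have "full d x j \<ge> full d \<theta>s j - 1 / 10 * full d \<theta>s j" using rel_U[OF x j] by linarith
    then show ?thesis using full_pos[OF \<theta>s j] by linarith
  qed
  then show "x \<in> Theta d" unfolding mem_Theta_iff_full using x by (auto simp: U_eq)
qed

lemma \<theta>s_U: "\<theta>s \<in> U"
  using \<theta>s R_nonneg unfolding U_eq by (auto simp: Theta_def fisher_sq_def)

lemma U_measurable [measurable]: "U \<in> sets (lborel_d d)"
proof -
  have "U = {x \<in> space (lborel_d d). fisher_sq d \<theta>s (\<lambda>j. x j - \<theta>s j) \<le> 4 * R}"
    by (simp add: U_eq space_PiM)
  also have "\<dots> \<in> sets (lborel_d d)" by measurable
  finally show ?thesis .
qed

text \<open>If \<open>V x\<close> were smaller, each of its nonnegative summands would be small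
  enough for the quadratic bound on the entropy gap, so \<open>V x\<close> would control the
  chi-square distance from \<open>mle\<close>. Then \<open>x\<close> and \<open>\<theta>s\<close>
  would both be within squared distance \<open>R\<close> of \<open>mle\<close>, hence within
  \<open>4 * R\<close> of each other. Passing from 6 to 7 pays for replacing the weights at
  \<open>mle\<close> by those at \<open>\<theta>s\<close>.\<close>

lemma V_large_outside_U:
  assumes x: "x \<in> Theta d" "x \<notin> U"
  shows "s\<^sup>2 * real d / 7 \<le> V x"
proof (rule ccontr)
  assume "\<not> s\<^sup>2 * real d / 7 \<le> V x"
  then have V: "V x < real n * R / 7" using real_n_pos by (simp add: R_def)
  have nR: "real n * R \<le> real n * theta_min d \<theta>s / 400" using R_le real_n_pos by simp
  have term_ge: "real n / 7 * ((full d x j - full d mle j)\<^sup>2 / full d \<theta>s j)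
     \<le> real (N j) * entropy_gap (full d x j / full d mle j)" if j: "j \<le> d" for j
  proof -
    define y where "y = full d x j / full d mle j"
    have pos: "full d \<theta>s j > 0" "full d mle j > 0" using full_pos[OF \<theta>s j] full_pos[OF mle_Theta j] by auto
    have y: "y > 0" using full_pos[OF x(1) j] pos by (simp add: y_def)
    have Nj: "real (N j) = real n * full d mle j" using full_mle[OF j] real_n_pos by simp
    have m: "full d mle j \<ge> 19 / 20 * full d \<theta>s j" "full d mle j \<le> 21 / 20 * full d \<theta>s j"
      using rel_mle[OF j] by linarith+
    have "real (N j) * entropy_gap y \<le> V x"
      unfolding V_def y_def using V_term_nonneg[OF x(1)] j by (intro member_le_sum) auto
    also have "\<dots> < real n * theta_min d \<theta>s / 2800" using V nR by linarith
    also have "\<dots> \<le> real n * full d \<theta>s j / 2800"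
      using theta_min_le[OF j] real_n_pos by (simp add: mult_left_mono)
    also have "\<dots> \<le> real n * (20 / 19 * full d mle j) / 2800"
      using m real_n_pos by (intro divide_right_mono mult_left_mono) auto
    also have "\<dots> \<le> real n * full d mle j * (1 / 6)"
      using pos real_n_pos by simp
    finally have "real (N j) * entropy_gap y < real (N j) * (1 / 6)" unfolding Nj by (simp add: mult.assoc)
    then have "entropy_gap y < 1 / 6" using Npos[OF j] by (simp add: mult_less_cancel_left)
    then have "real (N j) * ((y - 1)\<^sup>2 / 6) \<le> real (N j) * entropy_gap y"
      by (intro mult_left_mono entropy_gap_quadratic y) auto
    moreover have "real (N j) * ((y - 1)\<^sup>2 / 6) = real n / 6 * ((full d x j - full d mle j)\<^sup>2 / full d mle j)"
      unfolding Nj y_def using pos by (simp add: field_simps power2_eq_square)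
    moreover have "real n / 7 * ((full d x j - full d mle j)\<^sup>2 / full d \<theta>s j)
        \<le> real n / 6 * ((full d x j - full d mle j)\<^sup>2 / full d mle j)"
    proof -
      have "6 * full d mle j \<le> 7 * full d \<theta>s j" using m(2) pos by linarith
      then have "1 / (7 * full d \<theta>s j) \<le> 1 / (6 * full d mle j)"
        using pos by (intro divide_left_mono) auto
      then have "real n * (full d x j - full d mle j)\<^sup>2 * (1 / (7 * full d \<theta>s j))
        \<le> real n * (full d x j - full d mle j)\<^sup>2 * (1 / (6 * full d mle j))"
        using real_n_pos by (intro mult_left_mono) auto
      then show ?thesis by simp
    qed
    ultimately show ?thesis unfolding y_def by linarith
  qed
  have "real n / 7 * fisher_sq d \<theta>s (\<lambda>j. x j - mle j) \<le> V x"
    unfolding fisher_sq_full V_def sum_distrib_left by (intro sum_mono term_ge) auto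
  with V have "real n / 7 * fisher_sq d \<theta>s (\<lambda>j. x j - mle j) \<le> real n / 7 * R" by simp
  then have "fisher_sq d \<theta>s (\<lambda>j. x j - mle j) \<le> R" using real_n_pos by (simp add: mult_le_cancel_left)
  moreover have "fisher_sq d \<theta>s (\<lambda>j. mle j - \<theta>s j) \<le> R" using chi by (simp add: R_def)
  ultimately have "fisher_sq d \<theta>s (\<lambda>j. x j - \<theta>s j) \<le> 4 * R"
    using fisher_sq_add_le[OF \<theta>s, of x \<theta>s mle] by linarith
  then have "x \<in> U" using x by (simp add: U_eq Theta_def)
  with x show False by simp
qed

definition tail :: real where "tail = 2 ^ d * exp (- (s\<^sup>2 * real d / 14))"

lemma integrable_on:
  assumes "integrable (lborel_d d) f" "A \<in> sets (lborel_d d)"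
  shows "integrable (lborel_d d) (\<lambda>x. indicator A x * f x :: real)"
  using integrable_mult_indicator[OF assms(2,1)] by simp

lemma integral_split_U:
  fixes f :: "(nat \<Rightarrow> real) \<Rightarrow> real"
  assumes f: "integrable (lborel_d d) f"
  shows "(\<integral>x. f x \<partial>lborel_d d)
    = (\<integral>x. indicator U x * f x \<partial>lborel_d d) + (\<integral>x. indicator (space (lborel_d d) - U) x * f x \<partial>lborel_d d)"
proof -
  have "(\<integral>x. f x \<partial>lborel_d d) = (\<integral>x. indicator U x * f x + indicator (space (lborel_d d) - U) x * f x \<partial>lborel_d d)"
    by (intro Bochner_Integration.integral_cong) (auto simp: indicator_def)
  also have "\<dots> = (\<integral>x. indicator U x * f x \<partial>lborel_d d) + (\<integral>x. indicator (space (lborel_d d) - U) x * f x \<partial>lborel_d d)"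
    by (intro Bochner_Integration.integral_add integrable_on f sets.Diff sets.top U_measurable)
  finally show ?thesis .
qed

lemma p_outside_U: "(\<integral>x. indicator (space (lborel_d d) - U) x * p x \<partial>lborel_d d) \<le> tail"
proof -
  have "(\<integral>x. indicator (space (lborel_d d) - U) x * p x \<partial>lborel_d d) \<le> 2 ^ d * exp (- (s\<^sup>2 * real d / 7) / 2)"
    using V_large_outside_U by (intro p_tail sets.Diff sets.top U_measurable) auto
  also have "\<dots> = tail" by (simp add: tail_def)
  finally show ?thesis .
qed

text \<open>For \<open>s \<ge> 10\<close> one has \<open>s / 3 \<le> s^2 / 30\<close> and
  \<open>1 \<le> s^2 / 100\<close>, and \<open>1 / 30 + 1 / 100 + 1 / 50\<close> is below
  \<open>1 / 14\<close>; this is the origin of \<open>1 / 50\<close>. The factor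
  \<open>exp (s * d / 3)\<close> is what the variation of the prior on \<open>U\<close> can
  cost.\<close>

lemma tail_le: "exp (s * real d / 3) * tail \<le> exp (- (real d * (1 / 50 * s\<^sup>2)))" "tail \<le> exp (- (real d * (1 / 50 * s\<^sup>2)))"
  "tail \<le> 1 / 2"
proof -
  have dd: "real d \<ge> 1" using d by simp
  have s2: "s\<^sup>2 \<ge> 10 * s" using s mult_right_mono[of 10 s s] by (auto simp: power2_eq_square)
  then have s3: "s\<^sup>2 \<ge> 100" using s by linarith
  have "(2::real) ^ d \<le> exp 1 ^ d" using exp_ge_add_one_self[of 1] by (intro power_mono) auto
  also have "\<dots> = exp (real d)" by (simp add: exp_of_nat_mult[symmetric])
  finally have "tail \<le> exp (real d) * exp (- (s\<^sup>2 * real d / 14))"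
    by (simp add: tail_def)
  then have t: "tail \<le> exp (real d + - (s\<^sup>2 * real d / 14))" by (simp add: mult_exp_exp)
  then have "exp (s * real d / 3) * tail \<le> exp (s * real d / 3) * exp (real d + - (s\<^sup>2 * real d / 14))"
    by (intro mult_left_mono) auto
  also have "\<dots> = exp (real d * (s / 3 + 1 - s\<^sup>2 / 14))" by (simp add: mult_exp_exp algebra_simps)
  also have "real d * (s / 3 + 1 - s\<^sup>2 / 14) \<le> real d * (- (1 / 50 * s\<^sup>2))"
    using s2 s3 dd by (intro mult_left_mono) auto
  finally show e: "exp (s * real d / 3) * tail \<le> exp (- (real d * (1 / 50 * s\<^sup>2)))" by simp
  have "1 * tail \<le> exp (s * real d / 3) * tail"
    using s by (intro mult_right_mono) (auto simp: tail_def)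
  with e show t2: "tail \<le> exp (- (real d * (1 / 50 * s\<^sup>2)))" by simp
  have "1 * 2 \<le> real d * (1 / 50 * s\<^sup>2)" using dd s3 by (intro mult_mono) auto
  then have "exp (- (real d * (1 / 50 * s\<^sup>2))) \<le> exp (- 1)" by simp
  also have "\<dots> \<le> 1 / 2" using exp_ge_add_one_self[of 1] by (simp add: exp_minus field_simps)
  finally show "tail \<le> 1 / 2" using t2 by simp
qed

lemma tail_nonneg: "0 \<le> tail"
  by (simp add: tail_def)

text \<open>The prior need not be nonnegative outside \<open>Rd d\<close>.\<close>
definition g :: "(nat \<Rightarrow> real) \<Rightarrow> real" where "g x = max 0 (\<pi>0 x)"

lemma g_measurable [measurable]: "g \<in> borel_measurable (lborel_d d)"
  using prior unfolding g_def prior_density_def by (auto intro!: borel_measurable_max)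

lemma g_nonneg: "0 \<le> g x"
  by (simp add: g_def)

lemma g_eq: "x \<in> Rd d \<Longrightarrow> g x = \<pi>0 x"
  using prior by (auto simp: g_def prior_density_def)

lemma U_Rd: "U \<subseteq> Rd d"
  by (auto simp: U_eq)

lemma g_pos: "x \<in> Theta d \<Longrightarrow> 0 < g x"
  using prior g_eq[of x] by (auto simp: prior_density_def Theta_def)

lemma integrable_g: "integrable (lborel_d d) g"
proof (rule integrableI_nonneg)
  have "(\<integral>\<^sup>+x. ennreal (g x) \<partial>lborel_d d) = (\<integral>\<^sup>+x. ennreal (\<pi>0 x) \<partial>lborel_d d)"
    by (intro nn_integral_cong) (auto simp: g_eq space_PiM)
  then show "(\<integral>\<^sup>+x. ennreal (g x) \<partial>lborel_d d) < \<infinity>"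
    using prior by (simp add: prior_density_def)
  show "g \<in> borel_measurable (lborel_d d)" by (rule g_measurable)
qed (simp add: g_nonneg)

lemma p_le_mle: "p x \<le> p mle"
proof (cases "x \<in> Theta d")
  case True
  then show ?thesis using p_eq_V[OF True] V_nonneg[OF True] p_pos[OF mle_Theta] by (simp add: mult_left_le)
next
  case False
  then show ?thesis using p_outside dir_density_nonneg by simp
qed

lemma integrable_pg: "integrable (lborel_d d) (\<lambda>x. p x * g x)"
proof (rule Bochner_Integration.integrable_bound)
  show "integrable (lborel_d d) (\<lambda>x. p mle * g x)" using integrable_g by simp
  show "AE x in lborel_d d. norm (p x * g x) \<le> norm (p mle * g x)"
    using p_le_mle g_nonneg dir_density_nonneg by (intro AE_I2) (simp add: abs_mult mult_right_mono)
qed measurable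

lemma ln_g_lipschitz:
  assumes "x \<in> U" "y \<in> U"
  shows "\<bar>ln (g y) - ln (g x)\<bar> \<le> \<delta> * sqrt (fisher_sq d \<theta>s (\<lambda>j. y j - x j))"
proof -
  have "0 \<le> 2 * s" using s by simp
  moreover have "g x = \<pi>0 x" "g y = \<pi>0 y" using assms U_Rd g_eq by blast+
  ultimately show ?thesis using ln_prior_lipschitz[OF \<theta>s _ \<delta>(1) assms] by simp
qed

text \<open>The upper bound on \<open>\<delta>\<close> is chosen for this product with the radius of
  \<open>U\<close>: \<open>sqrt (n * d) / 6\<close> times \<open>2 * s * sqrt (d / n)\<close> is
  \<open>s * d / 3\<close>.\<close>

lemma delta_R: "\<delta> * sqrt (4 * R) \<le> s * real d / 3"
proof -
  have "\<delta> * sqrt (4 * R) \<le> sqrt (real n * real d) / 6 * sqrt (4 * R)"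
    using \<delta> R_nonneg by (intro mult_right_mono) auto
  also have "\<dots> = sqrt ((real n * real d) * (4 * R)) / 6" by (simp add: real_sqrt_mult)
  also have "(real n * real d) * (4 * R) = (2 * s * real d)\<^sup>2"
    using real_n_pos by (simp add: R_def power2_eq_square)
  also have "sqrt ((2 * s * real d)\<^sup>2) / 6 = s * real d / 3" using s by simp
  finally show ?thesis .
qed

lemma g_bounds:
  assumes x: "x \<in> U"
  shows "g \<theta>s * exp (- (s * real d / 3)) \<le> g x" "g x \<le> g \<theta>s * exp (s * real d / 3)"
proof -
  have "\<bar>ln (g x) - ln (g \<theta>s)\<bar> \<le> \<delta> * sqrt (fisher_sq d \<theta>s (\<lambda>j. x j - \<theta>s j))"
    by (rule ln_g_lipschitz[OF \<theta>s_U x])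
  also have "\<dots> \<le> \<delta> * sqrt (4 * R)" using x \<delta> by (intro mult_left_mono) (auto simp: U_eq)
  finally have l: "\<bar>ln (g x) - ln (g \<theta>s)\<bar> \<le> s * real d / 3" using delta_R by linarith
  then have l: "- (s * real d / 3) \<le> ln (g x) - ln (g \<theta>s)" "ln (g x) - ln (g \<theta>s) \<le> s * real d / 3"
    by linarith+
  have pos: "g x > 0" "g \<theta>s > 0" using g_pos x \<theta>s U_Theta by auto
  have e: "g x = g \<theta>s * exp (ln (g x) - ln (g \<theta>s))" using pos by (simp add: exp_diff)
  show "g \<theta>s * exp (- (s * real d / 3)) \<le> g x"
    using l pos by (subst e, intro mult_left_mono) auto
  show "g x \<le> g \<theta>s * exp (s * real d / 3)"
    using l pos by (subst e, intro mult_left_mono) auto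
qed

section \<open>Masses of the ellipsoid and the comparison of the two posteriors on it\<close>

definition D_U :: real where "D_U = (\<integral>x. indicator U x * p x \<partial>lborel_d d)"
definition Z_U :: real where "Z_U = (\<integral>x. indicator U x * (p x * g x) \<partial>lborel_d d)"
definition Z :: real where "Z = (\<integral>x. p x * g x \<partial>lborel_d d)"

lemma D_U: "1 - tail \<le> D_U" "1 / 2 \<le> D_U"
  using integral_split_U[OF integrable_p] p_outside_U integral_p tail_le(3) by (auto simp: D_U_def)

lemma Z_U_lower: "g \<theta>s * exp (- (s * real d / 3)) / 2 \<le> Z_U"
proof -
  have "g \<theta>s * exp (- (s * real d / 3)) / 2 \<le> g \<theta>s * exp (- (s * real d / 3)) * D_U"
    using mult_left_mono[OF D_U(2), of "g \<theta>s * exp (- (s * real d / 3))"] g_nonneg[of \<theta>s] by simp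
  also have "\<dots> = (\<integral>x. g \<theta>s * exp (- (s * real d / 3)) * (indicator U x * p x) \<partial>lborel_d d)"
    by (simp add: D_U_def)
  also have "\<dots> \<le> Z_U"
    unfolding Z_U_def
  proof (rule integral_mono)
    show "integrable (lborel_d d) (\<lambda>x. g \<theta>s * exp (- (s * real d / 3)) * (indicator U x * p x))"
      by (intro integrable_mult_right integrable_on integrable_p U_measurable)
    show "integrable (lborel_d d) (\<lambda>x. indicator U x * (p x * g x))"
      by (intro integrable_on integrable_pg U_measurable)
    show "g \<theta>s * exp (- (s * real d / 3)) * (indicator U x * p x) \<le> indicator U x * (p x * g x)" for x
      using mult_right_mono[OF g_bounds(1) dir_density_nonneg[of d N x]] by (auto simp: indicator_def mult.commute)
  qed
  finally show ?thesis .
qed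

lemma Z_pos: "0 < Z_U" "Z_U \<le> Z" "0 < Z"
proof -
  show "0 < Z_U" using Z_U_lower g_pos[OF \<theta>s] by (meson divide_pos_pos exp_gt_zero mult_pos_pos order_less_le_trans zero_less_numeral)
  moreover have "0 \<le> (\<integral>x. indicator (space (lborel_d d) - U) x * (p x * g x) \<partial>lborel_d d)"
    using g_nonneg dir_density_nonneg by (intro integral_nonneg_AE) auto
  then show "Z_U \<le> Z" using integral_split_U[OF integrable_pg] by (simp add: Z_def Z_U_def)
  ultimately show "0 < Z" by simp
qed

text \<open>Outside \<open>U\<close> the prior is controlled only by \<open>K\<close> times its
  value at \<open>\<theta>s\<close>, so the numerator is at most \<open>K * gs * tail\<close>. The
  denominator is replaced by the mass of \<open>U\<close>, where the prior may be smaller than at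
  \<open>\<theta>s\<close> by the factor \<open>exp (- s * d / 3)\<close>.\<close>

lemma prior_mass_outside:
  assumes K: "\<And>x. x \<in> Theta d \<Longrightarrow> \<pi>0 x / \<pi>0 \<theta>s \<le> K"
  shows "(Z - Z_U) / Z \<le> 2 * K * exp (- (real d * (1 / 50 * s\<^sup>2)))"
proof -
  define gs where "gs = g \<theta>s"
  have gs: "gs > 0" "gs = \<pi>0 \<theta>s" using g_pos[OF \<theta>s] g_eq[of \<theta>s] \<theta>s by (auto simp: gs_def Theta_def)
  have "\<pi>0 \<theta>s > 0" using gs by simp
  then have K0: "0 \<le> K" using K[OF \<theta>s] by simp
  have gK: "p x * g x \<le> K * gs * p x" for x
  proof (cases "x \<in> Theta d")
    case True
    then have "g x \<le> K * gs" using K[OF True] gs g_eq[of x] by (simp add: pos_divide_le_eq Theta_def)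
    from mult_right_mono[OF this dir_density_nonneg[of d N x]] show ?thesis by (simp add: mult.commute)
  qed (simp add: p_outside)
  have "Z - Z_U = (\<integral>x. indicator (space (lborel_d d) - U) x * (p x * g x) \<partial>lborel_d d)"
    using integral_split_U[OF integrable_pg] by (simp add: Z_def Z_U_def)
  also have "\<dots> \<le> (\<integral>x. K * gs * (indicator (space (lborel_d d) - U) x * p x) \<partial>lborel_d d)"
  proof (rule integral_mono)
    show "integrable (lborel_d d) (\<lambda>x. indicator (space (lborel_d d) - U) x * (p x * g x))"
      by (intro integrable_on integrable_pg sets.Diff sets.top U_measurable)
    show "integrable (lborel_d d) (\<lambda>x. K * gs * (indicator (space (lborel_d d) - U) x * p x))"
      by (intro integrable_mult_right integrable_on integrable_p sets.Diff sets.top U_measurable)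
    show "indicator (space (lborel_d d) - U) x * (p x * g x) \<le> K * gs * (indicator (space (lborel_d d) - U) x * p x)" for x
      using gK[of x] by (auto simp: indicator_def)
  qed
  also have "\<dots> \<le> K * gs * tail"
    using p_outside_U K0 gs by (simp add: mult_left_mono)
  finally have num: "Z - Z_U \<le> K * gs * tail" .
  have "(Z - Z_U) / Z \<le> (Z - Z_U) / Z_U" using Z_pos by (intro divide_left_mono) auto
  also have "\<dots> \<le> (K * gs * tail) / (gs * exp (- (s * real d / 3)) / 2)"
    using num Z_U_lower gs K0 tail_nonneg by (intro frac_le) (auto simp: gs_def[symmetric])
  also have "\<dots> = 2 * K * (exp (s * real d / 3) * tail)" using gs by (simp add: exp_minus field_simps)
  also have "\<dots> \<le> 2 * K * exp (- (real d * (1 / 50 * s\<^sup>2)))"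
    using K0 by (intro mult_left_mono tail_le) auto
  finally show ?thesis .
qed

text \<open>The square of a prior density need not be integrable; on \<open>U\<close> the Lipschitz
  estimate bounds it.\<close>

lemma integrable_pgg: "integrable (lborel_d d) (\<lambda>x. indicator U x * p x * (g x)\<^sup>2)"
proof (rule Bochner_Integration.integrable_bound)
  define c where "c = g \<theta>s * exp (s * real d / 3)"
  show "integrable (lborel_d d) (\<lambda>x. c\<^sup>2 * p x)" using integrable_p by simp
  show "AE x in lborel_d d. norm (indicator U x * p x * (g x)\<^sup>2) \<le> norm (c\<^sup>2 * p x)"
  proof (intro AE_I2)
    fix x
    show "norm (indicator U x * p x * (g x)\<^sup>2) \<le> norm (c\<^sup>2 * p x)"
    proof (cases "x \<in> U")
      case True
      have "(g x)\<^sup>2 \<le> c\<^sup>2" using g_bounds(2)[OF True] g_nonneg by (intro power_mono) (auto simp: c_def)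
      then show ?thesis using True dir_density_nonneg[of d N x] by (simp add: abs_mult mult.commute mult_left_mono)
    qed simp
  qed
qed measurable

text \<open>Prekopa-Leindler: the concavity of \<open>ln p\<close> on \<open>U\<close> absorbs the variation of \<open>ln g\<close>.\<close>
lemma midpoint_inequality:
  assumes x: "x \<in> U" and y: "y \<in> U" and z: "z = (\<lambda>i\<in>{1..d}. (x i + y i) / 2)"
  shows "z \<in> U" "p x * (g x)\<^sup>2 * p y \<le> exp (2 * \<delta>\<^sup>2 / real n) * (p z * g z)\<^sup>2"
proof -
  have zU: "z \<in> U"
  proof -
    have "z = along d x (\<lambda>j. y j - x j) (1 / 2)"
      unfolding z along_def by (intro restrict_ext) (simp add: field_simps)
    then show ?thesis using Ustar_convex[OF \<theta>s _ x y, of "1 / 2"] s by simp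
  qed
  then show "z \<in> U" .
  note T = U_Theta[THEN subsetD]
  define Q where "Q = fisher_sq d \<theta>s (\<lambda>j. x j - y j)"
  define r where "r = sqrt Q"
  have Q: "Q \<ge> 0" unfolding Q_def by (rule fisher_sq_nonneg[OF \<theta>s])
  have r: "r \<ge> 0" "r\<^sup>2 = Q" using Q by (auto simp: r_def)
  have "p x * p y \<le> (p z)\<^sup>2 * exp (- (\<Sum>j\<le>d. real (N j) * ((full d x j - full d y j)\<^sup>2 / (4 * (full d z j)\<^sup>2))))"
    by (rule dir_density_midpoint[OF T[OF x] T[OF y] z])
  also have "\<dots> \<le> (p z)\<^sup>2 * exp (- (real n / 8 * Q))"
  proof (intro mult_left_mono, unfold exp_le_cancel_iff neg_le_iff_le)
    \<comment> \<open>With \<open>full d z j \<le> 11 / 10 * full d \<theta>s j\<close> and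
      \<open>full d mle j \<ge> 19 / 20 * full d \<theta>s j\<close>, at least half of the curvature
      \<open>n / 4\<close> at the truth survives, as
      \<open>121 / 100 \<le> 2 * 19 / 20\<close>.\<close>
    show "real n / 8 * Q \<le> (\<Sum>j\<le>d. real (N j) * ((full d x j - full d y j)\<^sup>2 / (4 * (full d z j)\<^sup>2)))"
      unfolding Q_def fisher_sq_full sum_distrib_left
    proof (rule sum_mono)
      fix j assume "j \<in> {..d}"
      then have j: "j \<le> d" by simp
      have pos: "full d \<theta>s j > 0" "full d z j > 0" using full_pos[OF \<theta>s j] full_pos[OF T[OF zU] j] by auto
      have Nj: "real (N j) = real n * full d mle j" using full_mle[OF j] real_n_pos by simp
      have m: "full d mle j \<ge> 19 / 20 * full d \<theta>s j" using rel_mle[OF j] by linarith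
      have zj: "full d z j \<le> 11 / 10 * full d \<theta>s j" using rel_U[OF zU j] by linarith
      have "(full d z j)\<^sup>2 \<le> (11 / 10 * full d \<theta>s j)\<^sup>2" using zj pos by (intro power_mono) auto
      also have "\<dots> = 121 / 100 * full d \<theta>s j * full d \<theta>s j" by (simp add: power2_eq_square)
      also have "\<dots> \<le> 2 * (19 / 20 * full d \<theta>s j) * full d \<theta>s j"
        using pos by (intro mult_right_mono) auto
      also have "\<dots> \<le> 2 * full d mle j * full d \<theta>s j" using m pos by (intro mult_right_mono mult_left_mono) auto
      finally have "4 * (full d z j)\<^sup>2 \<le> 8 * full d mle j * full d \<theta>s j" by linarith
      then have "real n * full d mle j * (full d x j - full d y j)\<^sup>2 / (8 * full d mle j * full d \<theta>s j)
          \<le> real n * full d mle j * (full d x j - full d y j)\<^sup>2 / (4 * (full d z j)\<^sup>2)"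
        using pos full_pos[OF mle_Theta j] by (intro divide_left_mono) auto
      moreover have "real n * full d mle j * (full d x j - full d y j)\<^sup>2 / (8 * full d mle j * full d \<theta>s j)
          = real n / 8 * ((full d x j - full d y j)\<^sup>2 / full d \<theta>s j)"
        using full_pos[OF mle_Theta j] by simp
      ultimately show "real n / 8 * ((full d x j - full d y j)\<^sup>2 / full d \<theta>s j)
          \<le> real (N j) * ((full d x j - full d y j)\<^sup>2 / (4 * (full d z j)\<^sup>2))"
        unfolding Nj by simp
    qed
  qed simp
  finally have pp: "p x * p y \<le> (p z)\<^sup>2 * exp (- (real n / 8 * Q))" .
  have gg: "(g x)\<^sup>2 \<le> (g z)\<^sup>2 * exp (\<delta> * r)"
  proof -
    \<comment> \<open>The way from \<open>x\<close> to \<open>z\<close> is half that to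
      \<open>y\<close>, so \<open>ln g\<close> changes by at most \<open>\<delta> * r / 2\<close>;
      squaring \<open>g\<close> doubles this.\<close>
    have quarter: "fisher_sq d \<theta>s (\<lambda>j. x j - z j) = Q / 4"
    proof -
      have half: "full d x j - full d z j = (full d x j - full d y j) / 2" if "j \<le> d" for j
        unfolding z full_midpoint[OF that] by (simp add: field_simps)
      have "(full d x j - full d z j)\<^sup>2 / full d \<theta>s j = (full d x j - full d y j)\<^sup>2 / full d \<theta>s j / 4"
        if "j \<le> d" for j
        unfolding half[OF that] by (simp add: power_divide)
      then show ?thesis
        unfolding Q_def fisher_sq_full sum_divide_distrib by (intro sum.cong) auto
    qed
    have sqrt_quarter: "sqrt (Q / 4) = r / 2" by (simp add: r_def real_sqrt_divide)
    have "\<bar>ln (g x) - ln (g z)\<bar> \<le> \<delta> * (r / 2)"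
      using ln_g_lipschitz[OF zU x] unfolding quarter sqrt_quarter .
    then have le: "ln (g x) \<le> ln (g z) + \<delta> * r / 2" by linarith
    have gp: "g x > 0" "g z > 0" using g_pos T x zU by auto
    have "g x = exp (ln (g x))" using gp by simp
    also have "\<dots> \<le> exp (ln (g z) + \<delta> * r / 2)" using le by simp
    also have "\<dots> = g z * exp (\<delta> * r / 2)" using gp by (simp add: exp_add)
    finally have "(g x)\<^sup>2 \<le> (g z * exp (\<delta> * r / 2))\<^sup>2" using gp by (intro power_mono) auto
    also have "\<dots> = (g z)\<^sup>2 * exp (\<delta> * r)" by (simp add: power_mult_distrib power2_eq_square mult_exp_exp)
    finally show ?thesis .
  qed
  have "p x * (g x)\<^sup>2 * p y = (p x * p y) * (g x)\<^sup>2" by simp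
  also have "\<dots> \<le> ((p z)\<^sup>2 * exp (- (real n / 8 * Q))) * ((g z)\<^sup>2 * exp (\<delta> * r))"
    using dir_density_nonneg by (intro mult_mono[OF pp gg]) (simp_all add: mult_nonneg_nonneg)
  also have "\<dots> = exp (\<delta> * r - real n / 8 * r\<^sup>2) * (p z * g z)\<^sup>2"
    unfolding r(2) by (simp add: power_mult_distrib exp_add[symmetric] mult.commute mult.left_commute mult_exp_exp)
  also have "\<dots> \<le> exp (2 * \<delta>\<^sup>2 / real n) * (p z * g z)\<^sup>2"
  proof (intro mult_right_mono, unfold exp_le_cancel_iff)
    \<comment> \<open>Completing the square: \<open>\<delta> * r - n * r^2 / 8\<close> is largest at
      \<open>r = 4 * \<delta> / n\<close>.\<close>
    have "0 \<le> (real n * r - 4 * \<delta>)\<^sup>2" by simp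
    then have "8 * real n * (\<delta> * r) \<le> real n * real n * r\<^sup>2 + 16 * \<delta>\<^sup>2"
      by (simp add: power2_eq_square algebra_simps)
    then have "8 * real n * (\<delta> * r) / (8 * real n) \<le> (real n * real n * r\<^sup>2 + 16 * \<delta>\<^sup>2) / (8 * real n)"
      using real_n_pos by (intro divide_right_mono) auto
    then show "\<delta> * r - real n / 8 * r\<^sup>2 \<le> 2 * \<delta>\<^sup>2 / real n"
      using real_n_pos by (simp add: add_divide_distrib)
  qed simp
  finally show "p x * (g x)\<^sup>2 * p y \<le> exp (2 * \<delta>\<^sup>2 / real n) * (p z * g z)\<^sup>2" .
qed

text \<open>Prekopa-Leindler for \<open>p * g^2\<close>, \<open>p\<close> and
  \<open>c * (p * g)\<close>, all restricted to the convex set \<open>U\<close>. The product of the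
  first two integrals over \<open>Z_U^2\<close> is the second moment of the density of the general
  with respect to the flat posterior on \<open>U\<close>, so a chi-square bound of order
  \<open>\<delta>^2 / n\<close> results without a spectral gap estimate.\<close>

lemma chi_square_bound:
  "(\<integral>x. indicator U x * p x * (g x)\<^sup>2 \<partial>lborel_d d) * D_U \<le> exp (2 * \<delta>\<^sup>2 / real n) * Z_U\<^sup>2"
proof -
  define c where "c = exp (\<delta>\<^sup>2 / real n)"
  have c: "c\<^sup>2 = exp (2 * \<delta>\<^sup>2 / real n)" by (simp add: c_def power2_eq_square mult_exp_exp)
  define W where "W = (\<integral>x. indicator U x * p x * (g x)\<^sup>2 \<partial>lborel_d d)"
  have W0: "W \<ge> 0" unfolding W_def using dir_density_nonneg by (intro integral_nonneg_AE) auto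
  have nnW: "(\<integral>\<^sup>+x. ennreal (indicator U x * p x * (g x)\<^sup>2) \<partial>lborel_d d) = ennreal W"
    unfolding W_def using integrable_pgg dir_density_nonneg by (intro nn_integral_eq_integral) auto
  have nnD: "(\<integral>\<^sup>+x. ennreal (indicator U x * p x) \<partial>lborel_d d) = ennreal D_U"
    unfolding D_U_def using dir_density_nonneg
    by (intro nn_integral_eq_integral integrable_on integrable_p U_measurable) auto
  have nnZ: "(\<integral>\<^sup>+x. ennreal (c * (indicator U x * (p x * g x))) \<partial>lborel_d d) = ennreal (c * Z_U)"
  proof -
    have "integrable (lborel_d d) (\<lambda>x. c * (indicator U x * (p x * g x)))"
      by (intro integrable_mult_right integrable_on integrable_pg U_measurable)
    then have "(\<integral>\<^sup>+x. ennreal (c * (indicator U x * (p x * g x))) \<partial>lborel_d d)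
        = ennreal (\<integral>x. c * (indicator U x * (p x * g x)) \<partial>lborel_d d)"
      using dir_density_nonneg g_nonneg by (intro nn_integral_eq_integral) (auto simp: c_def)
    then show ?thesis by (simp add: Z_U_def)
  qed
  have "ennreal W * ennreal D_U \<le> (ennreal (c * Z_U))\<^sup>2"
    unfolding nnW[symmetric] nnD[symmetric] nnZ[symmetric]
  proof (rule prekopa_leindler_PiM)
    fix x y assume "x \<in> Rd d" "y \<in> Rd d"
    let ?z = "\<lambda>i\<in>{1..d}. (x i + y i) / 2"
    show "ennreal (indicator U x * p x * (g x)\<^sup>2) * ennreal (indicator U y * p y)
      \<le> (ennreal (c * (indicator U ?z * (p ?z * g ?z))))\<^sup>2"
    proof (cases "x \<in> U \<and> y \<in> U")
      case True
      then have m: "?z \<in> U" "p x * (g x)\<^sup>2 * p y \<le> c\<^sup>2 * (p ?z * g ?z)\<^sup>2"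
        using midpoint_inequality[of x y ?z] unfolding c by auto
      have "ennreal (p x * (g x)\<^sup>2) * ennreal (p y) = ennreal (p x * (g x)\<^sup>2 * p y)"
        using dir_density_nonneg by (intro ennreal_mult'[symmetric]) auto
      also have "\<dots> \<le> ennreal ((c * (p ?z * g ?z))\<^sup>2)"
        using m(2) by (intro ennreal_leI) (simp add: power_mult_distrib)
      also have "\<dots> = (ennreal (c * (p ?z * g ?z)))\<^sup>2"
        using dir_density_nonneg g_nonneg by (intro ennreal_power[symmetric]) (simp add: c_def)
      finally show ?thesis using True m(1) by simp
    qed auto
  qed measurable
  also have "(ennreal (c * Z_U))\<^sup>2 = ennreal ((c * Z_U)\<^sup>2)"
    using Z_pos by (intro ennreal_power) (simp add: c_def)
  finally have "ennreal (W * D_U) \<le> ennreal ((c * Z_U)\<^sup>2)"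
    using W0 by (simp add: ennreal_mult')
  then have "W * D_U \<le> (c * Z_U)\<^sup>2" by (subst (asm) ennreal_le_iff) auto
  then show ?thesis by (simp add: W_def power_mult_distrib c)
qed

section \<open>The total variation bound\<close>

lemma posterior_eq: "posterior n d N \<pi>0 = density (lborel_d d) (\<lambda>x. ennreal (p x * g x / Z))"
proof -
  define c :: real where "c = fact ((\<Sum>j\<le>d. N j) + d) / (\<Prod>j\<le>d. fact (N j))"
  have c: "c > 0" unfolding c_def by (intro divide_pos_pos prod_pos) auto
  have p: "p x = c * dir_weight d N x" for x by (simp add: dir_density_def c_def)
  define w where "w x = ennreal (exp (- real n * nll n d N x) * \<pi>0 x) * indicator (Theta d) x" for x
  have w: "w x = ennreal (dir_weight d N x * g x)" if x: "x \<in> Rd d" for x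
  proof (cases "x \<in> Theta d")
    case True
    have "exp (- real n * nll n d N x) = (\<Prod>j\<le>d. full d x j ^ N j)"
      using nll_eq[OF True] full_pos[OF True] by (simp add: exp_sum exp_of_nat_mult)
    then show ?thesis using True g_eq[OF x] by (simp add: w_def dir_weight_def)
  qed (simp add: w_def dir_weight_def)
  have "(\<integral>\<^sup>+x. w x \<partial>lborel_d d) = (\<integral>\<^sup>+x. ennreal (1 / c * (p x * g x)) \<partial>lborel_d d)"
    using c by (intro nn_integral_cong) (simp add: w p space_PiM)
  also have "\<dots> = ennreal (\<integral>x. 1 / c * (p x * g x) \<partial>lborel_d d)"
    using c dir_density_nonneg g_nonneg integrable_pg by (intro nn_integral_eq_integral integrable_mult_right) auto
  also have "(\<integral>x. 1 / c * (p x * g x) \<partial>lborel_d d) = Z / c" by (simp add: Z_def)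
  finally have W: "(\<integral>\<^sup>+x. w x \<partial>lborel_d d) = ennreal (Z / c)" .
  have "posterior n d N \<pi>0 = density (lborel_d d) (\<lambda>x. w x / (\<integral>\<^sup>+x. w x \<partial>lborel_d d))"
    by (simp add: posterior_def Let_def w_def)
  also have "\<dots> = density (lborel_d d) (\<lambda>x. ennreal (p x * g x / Z))"
  proof (rule density_cong)
    have "w x / ennreal (Z / c) = ennreal (p x * g x / Z)" if x: "x \<in> Rd d" for x
      using c Z_pos(3) dir_weight_nonneg g_nonneg w[OF x] by (simp add: p divide_ennreal)
    then show "AE x in lborel_d d. w x / (\<integral>\<^sup>+x. w x \<partial>lborel_d d) = ennreal (p x * g x / Z)"
      unfolding W by (intro AE_I2) (simp add: space_PiM)
    show "(\<lambda>x. ennreal (p x * g x / Z)) \<in> borel_measurable (lborel_d d)" by measurable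
    have "(\<lambda>x. ennreal (dir_weight d N x * g x)) \<in> borel_measurable (lborel_d d)" by measurable
    then have "w \<in> borel_measurable (lborel_d d)"
      by (rule measurable_cong[THEN iffD1, rotated]) (simp add: w space_PiM)
    then show "(\<lambda>x. w x / (\<integral>\<^sup>+x. w x \<partial>lborel_d d)) \<in> borel_measurable (lborel_d d)" by measurable
  qed
  finally show ?thesis .
qed

definition q :: "(nat \<Rightarrow> real) \<Rightarrow> real" where "q = gauss_density n d \<theta>s mle"

lemma integrable_q: "integrable (lborel_d d) q" and integral_q: "(\<integral>x. q x \<partial>lborel_d d) = 1"
  using gauss_density_integral[OF \<theta>s n, of mle] by (auto simp: q_def has_bochner_integral_iff)

text \<open>\<open>P1\<close> and \<open>P2\<close> belong to the general and the flat posterior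
  conditioned on \<open>U\<close>, \<open>P3\<close> to the flat posterior itself. The four
  distances along \<open>P\<close>, \<open>P1\<close>, \<open>P2\<close>, \<open>P3\<close>,
  \<open>G\<close> are at most \<open>2 * K * t\<close>, \<open>\<kappa>\<close>, \<open>t\<close>
  and \<open>75 / 2 * a\<close>, and 40 covers their sum.\<close>

lemma event_bound:
  assumes B: "B \<in> sets (lborel_d d)" and K: "\<And>x. x \<in> Theta d \<Longrightarrow> \<pi>0 x / \<pi>0 \<theta>s \<le> K"
  defines "P \<equiv> (\<integral>x. indicator B x * (p x * g x) \<partial>lborel_d d) / Z"
    and "G \<equiv> (\<integral>x. indicator B x * q x \<partial>lborel_d d)"
  shows "\<bar>P - G\<bar> \<le> 40 * (s * real d / sqrt (real n * theta_min d \<theta>s) + \<delta> / sqrt (real n)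
     + K * exp (- (real d * (1 / 50 * s\<^sup>2))))"
proof -
  define a where "a = s * real d / sqrt (real n * theta_min d \<theta>s)"
  define b where "b = \<delta> / sqrt (real n)"
  define t where "t = exp (- (real d * (1 / 50 * s\<^sup>2)))"
  have a: "a > 0" unfolding a_def using s d n theta_min_pos[OF \<theta>s] by (intro divide_pos_pos) auto
  have b: "b \<ge> 0" using \<delta> by (simp add: b_def)
  have "\<pi>0 \<theta>s > 0" using prior \<theta>s by (auto simp: prior_density_def)
  then have K1: "K \<ge> 1" using K[OF \<theta>s] by simp
  have t: "t > 0" by (simp add: t_def)
  show ?thesis
  \<comment> \<open>The exponential in the chi-square bound is linearized only for
    \<open>2 * b^2 \<le> 1\<close>. Otherwise \<open>40 * b\<close> exceeds 1 and the claim is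
    trivial.\<close>
  proof (cases "2 * b\<^sup>2 \<le> 1")
    case False
    have "0 \<le> P" "P \<le> 1"
    proof -
      have int: "integrable (lborel_d d) (\<lambda>x. indicator B x * (p x * g x))"
        by (intro integrable_on integrable_pg B)
      have "0 \<le> (\<integral>x. indicator B x * (p x * g x) \<partial>lborel_d d)"
        using dir_density_nonneg g_nonneg by (intro integral_nonneg_AE) auto
      moreover have "(\<integral>x. indicator B x * (p x * g x) \<partial>lborel_d d) \<le> Z"
        unfolding Z_def using dir_density_nonneg g_nonneg
        by (intro integral_mono int integrable_pg) (auto simp: indicator_def)
      ultimately show "0 \<le> P" "P \<le> 1" using Z_pos by (auto simp: P_def)
    qed
    moreover have "0 \<le> G" "G \<le> 1"
    proof -
      have q0: "q x \<ge> 0" for x using gauss_density_pos[OF \<theta>s n] by (simp add: q_def less_imp_le)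
      then show "0 \<le> G" unfolding G_def by (intro integral_nonneg_AE) auto
      have "G \<le> (\<integral>x. q x \<partial>lborel_d d)"
        unfolding G_def using q0 by (intro integral_mono integrable_on integrable_q B) (auto simp: indicator_def)
      then show "G \<le> 1" unfolding integral_q .
    qed
    ultimately have "\<bar>P - G\<bar> \<le> 1" by linarith
    have "b \<ge> 1 / 2"
    proof (rule ccontr)
      assume "\<not> b \<ge> 1 / 2"
      then have "b\<^sup>2 \<le> (1 / 2)\<^sup>2" using b by (intro power_mono) auto
      with False show False by (simp add: power2_eq_square)
    qed
    then have "1 \<le> 40 * b" by simp
    with \<open>\<bar>P - G\<bar> \<le> 1\<close> have le1: "\<bar>P - G\<bar> \<le> 40 * b" by (rule order_trans)
    have "\<bar>P - G\<bar> \<le> 40 * (a + b + v)" if "0 \<le> v" for v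
    proof (rule order_trans[OF le1])
      show "40 * b \<le> 40 * (a + b + v)" using a that by (intro mult_left_mono) simp_all
    qed
    moreover have "0 \<le> K * t" using K1 t by simp
    ultimately have "\<bar>P - G\<bar> \<le> 40 * (a + b + K * t)" by blast
    then show ?thesis unfolding a_def b_def t_def .
  next
    case True
    \<comment> \<open>The chi-square bound asks for \<open>2 * b\<close>, as
      \<open>exp (2 * b^2) \<le> 1 + 4 * b^2\<close>. Adding \<open>a\<close>, which occurs in the
      bound anyway, keeps \<open>\<kappa>\<close> positive when \<open>b = 0\<close>.\<close>
    define \<kappa> where "\<kappa> = 2 * b + a"
    have \<kappa>: "\<kappa> > 0" using a b by (simp add: \<kappa>_def)
    define P1 where "P1 = (\<integral>x. indicator (B \<inter> U) x * (p x * g x) \<partial>lborel_d d) / Z_U"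
    define P2 where "P2 = (\<integral>x. indicator (B \<inter> U) x * p x \<partial>lborel_d d) / D_U"
    define P3 where "P3 = (\<integral>x. indicator B x * p x \<partial>lborel_d d)"
    have 1: "\<bar>P - P1\<bar> \<le> 2 * K * t"
    proof -
      have "\<bar>P - P1\<bar> \<le> (Z - Z_U) / Z"
        unfolding P_def P1_def Z_def Z_U_def using Z_pos(1) dir_density_nonneg g_nonneg
        by (intro renormalized_restriction_bound integrable_pg B U_measurable) (auto simp: Z_U_def)
      also have "\<dots> \<le> 2 * K * t" unfolding t_def by (rule prior_mass_outside[OF K])
      finally show ?thesis .
    qed
    have 2: "\<bar>P1 - P2\<bar> \<le> \<kappa>"
    proof -
      have intU: "integrable (lborel_d d) (\<lambda>x. indicator U x * p x)"
        "integrable (lborel_d d) (\<lambda>x. indicator U x * p x * g x)"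
        using integrable_on[OF integrable_p U_measurable] integrable_on[OF integrable_pg U_measurable]
        by (simp_all add: mult.assoc)
      have e: "indicator (B \<inter> U) x * y = indicator B x * (indicator U x * y)" for x :: "nat \<Rightarrow> real" and y :: real
        by (simp add: indicator_def)
      have ZU': "(\<integral>x. indicator U x * p x * g x \<partial>lborel_d d) = Z_U" by (simp add: Z_U_def mult.assoc)
      have "2 * \<delta>\<^sup>2 / real n = 2 * b\<^sup>2" using n by (simp add: b_def power_divide)
      moreover have "exp (2 * b\<^sup>2) \<le> 1 + \<kappa>\<^sup>2"
      proof -
        have "exp (2 * b\<^sup>2) \<le> 1 + 2 * b\<^sup>2 + (2 * b\<^sup>2)\<^sup>2" using True by (intro exp_bound) auto
        also have "(2 * b\<^sup>2)\<^sup>2 \<le> 1 * (2 * b\<^sup>2)"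
          unfolding power2_eq_square[of "2 * b\<^sup>2"] using True by (intro mult_right_mono) auto
        also have "1 + 2 * b\<^sup>2 + 1 * (2 * b\<^sup>2) = 1 + (2 * b)\<^sup>2" by (simp add: power_mult_distrib)
        also have "(2 * b)\<^sup>2 \<le> \<kappa>\<^sup>2" using a b by (intro power_mono) (auto simp: \<kappa>_def)
        finally show ?thesis by simp
      qed
      ultimately have "exp (2 * \<delta>\<^sup>2 / real n) * Z_U\<^sup>2 \<le> (1 + \<kappa>\<^sup>2) * Z_U\<^sup>2"
        by (simp only:) (intro mult_right_mono; simp)
      with chi_square_bound have le: "(\<integral>x. indicator U x * p x * (g x)\<^sup>2 \<partial>lborel_d d) * D_U \<le> (1 + \<kappa>\<^sup>2) * Z_U\<^sup>2"
        by linarith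
      have "\<bar>(\<integral>x. indicator B x * (indicator U x * p x * g x) \<partial>lborel_d d) / (\<integral>x. indicator U x * p x * g x \<partial>lborel_d d)
        - (\<integral>x. indicator B x * (indicator U x * p x) \<partial>lborel_d d) / (\<integral>x. indicator U x * p x \<partial>lborel_d d)\<bar> \<le> \<kappa>"
      proof (rule reweighting_bound[OF intU integrable_pgg _ B _ _ \<kappa>])
        show "0 < (\<integral>x. indicator U x * p x \<partial>lborel_d d)" using D_U(2) by (simp add: D_U_def)
        show "0 < (\<integral>x. indicator U x * p x * g x \<partial>lborel_d d)" using Z_pos(1) ZU' by simp
        show "(\<integral>x. indicator U x * p x * (g x)\<^sup>2 \<partial>lborel_d d) * (\<integral>x. indicator U x * p x \<partial>lborel_d d)
          \<le> (1 + \<kappa>\<^sup>2) * (\<integral>x. indicator U x * p x * g x \<partial>lborel_d d)\<^sup>2"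
          using le unfolding ZU' D_U_def[symmetric] .
      qed (simp add: dir_density_nonneg)
      then show ?thesis by (simp add: P1_def P2_def e Z_U_def D_U_def mult.assoc)
    qed
    have 3: "\<bar>P2 - P3\<bar> \<le> t"
    proof -
      have "\<bar>P3 / 1 - P2\<bar> \<le> (1 - D_U) / 1"
        unfolding P3_def P2_def D_U_def integral_p[symmetric] using D_U(2) dir_density_nonneg
        by (intro renormalized_restriction_bound integrable_p B U_measurable) (auto simp: D_U_def)
      then show ?thesis using D_U(1) tail_le(2) by (simp add: t_def)
    qed
    have q_pos: "q x > 0" for x using gauss_density_pos[OF \<theta>s n] by (simp add: q_def)
    have a15: "15 * a > 0" using a by simp
    have 4: "\<bar>P3 - G\<bar> \<le> 5 / 2 * (15 * a)"
      unfolding P3_def G_def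
    proof (rule kl_bound[where L = log_ratio_bound])
      show "integrable (lborel_d d) (\<lambda>x. p x * log_ratio_bound x)"
        using log_ratio_bound_integral by (simp add: has_bochner_integral_iff)
      show "ln (p x / q x) \<le> log_ratio_bound x" if "p x > 0" for x
        using that p_outside[of x] log_ratio_le[of x] by (cases "x \<in> Theta d") (auto simp: q_def)
      have "\<bar>rat j - 1\<bar> \<le> 1 / 2" if "j \<le> d" for j using rat_near_1[OF that] by simp
      then have "(\<integral>x. p x * log_ratio_bound x \<partial>lborel_d d) \<le> (15 * s * real d / sqrt (real n * theta_min d \<theta>s))\<^sup>2"
        using s chi by (intro kl_flat_le) auto
      then show "(\<integral>x. p x * log_ratio_bound x \<partial>lborel_d d) \<le> (15 * a)\<^sup>2" by (simp add: a_def mult.assoc)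
    qed (rule integrable_p integrable_q integral_p integral_q B dir_density_nonneg q_pos a15)+
    obtain u where u: "K * t = u" by blast
    have t_le: "0 < u" "t \<le> u" using K1 t unfolding u[symmetric] by auto
    have "\<bar>P - G\<bar> \<le> \<bar>P - P1\<bar> + \<bar>P1 - P2\<bar> + \<bar>P2 - P3\<bar> + \<bar>P3 - G\<bar>" by linarith
    also have "\<dots> \<le> 2 * K * t + \<kappa> + t + 5 / 2 * (15 * a)" by (intro add_mono 1 2 3 4)
    also have "\<dots> \<le> 40 * (a + b + K * t)" using a b t t_le by (simp add: \<kappa>_def mult.assoc u)
    finally have "\<bar>P - G\<bar> \<le> 40 * (a + b + K * t)" .
    then show ?thesis by (simp add: a_def b_def t_def)
  qed
qed

lemma TV_bound:
  assumes K: "\<And>x. x \<in> Theta d \<Longrightarrow> \<pi>0 x / \<pi>0 \<theta>s \<le> K"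
  shows "TV (posterior n d N \<pi>0) (gaussian d (MLE n d N) (minv (real n \<cdot>\<^sub>m fisher d \<theta>s)))
    \<le> 40 * (s * real d / sqrt (real n * theta_min d \<theta>s) + \<delta> / sqrt (real n)
     + K * exp (- (real d * (1 / 50 * s\<^sup>2))))"
  unfolding TV_def
proof (rule cSUP_least)
  fix B assume "B \<in> sets (posterior n d N \<pi>0)"
  then have B: "B \<in> sets (lborel_d d)" by (simp add: posterior_eq)
  have "measure (posterior n d N \<pi>0) B = (\<integral>x. indicator B x * (p x * g x / Z) \<partial>lborel_d d)"
    unfolding posterior_eq using integrable_pg dir_density_nonneg g_nonneg Z_pos B
    by (intro measure_density_real) auto
  also have "\<dots> = (\<integral>x. indicator B x * (p x * g x) \<partial>lborel_d d) / Z"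
    by simp
  finally have P: "measure (posterior n d N \<pi>0) B = (\<integral>x. indicator B x * (p x * g x) \<partial>lborel_d d) / Z" .
  have G: "measure (gaussian d (MLE n d N) (minv (real n \<cdot>\<^sub>m fisher d \<theta>s))) B = (\<integral>x. indicator B x * q x \<partial>lborel_d d)"
    unfolding gaussian_fisher[OF \<theta>s n] MLE_eq q_def[symmetric]
    using integrable_q gauss_density_pos[OF \<theta>s n] B
    by (intro measure_density_real) (auto simp: q_def less_imp_le)
  show "\<bar>measure (posterior n d N \<pi>0) B - measure (gaussian d (MLE n d N) (minv (real n \<cdot>\<^sub>m fisher d \<theta>s))) B\<bar>
     \<le> 40 * (s * real d / sqrt (real n * theta_min d \<theta>s) + \<delta> / sqrt (real n)
     + K * exp (- (real d * (1 / 50 * s\<^sup>2))))"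
    unfolding P G by (rule event_bound[OF B K])
qed auto

end

section \<open>From small relative entropy of the frequencies to small chi-square distance\<close>

lemma relative_entropy_quadratic:
  fixes x :: real
  assumes "x \<ge> 0" "x * ln x - x + 1 < 1 / 3"
  shows "(x - 1)\<^sup>2 / 4 \<le> x * ln x - x + 1"
proof -
  define f where "f x = x * ln x - x + 1 - (x - 1)\<^sup>2 / 4" for x :: real
  \<comment> \<open>At 0 the function is 1, since \<open>0 * ln 0 = 0\<close>.\<close>
  have "x \<noteq> 0" using assms(2) by auto
  then have x: "x > 0" using assms by simp
  \<comment> \<open>At 2 the function is \<open>2 * ln 2 - 1 \<ge> 1 / 3\<close>; the tangent of
    \<open>x * ln x\<close> at 2 extends this bound to larger \<open>x\<close>.\<close>
  have "x < 2"
  proof (rule ccontr)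
    assume "\<not> x < 2"
    have "ln (2 / x) \<le> 2 / x - 1" using x by (intro ln_le_minus_one) auto
    then have "ln x \<ge> ln 2 + 1 - 2 / x" using x by (simp add: ln_div)
    then have "x * ln x \<ge> x * (ln 2 + 1 - 2 / x)" using x by (intro mult_left_mono) auto
    also have "x * (ln 2 + 1 - 2 / x) = x * ln 2 + x - 2" using x by (simp add: algebra_simps)
    finally have "x * ln x - x + 1 \<ge> x * ln 2 - 1" by simp
    moreover have "x * ln 2 \<ge> 2 * (2 / 3)"
      using \<open>\<not> x < 2\<close> ln2_ge_two_thirds by (intro mult_mono) auto
    ultimately show False using assms(2) by simp
  qed
  have der: "(f has_real_derivative (ln y - (y - 1) / 2)) (at y)" if "y > 0" for y
    unfolding f_def using that by (auto intro!: derivative_eq_intros simp: field_simps)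
  have "f 1 \<le> f x"
  proof (cases "x \<ge> 1")
    case True
    show ?thesis
    proof (rule DERIV_nonneg_imp_nondecreasing[OF True])
      fix y assume y: "1 \<le> y" "y \<le> x"
      have "ln (1 / y) \<le> 1 / y - 1" using y by (intro ln_le_minus_one) auto
      then have "ln y \<ge> (y - 1) / y" using y by (simp add: ln_div diff_divide_distrib)
      moreover have "(y - 1) / y \<ge> (y - 1) / 2" using y \<open>x < 2\<close> by (intro divide_left_mono) auto
      ultimately have "0 \<le> ln y - (y - 1) / 2" by linarith
      then show "\<exists>D. (f has_real_derivative D) (at y) \<and> 0 \<le> D" using der[of y] y by auto
    qed
  next
    case False
    show ?thesis
    proof (rule DERIV_nonpos_imp_nonincreasing[of x 1])
      fix y assume y: "x \<le> y" "y \<le> 1"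
      have "ln y \<le> y - 1" using y x by (intro ln_le_minus_one) auto
      then show "\<exists>D. (f has_real_derivative D) (at y) \<and> D \<le> 0"
        using der[of y] y x by (intro exI[of _ "ln y - (y - 1) / 2"]) auto
    qed (use False in auto)
  qed
  then show ?thesis by (simp add: f_def)
qed

lemma relative_entropy_nonneg:
  fixes x :: real
  assumes "x \<ge> 0"
  shows "0 \<le> x * ln x - x + 1"
proof (cases "x = 0")
  case False
  then have x: "x > 0" using assms by simp
  have "ln (1 / x) \<le> 1 / x - 1" using x by (intro ln_le_minus_one) auto
  then have "x * (- ln x) \<le> x * (1 / x - 1)" using x by (intro mult_left_mono) (auto simp: ln_div)
  then show ?thesis using x by (simp add: algebra_simps)
qed simp

text \<open>The linear parts of \<open>h\<close> cancel in the sum, so the weighted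
  \<open>h j\<close> add up to the log likelihood ratio and each single \<open>h j\<close> is below
  \<open>1 / 4\<close>. This excludes \<open>N j = 0\<close>, where \<open>h j\<close> is 1, and
  puts every state in the range of the quadratic lower bound.\<close>

lemma likelihood_ratio_event:
  assumes \<theta>s: "\<theta>s \<in> Theta d" and n: "1 \<le> n" and N: "N \<in> comps d n"
    and le: "(\<Prod>j\<le>d. (real (N j) / (real n * full d \<theta>s j)) ^ N j) \<le> exp t"
    and t: "t < real n * theta_min d \<theta>s / 4"
  shows "\<And>j. j \<le> d \<Longrightarrow> 1 \<le> N j"
    and "(\<Sum>j\<le>d. (real (N j) / real n - full d \<theta>s j)\<^sup>2 / full d \<theta>s j) \<le> 4 * t / real n"
proof -
  define r where "r j = real (N j) / (real n * full d \<theta>s j)" for j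
  have nn: "real n > 0" using n by simp
  have pos: "full d \<theta>s j > 0" if "j \<le> d" for j using full_pos[OF \<theta>s that] .
  have r0: "r j \<ge> 0" if "j \<le> d" for j using pos[OF that] by (simp add: r_def)
  have Nr: "real (N j) = real n * full d \<theta>s j * r j" if "j \<le> d" for j
    using pos[OF that] nn by (simp add: r_def)
  \<comment> \<open>For \<open>N j = 0\<close> both sides are 1: \<open>0 ^ 0 = 1\<close>, and the
    value of \<open>ln 0\<close> is multiplied by 0.\<close>
  have pw: "r j ^ N j = exp (real (N j) * ln (r j))" if j: "j \<le> d" for j
  proof (cases "N j = 0")
    case False
    then have "r j > 0" using pos[OF j] nn by (simp add: r_def)
    then show ?thesis by (simp add: exp_of_nat_mult)
  qed simp
  have "exp (\<Sum>j\<le>d. real (N j) * ln (r j)) \<le> exp t"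
    using le pw by (simp add: exp_sum r_def)
  then have sum_le: "(\<Sum>j\<le>d. real (N j) * ln (r j)) \<le> t" by simp
  define h where "h j = r j * ln (r j) - r j + 1" for j
  have h0: "0 \<le> h j" if "j \<le> d" for j unfolding h_def by (rule relative_entropy_nonneg[OF r0[OF that]])
  have "(\<Sum>j\<le>d. real n * full d \<theta>s j * h j)
    = (\<Sum>j\<le>d. real (N j) * ln (r j) + (real n * full d \<theta>s j - real (N j)))"
  proof (rule sum.cong)
    fix j assume "j \<in> {..d}"
    then have j: "j \<le> d" by simp
    show "real n * full d \<theta>s j * h j = real (N j) * ln (r j) + (real n * full d \<theta>s j - real (N j))"
      unfolding h_def Nr[OF j] by (simp add: algebra_simps)
  qed simp
  also have "\<dots> = (\<Sum>j\<le>d. real (N j) * ln (r j)) + (real n * (\<Sum>j\<le>d. full d \<theta>s j) - real (\<Sum>j\<le>d. N j))"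
    by (simp add: sum.distrib sum_subtractf sum_distrib_left)
  also have "real n * (\<Sum>j\<le>d. full d \<theta>s j) - real (\<Sum>j\<le>d. N j) = 0"
    using sum_full[of d \<theta>s] N by (simp add: atLeast0AtMost comps_def)
  finally have S: "(\<Sum>j\<le>d. real n * full d \<theta>s j * h j) \<le> t" using sum_le by simp
  have term_nonneg: "0 \<le> real n * full d \<theta>s j * h j" if "j \<le> d" for j
    using h0[OF that] pos[OF that] nn by simp
  have h_small: "h j < 1 / 4" if j: "j \<le> d" for j
  proof -
    have "real n * full d \<theta>s j * h j \<le> (\<Sum>j\<le>d. real n * full d \<theta>s j * h j)"
      using term_nonneg j by (intro member_le_sum) auto
    also have "\<dots> < real n * theta_min d \<theta>s / 4" using S t by simp
    also have "\<dots> \<le> real n * full d \<theta>s j / 4"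
      using theta_min_le[OF j] nn by (simp add: mult_left_mono)
    finally have "real n * full d \<theta>s j * h j < real n * full d \<theta>s j * (1 / 4)" by simp
    then show ?thesis using pos[OF j] nn by (simp add: mult_less_cancel_left)
  qed
  have quad: "(r j - 1)\<^sup>2 / 4 \<le> h j" if j: "j \<le> d" for j
    using h_small[OF j] unfolding h_def by (intro relative_entropy_quadratic r0[OF j]) auto
  show "1 \<le> N j" if j: "j \<le> d" for j
  proof (rule ccontr)
    assume "\<not> 1 \<le> N j"
    then have "h j = 1" by (simp add: h_def r_def)
    then show False using h_small[OF j] by simp
  qed
  have "real n / 4 * (\<Sum>j\<le>d. (real (N j) / real n - full d \<theta>s j)\<^sup>2 / full d \<theta>s j) \<le> (\<Sum>j\<le>d. real n * full d \<theta>s j * h j)"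
    unfolding sum_distrib_left
  proof (rule sum_mono)
    fix j assume "j \<in> {..d}"
    then have j: "j \<le> d" by simp
    have "real (N j) / real n - full d \<theta>s j = full d \<theta>s j * (r j - 1)"
      using Nr[OF j] nn by (simp add: algebra_simps)
    then have "real n / 4 * ((real (N j) / real n - full d \<theta>s j)\<^sup>2 / full d \<theta>s j) = real n * full d \<theta>s j * ((r j - 1)\<^sup>2 / 4)"
      using pos[OF j] by (simp add: power2_eq_square)
    also have "\<dots> \<le> real n * full d \<theta>s j * h j"
      using pos[OF j] nn by (intro mult_left_mono quad j) auto
    finally show "real n / 4 * ((real (N j) / real n - full d \<theta>s j)\<^sup>2 / full d \<theta>s j) \<le> real n * full d \<theta>s j * h j" .
  qed
  then have "real n / 4 * (\<Sum>j\<le>d. (real (N j) / real n - full d \<theta>s j)\<^sup>2 / full d \<theta>s j) \<le> t" using S by simp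
  then show "(\<Sum>j\<le>d. (real (N j) / real n - full d \<theta>s j)\<^sup>2 / full d \<theta>s j) \<le> 4 * t / real n"
    using nn by (simp add: field_simps)
qed

text \<open>If the prior is unbounded, the last term of the bound is infinite and the bound is
  trivial. Otherwise the supremum is a real number \<open>K\<close>, and the exponential of its
  logarithm gives it back.\<close>

lemma M0_cases:
  assumes \<theta>s: "\<theta>s \<in> Theta d" and prior: "prior_density d \<pi>0" and d: "1 \<le> d"
  obtains "exp_ereal (ereal (real d) * (M0 d \<theta>s \<pi>0 - ereal c)) = \<infinity>"
  | K where "\<And>x. x \<in> Theta d \<Longrightarrow> \<pi>0 x / \<pi>0 \<theta>s \<le> K"
     "exp_ereal (ereal (real d) * (M0 d \<theta>s \<pi>0 - ereal c)) = ereal (K * exp (- (real d * c)))"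
proof -
  define S where "S = (SUP x\<in>Theta d. ereal (\<pi>0 x / \<pi>0 \<theta>s))"
  have pos: "\<pi>0 \<theta>s > 0" using prior \<theta>s by (auto simp: prior_density_def)
  have S1: "1 \<le> S" unfolding S_def using pos by (intro SUP_upper2[OF \<theta>s]) (simp add: one_ereal_def)
  show thesis
  proof (cases S)
    case PInf
    then show ?thesis using that(1) d by (simp add: M0_def S_def[symmetric] ln_ereal_def exp_ereal_def)
  next
    case MInf
    then show ?thesis using S1 by simp
  next
    case (real K)
    then have K1: "K \<ge> 1" using S1 by (simp add: one_ereal_def)
    have "M0 d \<theta>s \<pi>0 = ereal (ln K / real d)"
      using real K1 d by (simp add: M0_def S_def[symmetric] ln_ereal_def)
    then have "ereal (real d) * (M0 d \<theta>s \<pi>0 - ereal c) = ereal (ln K - real d * c)"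
      using d by (simp add: right_diff_distrib)
    then have "exp_ereal (ereal (real d) * (M0 d \<theta>s \<pi>0 - ereal c)) = ereal (K * exp (- (real d * c)))"
      using K1 by (simp add: exp_ereal_def exp_diff exp_minus divide_inverse)
    moreover have "\<pi>0 x / \<pi>0 \<theta>s \<le> K" if "x \<in> Theta d" for x
    proof -
      have "ereal (\<pi>0 x / \<pi>0 \<theta>s) \<le> S" unfolding S_def by (intro SUP_upper that)
      then show ?thesis using real by simp
    qed
    ultimately show ?thesis using that(2) by blast
  qed
qed

text \<open>The supremum runs over a set containing \<open>\<theta>s\<close>, hence is not that of
  the empty set. Together with the upper bound assumed on it this makes \<open>delta01\<close> a
  real number.\<close>

lemma delta01_nonneg:
  assumes \<theta>s: "\<theta>s \<in> Theta d" and s: "0 \<le> s"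
  shows "0 \<le> delta01 n d \<theta>s \<pi>0 s"
proof (cases "C1_on d \<pi>0 (Ustar n d \<theta>s s) \<and> (\<forall>\<theta>\<in>Ustar n d \<theta>s s. 0 < \<pi>0 \<theta>)")
  case True
  have "\<theta>s \<in> Ustar n d \<theta>s s"
    using \<theta>s unfolding Ustar_eq[OF assms] by (auto simp: Theta_def fisher_sq_def)
  moreover have "0 \<le> ereal (wnorm_dual (fisher d \<theta>s) d (grad d (\<lambda>x. ln (\<pi>0 x)) \<theta>s))"
    by (simp add: wnorm_dual_def vnorm_def scalar_prod_self_nonneg)
  ultimately show ?thesis using True unfolding delta01_def by (auto intro: SUP_upper2)
qed (auto simp: delta01_def)

theorem corollary5p7:
  shows "\<exists>s\<^sub>0 c\<^sub>0 c\<^sub>1 c\<^sub>2 C :: real.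
    0 < s\<^sub>0 \<and> 0 < c\<^sub>0 \<and> 0 < c\<^sub>1 \<and> 0 < c\<^sub>2 \<and> 0 < C \<and>
    (\<forall>(d :: nat) (n :: nat) (\<theta>s :: nat \<Rightarrow> real) (\<pi>\<^sub>0 :: (nat \<Rightarrow> real) \<Rightarrow> real) (s :: real).
       1 \<le> d \<longrightarrow> 1 \<le> n \<longrightarrow> \<theta>s \<in> Theta d \<longrightarrow> prior_density d \<pi>\<^sub>0 \<longrightarrow>
       s\<^sub>0 \<le> s \<longrightarrow>
       s\<^sup>2 * real d / (real n * theta_min d \<theta>s) \<le> c\<^sub>0 \<longrightarrow>
       delta01 n d \<theta>s \<pi>\<^sub>0 (2 * s) \<le> ereal (sqrt (real n * real d) / 6) \<longrightarrow>
       (\<exists>E :: (nat \<Rightarrow> nat) set.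
          1 - exp (- c\<^sub>1 * real d * s\<^sup>2) \<le> measure_pmf.prob (multinomial_pmf n d \<theta>s) E \<and>
          (\<forall>N \<in> E.
             (\<exists>!t. is_MLE n d N t) \<and>
             ereal (TV (posterior n d N \<pi>\<^sub>0)
                       (gaussian d (MLE n d N) (minv (real n \<cdot>\<^sub>m fisher d \<theta>s))))
             \<le> ereal C *
                 (ereal (s * real d / sqrt (real n * theta_min d \<theta>s))
                  + delta01 n d \<theta>s \<pi>\<^sub>0 (2 * s) / ereal (sqrt (real n))
                  + exp_ereal (ereal (real d) * (M0 d \<theta>s \<pi>\<^sub>0 - ereal (c\<^sub>2 * s\<^sup>2)))))))"
\<comment> \<open>\<open>10\<close> and \<open>1 / 400\<close> are the thresholds of
  \<open>good_counts\<close>, \<open>1 / 50\<close> stems from the tails and \<open>40\<close> from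
  the total variation bound. \<open>1 / 16\<close> is half of the rate \<open>1 / 8\<close> of the
  event; the other half absorbs \<open>4 ^ d\<close>.\<close>
proof (rule exI[of _ 10], rule exI[of _ "1 / 400"], rule exI[of _ "1 / 16"], rule exI[of _ "1 / 50"],
    rule exI[of _ 40], intro conjI allI impI)
  fix d n :: nat and \<theta>s :: "nat \<Rightarrow> real" and \<pi>\<^sub>0 :: "(nat \<Rightarrow> real) \<Rightarrow> real" and s :: real
  assume d: "1 \<le> d" and n: "1 \<le> n" and \<theta>s: "\<theta>s \<in> Theta d" and prior: "prior_density d \<pi>\<^sub>0"
    and s: "10 \<le> s" and small: "s\<^sup>2 * real d / (real n * theta_min d \<theta>s) \<le> 1 / 400"
    and delta: "delta01 n d \<theta>s \<pi>\<^sub>0 (2 * s) \<le> ereal (sqrt (real n * real d) / 6)"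
  have nonneg: "0 \<le> delta01 n d \<theta>s \<pi>\<^sub>0 (2 * s)" using s by (intro delta01_nonneg \<theta>s) auto
  obtain \<delta> where delta_eq: "delta01 n d \<theta>s \<pi>\<^sub>0 (2 * s) = ereal \<delta>"
    using delta nonneg by (cases "delta01 n d \<theta>s \<pi>\<^sub>0 (2 * s)") auto
  have nn: "real n > 0" and dd: "real d \<ge> 1" using n d by auto
  \<comment> \<open>Under this threshold for \<open>n\<close> times the relative entropy the
    chi-square distance is at most four times as much over \<open>n\<close>, which is the radius
    \<open>s^2 * d / n\<close> required in \<open>good_counts\<close>.\<close>
  define E where "E = {N \<in> comps d n. (\<Prod>j\<le>d. (real (N j) / (real n * full d \<theta>s j)) ^ N j) \<le> exp (s\<^sup>2 * real d / 4)}"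
  have prob: "1 - exp (- (1 / 16) * real d * s\<^sup>2) \<le> measure_pmf.prob (multinomial_pmf n d \<theta>s) E"
  proof -
    have s2: "s\<^sup>2 \<ge> 100" using power_mono[of 10 s 2] s by simp
    have "(4::real) ^ d \<le> exp 2 ^ d"
    proof (rule power_mono)
      have "(2::real) * 2 \<le> exp 1 * exp 1" using exp_ge_add_one_self[of 1] by (intro mult_mono) auto
      then show "(4::real) \<le> exp 2" by (simp add: mult_exp_exp)
    qed simp
    also have "\<dots> = exp (real d * 2)" by (simp add: exp_of_nat_mult)
    finally have "4 ^ d * exp (- (s\<^sup>2 * real d / 4) / 2) \<le> exp (real d * 2) * exp (- (s\<^sup>2 * real d / 4) / 2)"
      by (intro mult_right_mono) auto
    also have "\<dots> = exp (real d * (2 - s\<^sup>2 / 8))" by (simp add: mult_exp_exp algebra_simps)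
    also have "real d * (2 - s\<^sup>2 / 8) \<le> real d * (- (1 / 16) * s\<^sup>2)"
      using s2 by (intro mult_left_mono) auto
    finally have "4 ^ d * exp (- (s\<^sup>2 * real d / 4) / 2) \<le> exp (- (1 / 16) * real d * s\<^sup>2)" by (simp add: mult_ac)
    then show ?thesis
      using multinomial_likelihood_ratio_tail[OF \<theta>s n, of "s\<^sup>2 * real d / 4"] unfolding E_def by linarith
  qed
  have good: "good_counts d n \<theta>s N s \<delta> \<pi>\<^sub>0" if N: "N \<in> E" for N
  proof -
    have tm: "theta_min d \<theta>s > 0" by (rule theta_min_pos[OF \<theta>s])
    have "s\<^sup>2 * real d \<le> real n * theta_min d \<theta>s / 400"
      using small tm nn by (simp add: pos_divide_le_eq)
    moreover have "real n * theta_min d \<theta>s > 0" using tm nn by simp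
    ultimately have t: "s\<^sup>2 * real d / 4 < real n * theta_min d \<theta>s / 4" by linarith
    have NC: "N \<in> comps d n" using N by (simp add: E_def)
    have le: "(\<Prod>j\<le>d. (real (N j) / (real n * full d \<theta>s j)) ^ N j) \<le> exp (s\<^sup>2 * real d / 4)"
      using N by (simp add: E_def)
    note ev = likelihood_ratio_event[OF \<theta>s n NC le t]
    interpret counts d n \<theta>s N by unfold_locales (use d n \<theta>s NC ev(1) in auto)
    have "fisher_sq d \<theta>s (\<lambda>j. mle j - \<theta>s j) = (\<Sum>j\<le>d. (real (N j) / real n - full d \<theta>s j)\<^sup>2 / full d \<theta>s j)"
      unfolding fisher_sq_full by (intro sum.cong) (auto simp: full_mle)
    also have "\<dots> \<le> s\<^sup>2 * (real d / real n)" using ev(2) by simp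
    finally have "fisher_sq d \<theta>s (\<lambda>j. mle j - \<theta>s j) \<le> s\<^sup>2 * (real d / real n)" .
    then show ?thesis
      using s small prior delta_eq nonneg delta by unfold_locales auto
  qed
  show "\<exists>E. 1 - exp (- (1 / 16) * real d * s\<^sup>2) \<le> measure_pmf.prob (multinomial_pmf n d \<theta>s) E \<and>
          (\<forall>N \<in> E.
             (\<exists>!t. is_MLE n d N t) \<and>
             ereal (TV (posterior n d N \<pi>\<^sub>0)
                       (gaussian d (MLE n d N) (minv (real n \<cdot>\<^sub>m fisher d \<theta>s))))
             \<le> ereal 40 *
                 (ereal (s * real d / sqrt (real n * theta_min d \<theta>s))
                  + delta01 n d \<theta>s \<pi>\<^sub>0 (2 * s) / ereal (sqrt (real n))
                  + exp_ereal (ereal (real d) * (M0 d \<theta>s \<pi>\<^sub>0 - ereal (1 / 50 * s\<^sup>2)))))"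
  proof (intro exI[of _ E] conjI prob ballI)
    fix N assume N: "N \<in> E"
    interpret good_counts d n \<theta>s N s \<delta> \<pi>\<^sub>0 by (rule good[OF N])
    show "\<exists>!t. is_MLE n d N t" unfolding is_MLE_iff by auto
    have quot: "ereal \<delta> / ereal (sqrt (real n)) = ereal (\<delta> / sqrt (real n))" using nn by simp
    show "ereal (TV (posterior n d N \<pi>\<^sub>0)
                       (gaussian d (MLE n d N) (minv (real n \<cdot>\<^sub>m fisher d \<theta>s))))
             \<le> ereal 40 *
                 (ereal (s * real d / sqrt (real n * theta_min d \<theta>s))
                  + delta01 n d \<theta>s \<pi>\<^sub>0 (2 * s) / ereal (sqrt (real n))
                  + exp_ereal (ereal (real d) * (M0 d \<theta>s \<pi>\<^sub>0 - ereal (1 / 50 * s\<^sup>2))))"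
    proof (cases rule: M0_cases[OF \<theta>s prior d, of "1 / 50 * s\<^sup>2"])
      case 1
      then show ?thesis unfolding delta_eq quot by simp
    next
      case (2 K)
      then show ?thesis unfolding delta_eq quot using TV_bound[OF 2(1)] by simp
    qed
  qed
qed auto

end
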